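(* Let $m,n\geq 1$ be integers. There does not exist a Kähler manifold $(X,\omega_X)$ of positive dimension that can be holomorphically isometrically embedded into the complex Euclidean space $(\mathbb{C}^m,\omega_{\mathbb{C}^m})$ and also into the symmetrized polydisc $(\mathbb{G}_n,\omega_{\mathbb{G}_n})$. That is, there is no Kähler manifold $(X,\omega_X)$ of positive dimension admitting both a holomorphic embedding $F:X\to\mathbb{C}^m$ with $F^{*}\omega_{\mathbb{C}^m}=\omega_X$ and a holomorphic embedding $G:X\to\mathbb{G}_n$ with $G^{*}\omega_{\mathbb{G}_n}=\omega_X$.
   Context: Let $\mathbb{D}$ be the unit disc in $\mathbb{C}$. The symmetrization map $\pi_n=(\pi_{n,1},\ldots,\pi_{n,n}):\mathbb{C}^n\to\mathbb{C}^n$ is given by the elementary symmetric polynomials $$\pi_{n,k}(\lambda)=\sum_{1\leq j_1<\cdots<j_k\leq n}\lambda_{j_1}\cdots\lambda_{j_k},\quad 1\leq k\leq n,\ \lambda=(\lambda_1,\ldots,\lambda_n)\in\mathbb{C}^n.$$ The symmetrized polydisc is $\mathbb{G}_n:=\pi_n(\mathbb{D}^n)$, a bounded domain in $\mathbb{C}^n$ (with $\mathbb{G}_1=\mathbb{D}$). Metrics are identified with their Kähler forms. Kähler metrics are not required to be complete. The Euclidean metric on $\mathbb{C}^m$ is $\omega_{\mathbb{C}^m}=\sqrt{-1}\,\partial\bar\partial\sum_{i=1}^m|z_i|^2$. Let $K_{\mathbb{G}_n}(\cdot,\cdot)$ be the Bergman kernel of $\mathbb{G}_n$, i.e. the reproducing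 kernel of the Hilbert space of square-integrable (with respect to Lebesgue measure) holomorphic functions on $\mathbb{G}_n$; it is holomorphic in the first variable and anti-holomorphic in the second. The Bergman metric on $\mathbb{G}_n$ is $\omega_{\mathbb{G}_n}=\sqrt{-1}\,\partial\bar\partial\log K_{\mathbb{G}_n}(\xi,\xi)$. *)

theory Defs
  imports "HOL-Analysis.Analysis"
begin

section \<open>Holomorphic and smooth functions of several complex variables\<close>

definition holomorphic_fun_on :: "(complex^'n \<Rightarrow> complex) \<Rightarrow> (complex^'n) set \<Rightarrow> bool" where
  "holomorphic_fun_on f S \<longleftrightarrow>
     (\<forall>z\<in>S. \<exists>a::complex^'n. (f has_derivative (\<lambda>v. \<Sum>i\<in>UNIV. a $ i * v $ i)) (at z))"

definition holomorphic_map_on :: "(complex^'n \<Rightarrow> complex^'m) \<Rightarrow> (complex^'n) set \<Rightarrow> bool" where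
  "holomorphic_map_on F S \<longleftrightarrow> (\<forall>j. holomorphic_fun_on (\<lambda>z. F z $ j) S)"

text \<open>\<open>C\<^sup>k\<close> in the real sense, by iterated directional derivatives; used for open \<open>S\<close> only.\<close>

primrec Ck_on :: "nat \<Rightarrow> ('a::euclidean_space \<Rightarrow> 'b::real_normed_vector) \<Rightarrow> 'a set \<Rightarrow> bool" where
  "Ck_on 0 f S \<longleftrightarrow> continuous_on S f"
| "Ck_on (Suc k) f S \<longleftrightarrow>
     (\<forall>z\<in>S. f differentiable (at z)) \<and> (\<forall>v. Ck_on k (\<lambda>z. frechet_derivative f (at z) v) S)"

definition smooth_fun_on :: "('a::euclidean_space \<Rightarrow> 'b::real_normed_vector) \<Rightarrow> 'a set \<Rightarrow> bool" where
  "smooth_fun_on f S \<longleftrightarrow> (\<forall>k. Ck_on k f S)"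


section \<open>Two-forms on open subsets of complex n-space\<close>

text \<open>A two-form assigns to a point \<open>z\<close> a real-bilinear function of two tangent vectors
  in \<open>\<complex>\<^sup>n\<close>, with complex values.\<close>

type_synonym 'n two_form = "complex^'n \<Rightarrow> complex^'n \<Rightarrow> complex^'n \<Rightarrow> complex"

definition pullback_form :: "(complex^'n \<Rightarrow> complex^'m) \<Rightarrow> 'm two_form \<Rightarrow> 'n two_form" where
  "pullback_form F \<omega> z u v =
     \<omega> (F z) (frechet_derivative F (at z) u) (frechet_derivative F (at z) v)"

definition d_z :: "'n \<Rightarrow> (complex^'n \<Rightarrow> complex) \<Rightarrow> complex^'n \<Rightarrow> complex" where
  "d_z i f z = (frechet_derivative f (at z) (axis i 1)
                - \<i> * frechet_derivative f (at z) (axis i \<i>)) / 2"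

definition d_zbar :: "'n \<Rightarrow> (complex^'n \<Rightarrow> complex) \<Rightarrow> complex^'n \<Rightarrow> complex" where
  "d_zbar i f z = (frechet_derivative f (at z) (axis i 1)
                   + \<i> * frechet_derivative f (at z) (axis i \<i>)) / 2"

text \<open>The form \<open>\<i> \<partial>\<partial>\<^sup>-\<phi> = \<i> \<Sum> \<partial>\<^sub>i\<partial>\<^sup>-\<^sub>j\<phi> dz\<^sub>i \<and> dz\<^sup>-\<^sub>j\<close>, with the convention
  \<open>(\<alpha> \<and> \<beta>)(u,v) = \<alpha>(u) \<beta>(v) - \<alpha>(v) \<beta>(u)\<close>.\<close>

definition i_ddbar :: "(complex^'n \<Rightarrow> real) \<Rightarrow> 'n two_form" where
  "i_ddbar \<phi> z u v = \<i> * (\<Sum>i\<in>UNIV. \<Sum>j\<in>UNIV.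
      d_z i (d_zbar j (\<lambda>x. complex_of_real (\<phi> x))) z * (u $ i * cnj (v $ j) - v $ i * cnj (u $ j)))"

text \<open>Kaehler forms: smooth, real, of type (1,1) (invariant under multiplication by \<open>\<i>\<close>),
  positive and closed. In the last clause \<open>d\<omega>(u,v,w)\<close> is evaluated on constant vector fields.\<close>

definition kaehler_form_on :: "(complex^'n) set \<Rightarrow> 'n two_form \<Rightarrow> bool" where
  "kaehler_form_on S \<omega> \<longleftrightarrow>
     (\<forall>z\<in>S. bilinear (\<omega> z)) \<and>
     (\<forall>z\<in>S. \<forall>u v. \<omega> z v u = - \<omega> z u v) \<and>
     (\<forall>u v. smooth_fun_on (\<lambda>z. \<omega> z u v) S) \<and>
     (\<forall>z\<in>S. \<forall>u v. \<omega> z u v \<in> \<real>) \<and>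
     (\<forall>z\<in>S. \<forall>u v. \<omega> z (\<i> *s u) (\<i> *s v) = \<omega> z u v) \<and>
     (\<forall>z\<in>S. \<forall>u. u \<noteq> 0 \<longrightarrow> 0 < Re (\<omega> z u (\<i> *s u))) \<and>
     (\<forall>z\<in>S. \<forall>u v w. frechet_derivative (\<lambda>x. \<omega> x v w) (at z) u
                   - frechet_derivative (\<lambda>x. \<omega> x u w) (at z) v
                   + frechet_derivative (\<lambda>x. \<omega> x u v) (at z) w = 0)"


section \<open>Complex manifolds and Kaehler manifolds\<close>

text \<open>A chart is a pair \<open>(U, \<phi>)\<close>; the values of \<open>\<phi>\<close> outside \<open>U\<close> are irrelevant. The complex
  dimension is \<open>CARD('d)\<close>, which is always positive. Connectedness is not required.\<close>

type_synonym ('x, 'd) chart = "'x set \<times> ('x \<Rightarrow> complex^'d)"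

locale complex_manifold =
  fixes X :: "'x topology" and A :: "('x, 'd::finite) chart set"
  assumes nonempty: "topspace X \<noteq> {}"
    and Hausdorff: "Hausdorff_space X"
    and second_countable: "second_countable X"
    and covering: "(\<Union>(U, \<phi>)\<in>A. U) = topspace X"
    and chart_dom: "(U, \<phi>) \<in> A \<Longrightarrow> openin X U"
    and chart_ran: "(U, \<phi>) \<in> A \<Longrightarrow> open (\<phi> ` U)"
    and chart_homeo: "(U, \<phi>) \<in> A \<Longrightarrow>
          homeomorphic_map (subtopology X U) (top_of_set (\<phi> ` U)) \<phi>"
    and transition: "(U, \<phi>) \<in> A \<Longrightarrow> (V, \<psi>) \<in> A \<Longrightarrow>
          holomorphic_map_on (\<psi> \<circ> inv_into U \<phi>) (\<phi> ` (U \<inter> V))"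

text \<open>A form on the manifold is given by its coordinate representation in every chart
  (\<open>\<omega> (U, \<phi>)\<close> on \<open>\<phi> ` U\<close>), the representations being related by the coordinate changes.\<close>

locale kaehler_manifold = complex_manifold X A
  for X :: "'x topology" and A :: "('x, 'd::finite) chart set" +
  fixes \<omega> :: "('x, 'd) chart \<Rightarrow> 'd two_form"
  assumes kaehler: "(U, \<phi>) \<in> A \<Longrightarrow> kaehler_form_on (\<phi> ` U) (\<omega> (U, \<phi>))"
    and compatible: "(U, \<phi>) \<in> A \<Longrightarrow> (V, \<psi>) \<in> A \<Longrightarrow> z \<in> \<phi> ` (U \<inter> V) \<Longrightarrow>
          \<omega> (U, \<phi>) z = pullback_form (\<psi> \<circ> inv_into U \<phi>) (\<omega> (V, \<psi>)) z"

text \<open>Holomorphic embedding into an open set \<open>S\<close> of \<open>\<complex>\<^sup>m\<close>: a holomorphic immersion that is a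
  homeomorphism onto its image.\<close>

definition holomorphic_embedding ::
    "'x topology \<Rightarrow> ('x, 'd::finite) chart set \<Rightarrow> (complex^'m) set \<Rightarrow> ('x \<Rightarrow> complex^'m) \<Rightarrow> bool" where
  "holomorphic_embedding X A S F \<longleftrightarrow>
     F ` topspace X \<subseteq> S \<and>
     embedding_map X (top_of_set S) F \<and>
     (\<forall>(U, \<phi>)\<in>A. holomorphic_map_on (F \<circ> inv_into U \<phi>) (\<phi> ` U) \<and>
        (\<forall>z\<in>\<phi> ` U. inj (frechet_derivative (F \<circ> inv_into U \<phi>) (at z))))"

text \<open>\<open>F\<^sup>*\<Omega> = \<omega>\<close>, read off in every chart.\<close>

definition isometric_map ::
    "('x, 'd::finite) chart set \<Rightarrow> (('x, 'd) chart \<Rightarrow> 'd two_form) \<Rightarrow> 'm two_form \<Rightarrow>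
     ('x \<Rightarrow> complex^'m) \<Rightarrow> bool" where
  "isometric_map A \<omega> \<Omega> F \<longleftrightarrow>
     (\<forall>(U, \<phi>)\<in>A. \<forall>z\<in>\<phi> ` U. pullback_form (F \<circ> inv_into U \<phi>) \<Omega> z = \<omega> (U, \<phi>) z)"

definition euclidean_form :: "'m::finite two_form" where
  "euclidean_form = i_ddbar (\<lambda>z. \<Sum>i\<in>UNIV. (cmod (z $ i))\<^sup>2)"


section \<open>Bergman kernel and Bergman metric\<close>

definition bergman_space :: "(complex^'n) set \<Rightarrow> (complex^'n \<Rightarrow> complex) set" where
  "bergman_space S =
     {f. holomorphic_fun_on f S \<and> set_integrable lborel S (\<lambda>z. (cmod (f z))\<^sup>2)}"

definition is_bergman_kernel ::
    "(complex^'n) set \<Rightarrow> (complex^'n \<Rightarrow> complex^'n \<Rightarrow> complex) \<Rightarrow> bool" where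
  "is_bergman_kernel S K \<longleftrightarrow>
     (\<forall>w\<in>S. (\<lambda>z. K z w) \<in> bergman_space S \<and>
        (\<forall>f\<in>bergman_space S. f w = set_lebesgue_integral lborel S (\<lambda>z. f z * cnj (K z w))))"

text \<open>The reproducing kernel is uniquely determined on \<open>S \<times> S\<close>; the choice operator only
  affects its values elsewhere.\<close>

definition bergman_kernel :: "(complex^'n) set \<Rightarrow> complex^'n \<Rightarrow> complex^'n \<Rightarrow> complex" where
  "bergman_kernel S = (SOME K. is_bergman_kernel S K)"

text \<open>\<open>K(\<xi>,\<xi>)\<close> is real, being the squared norm of \<open>K(\<cdot>,\<xi>)\<close>, hence the real part below.\<close>

definition bergman_form :: "(complex^'n) set \<Rightarrow> 'n two_form" where
  "bergman_form S = i_ddbar (\<lambda>\<xi>. ln (Re (bergman_kernel S \<xi> \<xi>)))"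


section \<open>The symmetrized polydisc\<close>

text \<open>The linear order on the index type serves only to number the coordinates of \<open>\<complex>\<^sup>n\<close> by
  \<open>1, \<dots>, n\<close>: the index \<open>i\<close> has number \<open>card {..i}\<close>.\<close>

definition elem_sym :: "nat \<Rightarrow> complex^'n \<Rightarrow> complex" where
  "elem_sym k x = (\<Sum>J\<in>{J. card J = k}. \<Prod>j\<in>J. x $ j)"

definition symmetrization :: "complex^'n::{finite,linorder} \<Rightarrow> complex^'n::{finite,linorder}" where
  "symmetrization x = (\<chi> i. elem_sym (card {..i}) x)"

definition symmetrized_polydisc :: "(complex^'n::{finite,linorder}) set" where
  "symmetrized_polydisc = symmetrization ` {x. \<forall>j. cmod (x $ j) < 1}"

end

theory Submission
  imports Defs "HOL-Complex_Analysis.Complex_Analysis" "HOL-Computational_Algebra.Fundamental_Theorem_Algebra"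
begin

text \<open>Pulled back along the symmetrization map, the Bergman kernel of the symmetrized polydisc is the
  antisymmetrization of the kernel of the polydisc divided by two Vandermonde determinants. Dividing
  \<open>1 / (1 - t b)\<^sup>2\<close> with remainder modulo the polynomials with roots \<open>\<lambda>\<close> and \<open>\<mu>\<close> shows that it equals
  \<open>N(\<xi>, \<eta>\<^sup>-) / M(\<xi>, \<eta>\<^sup>-)\<^sup>2\<close> up to a constant, with polynomials \<open>N\<close> and \<open>M\<close>.

  On a holomorphic disc in a common submanifold, with coordinates \<open>f\<close> in the Euclidean space and
  \<open>g\<close> in the domain, equality of the metrics polarizes to
  \<open>\<psi> N M = N\<^sub>s M - 2 M\<^sub>s N\<close> with \<open>\<psi>(z,s) = \<Sum> f\<^sub>j(z) (f\<^sub>j'(s\<^sup>-))\<^sup>- + h(s)\<close>, where \<open>N\<close> and \<open>M\<close> are now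
  evaluated along \<open>g\<close>. All these kernels have finite rank, hence as power series in \<open>s\<close> over the
  field of formal Laurent series in \<open>z\<close> they have a content with respect to any valuation trivial on
  the constants, and by the Gauss lemma a logarithmic derivative has integral coefficients. So
  \<open>\<psi>(z,0)\<close> lies in every valuation ring containing the constants, which makes it constant, whereas
  its derivative at the origin is \<open>\<Sum> |f\<^sub>j'(0)|\<^sup>2 > 0\<close>.\<close>

no_notation fps_nth (infixl "$" 75)

section \<open>Valuation rings\<close>

text \<open>The z-adic valuation alone proves nothing: every kernel here is a power series in z and
  so already integral for it. The valuation has to be adapted to the function. If x = psi(z,0) -
  psi(0,0) is not zero, the ring C[1/x] does not contain x, and Chevalley's extension theorem gives
  a valuation ring of the Laurent series field that contains C[1/x] and still omits x; in other
  words, x is given a pole. Such a valuation need not be discrete, so a power series might have no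
  coefficient of least value; finite rank over the constants is what supplies one. Restricted to an
  arbitrary holomorphic curve, polynomials lose their algebraicity but keep finite rank, which is
  why a rational kernel suffices. The exponent of M is the exponent 2 in the Bergman kernel of the
  disc; the Gauss lemma argument works for every natural exponent. Zeros of N off the diagonal are
  not excluded, so its non-vanishing near the centre of the disc is drawn from positivity of the
  Bergman kernel on the diagonal, by continuity.\<close>

definition subring_set :: "'k::field set \<Rightarrow> bool" where
  "subring_set R \<longleftrightarrow> 1 \<in> R \<and> (\<forall>x\<in>R. \<forall>y\<in>R. x - y \<in> R \<and> x * y \<in> R)"

definition valuation_ring :: "'k::field set \<Rightarrow> bool" where
  "valuation_ring R \<longleftrightarrow> subring_set R \<and> (\<forall>x. x \<in> R \<or> inverse x \<in> R)"

lemma subring_setD: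
  assumes "subring_set R"
  shows "1 \<in> R" "0 \<in> R" "x \<in> R \<Longrightarrow> y \<in> R \<Longrightarrow> x - y \<in> R" "x \<in> R \<Longrightarrow> y \<in> R \<Longrightarrow> x * y \<in> R"
    "x \<in> R \<Longrightarrow> - x \<in> R" "x \<in> R \<Longrightarrow> y \<in> R \<Longrightarrow> x + y \<in> R"
proof -
  show 1: "1 \<in> R" and d: "\<And>x y. x \<in> R \<Longrightarrow> y \<in> R \<Longrightarrow> x - y \<in> R"
    and "x \<in> R \<Longrightarrow> y \<in> R \<Longrightarrow> x * y \<in> R"
    using assms by (auto simp: subring_set_def)
  show 0: "0 \<in> R" using d[OF 1 1] by simp
  show m: "\<And>x. x \<in> R \<Longrightarrow> - x \<in> R" using d[OF 0] by fastforce
  show "x \<in> R \<Longrightarrow> y \<in> R \<Longrightarrow> x + y \<in> R" using d[OF _ m, of x y] by simp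
qed

lemma subring_set_sum: "subring_set R \<Longrightarrow> (\<And>i. i \<in> I \<Longrightarrow> f i \<in> R) \<Longrightarrow> sum f I \<in> R"
  by (induction I rule: infinite_finite_induct) (auto intro: subring_setD)

lemma subring_set_power: "subring_set R \<Longrightarrow> x \<in> R \<Longrightarrow> x ^ k \<in> R"
  by (induction k) (auto intro: subring_setD)

lemma subring_set_of_nat: "subring_set R \<Longrightarrow> of_nat k \<in> R"
  by (induction k) (auto intro: subring_setD)

text \<open>The ring \<open>R[y]\<close>. Subrings are sets rather than types, so its elements are
  the values of those polynomials over the whole field whose coefficients happen to lie in
  \<open>R\<close>.\<close>

definition adjoin :: "'k::field set \<Rightarrow> 'k \<Rightarrow> 'k set" where
  "adjoin R y = {poly p y | p. \<forall>i. coeff p i \<in> R}"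

lemma adjoin_subring:
  assumes "subring_set R"
  shows "subring_set (adjoin R y)"
  unfolding subring_set_def
proof (intro conjI ballI)
  show "1 \<in> adjoin R y" unfolding adjoin_def
    using assms by (auto intro!: exI[of _ 1] subring_setD simp: coeff_1)
next
  fix a b assume "a \<in> adjoin R y" "b \<in> adjoin R y"
  then obtain p q where "a = poly p y" "b = poly q y" "\<forall>i. coeff p i \<in> R" "\<forall>i. coeff q i \<in> R"
    by (auto simp: adjoin_def)
  moreover from this have "\<forall>i. coeff (p - q) i \<in> R" "\<forall>i. coeff (p * q) i \<in> R"
    using assms by (auto intro!: subring_set_sum subring_setD simp: coeff_mult)
  ultimately show "a - b \<in> adjoin R y" "a * b \<in> adjoin R y" unfolding adjoin_def
    by (auto intro: exI[of _ "p - q"] exI[of _ "p * q"] simp del: coeff_diff)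
qed

lemma adjoin_contains:
  assumes "subring_set R"
  shows "R \<subseteq> adjoin R y" "y \<in> adjoin R y"
proof
  fix a assume "a \<in> R"
  then show "a \<in> adjoin R y" unfolding adjoin_def using subring_setD[OF assms]
    by (auto intro!: exI[of _ "[:a:]"] simp: coeff_pCons split: nat.splits)
next
  show "y \<in> adjoin R y" unfolding adjoin_def using subring_setD[OF assms]
    by (auto intro!: exI[of _ "[:0,1:]"] simp: coeff_pCons split: nat.splits)
qed

text \<open>For \<open>R\<close> maximal among the rings omitting \<open>inverse a\<close>, the
  multiples of \<open>a\<close> lie in the Jacobson radical. Every power of
  \<open>u = 1 - a * b\<close> has the form \<open>1 - a * c\<close>. Were \<open>inverse a\<close>
  a polynomial of degree \<open>d\<close> in \<open>inverse u\<close>, multiplication by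
  \<open>u ^ d\<close> would put \<open>inverse a * (1 - a * c)\<close>, and hence
  \<open>inverse a\<close>, into \<open>R\<close>.\<close>

lemma unit_of_maximal_subring:
  fixes a :: "'k::field"
  assumes R: "subring_set R" and a: "a \<in> R" "a \<noteq> 0" "inverse a \<notin> R" and b: "b \<in> R"
    and max: "\<And>y. inverse a \<notin> adjoin R y \<Longrightarrow> y \<in> R"
  shows "inverse (1 - a * b) \<in> R" "1 - a * b \<noteq> 0"
proof -
  define u where "u = 1 - a * b"
  show u0: "1 - a * b \<noteq> 0"
  proof
    assume "1 - a * b = 0"
    then have "inverse a = b" using a by (simp add: field_simps)
    then show False using a b by simp
  qed
  have pw: "\<exists>c\<in>R. u ^ k = 1 - a * c" for k
  proof (induction k)
    case 0 show ?case using subring_setD(2)[OF R] by (auto intro!: bexI[of _ 0])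
  next
    case (Suc k)
    then obtain c where c: "c \<in> R" "u ^ k = 1 - a * c" by auto
    have "u ^ Suc k = 1 - a * (b + c - a * b * c)"
      by (simp add: c) (simp add: u_def algebra_simps)
    moreover have "b + c - a * b * c \<in> R" using c b a by (intro subring_setD[OF R])
    ultimately show ?case by blast
  qed
  have uR: "u \<in> R" unfolding u_def using a b by (intro subring_setD[OF R])
  show "inverse (1 - a * b) \<in> R"
  proof (rule max, rule notI)
    assume "inverse a \<in> adjoin R (inverse (1 - a * b))"
    then obtain p where p: "inverse a = poly p (inverse u)" "\<forall>i. coeff p i \<in> R"
      by (auto simp: adjoin_def u_def)
    define d where "d = degree p"
    have "inverse a * u ^ d = (\<Sum>i\<le>d. coeff p i * inverse u ^ i * u ^ d)"
      by (simp add: p poly_altdef d_def sum_distrib_right)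
    also have "\<dots> = (\<Sum>i\<le>d. coeff p i * u ^ (d - i))"
      using u0 by (intro sum.cong) (auto simp: u_def power_diff field_simps)
    also have "\<dots> \<in> R" using p uR by (intro subring_set_sum[OF R] subring_setD(4)[OF R] subring_set_power[OF R]) auto
    finally have 1: "inverse a * u ^ d \<in> R" .
    obtain c where c: "c \<in> R" "u ^ d = 1 - a * c" using pw by blast
    have "inverse a = inverse a * u ^ d + c" using c a by (simp add: field_simps)
    then show False using subring_setD(6)[OF R 1 c(1)] a by simp
  qed
qed

text \<open>A witness, of degree at most \<open>n\<close>, that \<open>a\<close> generates the unit
  ideal of \<open>R[y]\<close>. The degree is recorded because the argument is a descent on
  it.\<close>

definition unit_relation :: "'k::field set \<Rightarrow> 'k \<Rightarrow> 'k \<Rightarrow> nat \<Rightarrow> bool" where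
  "unit_relation R a y n \<longleftrightarrow> (\<exists>c. (\<forall>i. c i \<in> R) \<and> (\<Sum>i\<le>n. a * c i * y ^ i) = 1)"

text \<open>The descent in Chevalley's argument. Multiplied by \<open>y ^ n\<close>, the relation
  for \<open>inverse y\<close> expresses \<open>(1 - a * b 0) * y ^ n\<close> by lower powers with
  coefficients in \<open>a R\<close>. Its leading factor is invertible by
  \<open>unit_of_maximal_subring\<close>, so the top term of the relation for \<open>y\<close> can
  be eliminated.\<close>

lemma unit_relation_reduce:
  fixes a :: "'k::field"
  assumes R: "subring_set R" and a: "a \<in> R" "a \<noteq> 0" "inverse a \<notin> R"
    and max: "\<And>y. inverse a \<notin> adjoin R y \<Longrightarrow> y \<in> R"
    and y: "y \<noteq> 0" and n: "unit_relation R a y n" "unit_relation R a (inverse y) m" "m \<le> n"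
  shows "n > 0 \<and> unit_relation R a y (n - 1)"
proof -
  obtain c where c: "\<forall>i. c i \<in> R" "(\<Sum>i\<le>n. a * c i * y ^ i) = 1" using n(1) by (auto simp: unit_relation_def)
  obtain b0 where b0: "\<forall>i. b0 i \<in> R" "(\<Sum>i\<le>m. a * b0 i * inverse y ^ i) = 1"
    using n(2) by (auto simp: unit_relation_def)
  define b where "b i = (if i \<le> m then b0 i else 0)" for i
  have b: "b i \<in> R" for i using b0 subring_setD(2)[OF R] by (auto simp: b_def)
  have "(\<Sum>i\<le>n. a * b i * inverse y ^ i) = (\<Sum>i\<le>m. a * b0 i * inverse y ^ i)"
    using n(3) by (intro sum.mono_neutral_cong_right) (auto simp: b_def)
  then have bs: "(\<Sum>i\<le>n. a * b i * inverse y ^ i) = 1" using b0 by simp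
  have n0: "n > 0"
  proof (rule ccontr)
    assume "\<not> n > 0"
    then have "a * c 0 = 1" using c by simp
    then have "inverse a = c 0" using a by (simp add: field_simps)
    then show False using a c by metis
  qed
  define u where "u = 1 - a * b 0"
  have u: "inverse u \<in> R" "u \<noteq> 0" using unit_of_maximal_subring[OF R a b max] by (auto simp: u_def)
  have "(\<Sum>i<n. a * b (n - i) * y ^ i) = (\<Sum>j\<in>{1..n}. a * b j * y ^ (n - j))"
    by (rule sum.reindex_bij_witness[of _ "\<lambda>j. n - j" "\<lambda>i. n - i"]) auto
  also have "\<dots> = (\<Sum>j\<in>{1..n}. a * b j * inverse y ^ j) * y ^ n"
    unfolding sum_distrib_right using y by (intro sum.cong refl) (auto simp: power_diff field_simps)
  also have "(\<Sum>j\<in>{1..n}. a * b j * inverse y ^ j) = (\<Sum>i\<le>n. a * b i * inverse y ^ i) - a * b 0"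
    by (simp add: atMost_atLeast0 sum.atLeast_Suc_atMost)
  finally have s: "(\<Sum>i<n. a * b (n - i) * y ^ i) = u * y ^ n" by (simp add: bs u_def)
  \<comment> \<open>Results from replacing \<open>y ^ n\<close> in the relation for \<open>y\<close>
    by the value that \<open>s\<close> gives for it.\<close>
  define c' where "c' i = c i + a * c n * inverse u * b (n - i)" for i
  have "(\<Sum>i<n. a * c' i * y ^ i) = (\<Sum>i<n. a * c i * y ^ i) + a * c n * inverse u * (\<Sum>i<n. a * b (n - i) * y ^ i)"
    by (simp add: c'_def algebra_simps sum.distrib sum_distrib_left)
  also have "\<dots> = (\<Sum>i<n. a * c i * y ^ i) + a * c n * y ^ n" using u by (simp add: s)
  also have "\<dots> = (\<Sum>i\<le>n. a * c i * y ^ i)" by (simp add: lessThan_Suc_atMost[symmetric])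
  finally have "(\<Sum>i<n. a * c' i * y ^ i) = 1" using c by simp
  moreover have "{..<n} = {..n - 1}" using n0 by auto
  moreover have "c' i \<in> R" for i unfolding c'_def using c b u a by (intro subring_setD[OF R]) auto
  ultimately show ?thesis using n0 unfolding unit_relation_def by metis
qed

text \<open>Chevalley's extension theorem. Zorn's lemma gives a ring maximal among those that
  contain \<open>R0\<close> and omit \<open>inverse a\<close>. If neither \<open>y\<close> nor
  \<open>inverse y\<close> belonged to it, both would satisfy unit relations by maximality, and of
  two relations of minimal degree the longer one could be shortened.\<close>

lemma exists_valuation_ring:
  fixes a :: "'k::field"
  assumes R0: "subring_set R0" and a: "a \<in> R0" "inverse a \<notin> R0"
  obtains V where "valuation_ring V" "R0 \<subseteq> V" "inverse a \<notin> V"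
proof -
  define \<A> where "\<A> = {R. subring_set R \<and> R0 \<subseteq> R \<and> inverse a \<notin> R}"
  have "\<A> \<noteq> {}" using assms by (auto simp: \<A>_def)
  then have "\<exists>M\<in>\<A>. \<forall>X\<in>\<A>. M \<subseteq> X \<longrightarrow> X = M"
  proof (rule subset_Zorn_nonempty)
    fix C assume C: "C \<noteq> {}" "subset.chain \<A> C"
    then obtain R1 where R1: "R1 \<in> C" by blast
    have sub: "subring_set R" "R0 \<subseteq> R" "inverse a \<notin> R" if "R \<in> C" for R
      using that C by (auto simp: subset.chain_def \<A>_def)
    have "subring_set (\<Union>C)" unfolding subring_set_def
    proof (intro conjI ballI)
      show "1 \<in> \<Union>C" using R1 sub(1) subring_setD(1) by blast
      fix x y assume "x \<in> \<Union>C" "y \<in> \<Union>C"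
      then obtain X Y where XY: "X \<in> C" "x \<in> X" "Y \<in> C" "y \<in> Y" by blast
      then have "X \<subseteq> Y \<or> Y \<subseteq> X" using C by (auto simp: subset.chain_def)
      then obtain Z where Z: "Z \<in> C" "x \<in> Z" "y \<in> Z" using XY by blast
      show "x - y \<in> \<Union>C" "x * y \<in> \<Union>C"
        using Z sub(1) subring_setD(3,4) by blast+
    qed
    then show "\<Union>C \<in> \<A>" using sub R1 by (auto simp: \<A>_def)
  qed
  then obtain R where R: "R \<in> \<A>" and Rmax: "\<And>X. X \<in> \<A> \<Longrightarrow> R \<subseteq> X \<Longrightarrow> X = R" by blast
  have sR: "subring_set R" and R0R: "R0 \<subseteq> R" and aR: "a \<in> R" "inverse a \<notin> R"
    using R a by (auto simp: \<A>_def)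
  have a0: "a \<noteq> 0" using aR by auto
  have max: "y \<in> R" if "inverse a \<notin> adjoin R y" for y
  proof -
    have "adjoin R y \<in> \<A>"
      using that adjoin_subring[OF sR] adjoin_contains(1)[OF sR] R0R by (auto simp: \<A>_def)
    then show ?thesis using Rmax adjoin_contains[OF sR, of y] by blast
  qed
  have rel: "\<exists>n. unit_relation R a y n" if "y \<notin> R" for y
  proof -
    have "inverse a \<in> adjoin R y" using that max by blast
    then obtain p where p: "inverse a = poly p y" "\<forall>i. coeff p i \<in> R" by (auto simp: adjoin_def)
    have "(\<Sum>i\<le>degree p. a * coeff p i * y ^ i) = a * inverse a"
      unfolding p(1) by (simp add: poly_altdef sum_distrib_left mult.assoc)
    then show ?thesis using p a0 unfolding unit_relation_def by (metis right_inverse)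
  qed
  have "y \<in> R \<or> inverse y \<in> R" for y
  proof (rule ccontr)
    assume neg: "\<not> (y \<in> R \<or> inverse y \<in> R)"
    have y0: "y \<noteq> 0" using neg subring_setD(2)[OF sR] by auto
    define n where "n = (LEAST n. unit_relation R a y n)"
    define m where "m = (LEAST n. unit_relation R a (inverse y) n)"
    have n: "unit_relation R a y n" using rel[of y] neg unfolding n_def by (metis LeastI_ex)
    have m: "unit_relation R a (inverse y) m" using rel[of "inverse y"] neg unfolding m_def by (metis LeastI_ex)
    show False
    proof (cases "m \<le> n")
      case True
      then have "n > 0 \<and> unit_relation R a y (n - 1)"
        using unit_relation_reduce[OF sR aR(1) a0 aR(2) max y0 n m] by auto
      then show False using Least_le[of "unit_relation R a y" "n - 1"] unfolding n_def by linarith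
    next
      case False
      then have "m > 0 \<and> unit_relation R a (inverse y) (m - 1)"
        using unit_relation_reduce[OF sR aR(1) a0 aR(2) max _ m, of n] n y0 by auto
      then show False using Least_le[of "unit_relation R a (inverse y)" "m - 1"] unfolding m_def by linarith
    qed
  qed
  then show ?thesis using that sR R0R aR by (auto simp: valuation_ring_def)
qed

definition val_ideal :: "'k::field set \<Rightarrow> 'k set" where
  "val_ideal V = {x \<in> V. x = 0 \<or> inverse x \<notin> V}"

lemma val_ideal_mult:
  assumes V: "valuation_ring V" and x: "x \<in> val_ideal V" and y: "y \<in> V"
  shows "x * y \<in> val_ideal V"
proof -
  have sV: "subring_set V" using V by (auto simp: valuation_ring_def)
  have "x * y \<in> V" using x y subring_setD(4)[OF sV] by (auto simp: val_ideal_def)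
  moreover have "inverse (x * y) \<notin> V" if "x * y \<noteq> 0"
  proof
    assume "inverse (x * y) \<in> V"
    then have "y * inverse (x * y) \<in> V" using y subring_setD(4)[OF sV] by auto
    moreover have "y * inverse (x * y) = inverse x" using that by simp
    ultimately have "inverse x \<in> V" by (simp only:)
    then show False using x that by (auto simp: val_ideal_def)
  qed
  ultimately show ?thesis by (auto simp: val_ideal_def)
qed

text \<open>Of two nonzero elements one divides the other in \<open>V\<close>. The sum is then the
  divisor times an element of \<open>V\<close>, so \<open>val_ideal_mult\<close> applies.\<close>

lemma val_ideal_add:
  assumes V: "valuation_ring V" and x: "x \<in> val_ideal V" and y: "y \<in> val_ideal V"
  shows "x + y \<in> val_ideal V"
proof -
  have sV: "subring_set V" using V by (auto simp: valuation_ring_def)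
  have *: "x + y \<in> val_ideal V" if "x \<in> val_ideal V" "y \<in> val_ideal V" "x / y \<in> V" "y \<noteq> 0" for x y
  proof -
    have "y * (1 + x / y) \<in> val_ideal V"
      using that by (intro val_ideal_mult[OF V] subring_setD[OF sV])
    moreover have "y * (1 + x / y) = x + y" using that by (simp add: distrib_left)
    ultimately show ?thesis by simp
  qed
  consider "x = 0" | "y = 0" | "x \<noteq> 0" "y \<noteq> 0" "x / y \<in> V" | "x \<noteq> 0" "y \<noteq> 0" "y / x \<in> V"
    using V unfolding valuation_ring_def by (metis inverse_divide)
  then show ?thesis
    using x y *[of x y] *[of y x] by cases (auto simp: add.commute)
qed

lemma val_ideal_sum:
  "valuation_ring V \<Longrightarrow> (\<And>i. i \<in> I \<Longrightarrow> f i \<in> val_ideal V) \<Longrightarrow> sum f I \<in> val_ideal V"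
proof (induction I rule: infinite_finite_induct)
  case (insert x F) then show ?case by (auto intro: val_ideal_add)
qed (auto simp: val_ideal_def valuation_ring_def intro: subring_setD)

section \<open>Contents of power series and the Gauss lemma over a valuation ring\<close>

definition primitive_at :: "'k::field set \<Rightarrow> nat \<Rightarrow> 'k fps \<Rightarrow> bool" where
  "primitive_at V k X \<longleftrightarrow> (\<forall>i. fps_nth X i \<in> V) \<and> (\<forall>i<k. fps_nth X i \<in> val_ideal V) \<and> fps_nth X k \<notin> val_ideal V"

text \<open>Modulo the maximal ideal, \<open>X\<close> and \<open>Y\<close> are series of exact
  orders \<open>k\<close> and \<open>l\<close> over the residue field, and orders add. In the
  coefficient of index \<open>k + l\<close> every term but one has a factor in the maximal ideal,
  and the remaining term is a product of units.\<close>

lemma primitive_at_mult: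
  assumes V: "valuation_ring V" and X: "primitive_at V k X" and Y: "primitive_at V l Y"
  shows "primitive_at V (k + l) (X * Y)"
  unfolding primitive_at_def
proof (intro conjI allI impI)
  have sV: "subring_set V" using V by (auto simp: valuation_ring_def)
  have XV: "fps_nth X i \<in> V" and YV: "fps_nth Y i \<in> V" for i
    using X Y by (auto simp: primitive_at_def)
  show "fps_nth (X * Y) i \<in> V" for i
    unfolding fps_mult_nth by (intro subring_set_sum[OF sV] subring_setD(4)[OF sV] XV YV)
  have tm: "fps_nth X i * fps_nth Y j \<in> val_ideal V" if "i < k \<or> j < l" for i j
    using that X Y val_ideal_mult[OF V _ XV, of "fps_nth Y j" i] val_ideal_mult[OF V _ YV, of "fps_nth X i" j]
    by (auto simp: primitive_at_def mult.commute)
  show "fps_nth (X * Y) i \<in> val_ideal V" if "i < k + l" for i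
    unfolding fps_mult_nth using that by (intro val_ideal_sum[OF V] tm) auto
  show "fps_nth (X * Y) (k + l) \<notin> val_ideal V"
  proof
    assume *: "fps_nth (X * Y) (k + l) \<in> val_ideal V"
    define r where "r = (\<Sum>i\<in>{0..k+l} - {k}. fps_nth X i * fps_nth Y (k + l - i))"
    have "r \<in> val_ideal V" unfolding r_def by (intro val_ideal_sum[OF V] tm) auto
    moreover have "-1 \<in> V" by (intro subring_setD[OF sV])
    ultimately have "r * (-1) \<in> val_ideal V" using val_ideal_mult[OF V] by blast
    then have "fps_nth (X * Y) (k + l) + r * (-1) \<in> val_ideal V" using * val_ideal_add[OF V] by blast
    also have "fps_nth (X * Y) (k + l) + r * (-1) = fps_nth X k * fps_nth Y l"
      unfolding fps_mult_nth r_def by (subst sum.remove[of _ k]) auto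
    finally have xy: "fps_nth X k * fps_nth Y l \<in> val_ideal V" .
    have "fps_nth X k \<noteq> 0" "fps_nth Y l \<noteq> 0" "inverse (fps_nth X k) \<in> V" "inverse (fps_nth Y l) \<in> V"
      using X Y subring_setD(2)[OF sV] by (auto simp: primitive_at_def val_ideal_def)
    then show False using xy subring_setD(4)[OF sV]
      by (auto simp: val_ideal_def)
  qed
qed

definition finite_rank_fps :: "('c::field \<Rightarrow> 'k::field) \<Rightarrow> 'k fps \<Rightarrow> bool" where
  "finite_rank_fps \<iota> X \<longleftrightarrow> (\<exists>(n::nat) u c. \<forall>k. fps_nth X k = (\<Sum>i<n. \<iota> (c i k) * u i))"

text \<open>Existence of the content. Infinitely many coefficients need not have one of least value,
  but here they span a space of finite dimension over the constants. In a finite basis taken from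
  the coefficients, some \<open>b\<close> divides all basis elements; constants being integral, it
  divides every coefficient.\<close>

lemma finite_rank_primitive:
  fixes \<iota> :: "'c::field \<Rightarrow> 'k::field"
  assumes V: "valuation_ring V" and vs: "vector_space (\<lambda>c x. \<iota> c * x)" and \<iota>: "\<And>c. \<iota> c \<in> V"
    and X: "finite_rank_fps \<iota> X" "X \<noteq> 0"
  obtains p k where "p \<noteq> 0" "primitive_at V k (fps_const (inverse p) * X)" "p = fps_nth X k"
proof -
  have sV: "subring_set V" using V by (auto simp: valuation_ring_def)
  interpret vector_space "\<lambda>c x. \<iota> c * x" by fact
  obtain n :: nat and u c where u: "\<And>k. fps_nth X k = (\<Sum>i<n. \<iota> (c i k) * u i)"
    using X by (auto simp: finite_rank_fps_def)
  define S where "S = range (fps_nth X)"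
  have Su: "S \<subseteq> span (u ` {..<n})"
    unfolding S_def by (auto simp: u intro!: span_sum span_scale intro: span_base)
  obtain B where B: "B \<subseteq> S" "independent B" "S \<subseteq> span B" using maximal_independent_subset by blast
  have finB: "finite B" using independent_span_bound[of "u ` {..<n}" B] B Su by auto
  have "B \<noteq> {}"
  proof
    assume "B = {}"
    then have "S \<subseteq> {0}" using B by simp
    then have "X = 0" by (auto simp: S_def fps_eq_iff)
    then show False using X by simp
  qed
  have "\<exists>b\<in>B. \<forall>x\<in>B. x / b \<in> V"
    using finB \<open>B \<noteq> {}\<close> B(2)
  proof (induction B rule: finite_ne_induct)
    case (singleton x) then show ?case using subring_setD(1,2)[OF sV] by (cases "x = 0") auto
  next
    case (insert x F)
    then obtain b where b: "b \<in> F" "\<forall>x\<in>F. x / b \<in> V" using independent_mono[of "insert x F" F] by blast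
    have b0: "b \<noteq> 0" using b insert.prems dependent_zero[of "insert x F"] by auto
    have x0: "x \<noteq> 0" using insert.prems dependent_zero[of "insert x F"] by auto
    show ?case
    proof (cases "x / b \<in> V")
      case True then show ?thesis using b by auto
    next
      case False
      then have bx: "b / x \<in> V" using V unfolding valuation_ring_def by (metis inverse_divide)
      have "y / x \<in> V" if "y \<in> F" for y
        using subring_setD(4)[OF sV, of "y / b" "b / x"] b that bx b0 by auto
      then show ?thesis using x0 subring_setD(1)[OF sV] by (intro bexI[of _ x]) auto
    qed
  qed
  then obtain b where b: "b \<in> B" "\<And>x. x \<in> B \<Longrightarrow> x / b \<in> V" by blast
  have b0: "b \<noteq> 0" using b B(2) dependent_zero by auto
  have bV: "x / b \<in> V" if "x \<in> span B" for x
    using that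
  proof (induction rule: span_induct_alt)
    case base show ?case using subring_setD(2)[OF sV] by simp
  next
    case (step c x y)
    then show ?case using b(2)[of x] \<iota>[of c] subring_setD(4,6)[OF sV] by (simp add: add_divide_distrib times_divide_eq_right[symmetric] del: times_divide_eq_right)
  qed
  \<comment> \<open>The coefficients of least value are those associated with \<open>b\<close>. The
    first of them is taken as content, so that all earlier quotients fall into the maximal
    ideal.\<close>
  define P where "P k \<longleftrightarrow> fps_nth X k / b \<notin> val_ideal V" for k
  have "\<exists>k. P k"
  proof -
    obtain k where "b = fps_nth X k" using b B by (auto simp: S_def)
    then have "P k" using b0 subring_setD(1)[OF sV] by (auto simp: P_def val_ideal_def)
    then show ?thesis by blast
  qed
  define k where "k = (LEAST k. P k)"
  have Pk: "P k" using \<open>\<exists>k. P k\<close> unfolding k_def by (rule LeastI_ex)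
  have lt: "\<not> P i" if "i < k" for i using that not_less_Least unfolding k_def by blast
  define p where "p = fps_nth X k"
  have XV: "fps_nth X i / b \<in> V" for i using bV B(3) by (auto simp: S_def)
  have p0: "p \<noteq> 0" and bp: "b / p \<in> V"
    using Pk XV[of k] subring_setD(2)[OF sV] by (auto simp: P_def val_ideal_def p_def)
  have eq: "fps_nth (fps_const (inverse p) * X) i = fps_nth X i / b * (b / p)" for i
    using b0 by (simp add: field_simps)
  have "primitive_at V k (fps_const (inverse p) * X)"
    unfolding primitive_at_def
  proof (intro conjI allI impI)
    show "fps_nth (fps_const (inverse p) * X) i \<in> V" for i
      unfolding eq using XV bp by (intro subring_setD[OF sV])
    show "fps_nth (fps_const (inverse p) * X) i \<in> val_ideal V" if "i < k" for i
      unfolding eq using lt[OF that] bp by (intro val_ideal_mult[OF V]) (auto simp: P_def)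
    show "fps_nth (fps_const (inverse p) * X) k \<notin> val_ideal V"
      using p0 subring_setD(1)[OF sV] by (auto simp: p_def val_ideal_def)
  qed
  then show ?thesis using that p0 by (simp add: p_def)
qed

text \<open>A Gauss lemma argument: after normalising contents, the logarithmic derivatives of \<open>N\<close> and
  \<open>M\<close> have non-negative Gauss valuation.\<close>

lemma log_derivative_integral:
  fixes \<iota> :: "'c::field \<Rightarrow> 'k::field"
  assumes V: "valuation_ring V" and vs: "vector_space (\<lambda>c x. \<iota> c * x)" and \<iota>: "\<And>c. \<iota> c \<in> V"
    and N: "finite_rank_fps \<iota> N" "N \<noteq> 0" and M: "finite_rank_fps \<iota> M" "M \<noteq> 0"
    and P: "finite_rank_fps \<iota> P"
    and eq: "P * N * M = fps_deriv N * M - of_nat e * fps_deriv M * N"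
  shows "fps_nth P k \<in> V"
proof (cases "P = 0")
  case True then show ?thesis using V subring_setD(2) by (auto simp: valuation_ring_def)
next
  case False
  have sV: "subring_set V" using V by (auto simp: valuation_ring_def)
  obtain n i where n: "n \<noteq> 0" "primitive_at V i (fps_const (inverse n) * N)"
    using finite_rank_primitive[OF V vs \<iota> N] by metis
  obtain m j where m: "m \<noteq> 0" "primitive_at V j (fps_const (inverse m) * M)"
    using finite_rank_primitive[OF V vs \<iota> M] by metis
  obtain p l where p: "p \<noteq> 0" "primitive_at V l (fps_const (inverse p) * P)"
    using finite_rank_primitive[OF V vs \<iota> P False] by metis
  define N' where "N' = fps_const (inverse n) * N"
  define M' where "M' = fps_const (inverse m) * M"
  define P' where "P' = fps_const (inverse p) * P"
  have T: "primitive_at V (l + i + j) (P' * N' * M')"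
    unfolding N'_def M'_def P'_def using n m p by (intro primitive_at_mult[OF V])
  \<comment> \<open>Constants pass through the derivation, so dividing \<open>N\<close> and
    \<open>M\<close> by their contents keeps the shape of the equation, and the content
    \<open>p\<close> of \<open>P\<close> is left over.\<close>
  have "fps_const p * (P' * N' * M') = (fps_const p * fps_const (inverse p)) * fps_const (inverse n) * fps_const (inverse m) * (P * N * M)"
    by (simp add: P'_def N'_def M'_def algebra_simps)
  also have "fps_const p * fps_const (inverse p) = 1" using p by (simp add: fps_const_mult)
  also have "1 * fps_const (inverse n) * fps_const (inverse m) * (P * N * M) = fps_deriv N' * M' - of_nat e * fps_deriv M' * N'"
    unfolding eq by (simp add: N'_def M'_def algebra_simps)
  finally have e1: "fps_const p * (P' * N' * M') = fps_deriv N' * M' - of_nat e * fps_deriv M' * N'" .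
  have VN: "fps_nth N' k \<in> V" "fps_nth M' k \<in> V" "fps_nth P' k \<in> V" for k
    using n m p by (auto simp: primitive_at_def N'_def M'_def P'_def)
  have VM: "fps_nth (X * Y) k \<in> V" if "\<And>k. fps_nth X k \<in> V" "\<And>k. fps_nth Y k \<in> V" for X Y k
    unfolding fps_mult_nth using that by (intro subring_set_sum[OF sV] subring_setD(4)[OF sV])
  have VD: "fps_nth (fps_deriv X) k \<in> V" if "\<And>k. fps_nth X k \<in> V" for X k
    using that subring_set_of_nat[OF sV] by (auto intro!: subring_setD(4)[OF sV] simp del: of_nat_Suc)
  have Ve: "fps_nth (of_nat e :: 'k fps) k \<in> V" for k
    using subring_set_of_nat[OF sV] subring_setD(2)[OF sV] by (simp add: fps_of_nat[symmetric])
  have "fps_nth (fps_deriv N' * M' - of_nat e * fps_deriv M' * N') k \<in> V" for k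
    unfolding fps_sub_nth by (intro subring_setD(3)[OF sV] VM VD VN Ve)
  then have "fps_nth (fps_const p * (P' * N' * M')) (l + i + j) \<in> V" unfolding e1 .
  then have pt: "p * fps_nth (P' * N' * M') (l + i + j) \<in> V" by simp
  \<comment> \<open>The product of the three primitive series has a unit at this index. Dividing by
    it shows that \<open>p\<close> is integral, and with it every coefficient of
    \<open>P\<close>.\<close>
  have ti: "fps_nth (P' * N' * M') (l + i + j) \<noteq> 0" "inverse (fps_nth (P' * N' * M') (l + i + j)) \<in> V"
    using T subring_setD(2)[OF sV] by (auto simp: primitive_at_def val_ideal_def)
  then have "p \<in> V" using subring_setD(4)[OF sV pt ti(2)]
    by (simp only: mult.assoc right_inverse mult_1_right not_False_eq_True)
  moreover have "fps_nth P k = p * fps_nth P' k" using p by (simp add: P'_def)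
  ultimately show ?thesis using VN subring_setD(4)[OF sV] by auto
qed

text \<open>It suffices that \<open>x\<close> is not in the ring generated by the constants and
  \<open>inverse x\<close>. From \<open>x = p (1/x)\<close>, multiplication by \<open>x ^ d\<close>
  gives an identity in which, at exponent zero, everything vanishes except the leading coefficient
  of \<open>p\<close>, a constant; so that constant would be zero.\<close>

lemma exists_valuation_ring_fls:
  fixes x :: "complex fls"
  assumes x: "x \<noteq> 0" "fls_subdegree x > 0"
  obtains V where "valuation_ring V" "range fls_const \<subseteq> V" "x \<notin> V"
proof -
  have sC: "subring_set (range fls_const :: complex fls set)"
    unfolding subring_set_def
    by (auto simp: fls_const_mult_const fls_minus_const intro: range_eqI[of _ _ 1])
  have "x \<notin> adjoin (range fls_const) (inverse x)"
  proof
    assume "x \<in> adjoin (range fls_const) (inverse x)"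
    then obtain p where p: "x = poly p (inverse x)" "\<forall>i. coeff p i \<in> range fls_const"
      by (auto simp: adjoin_def)
    define d where "d = degree p"
    have pow0: "fls_nth (x ^ k) 0 = 0" if "k > 0" for k
      using that x by (intro fls_eq0_below_subdegree) (simp add: fls_subdegree_pow)
    have "x ^ (d + 1) = (\<Sum>i\<le>d. coeff p i * inverse x ^ i) * x ^ d"
      using p(1) by (simp add: poly_altdef d_def)
    also have "\<dots> = (\<Sum>i\<le>d. coeff p i * x ^ (d - i))"
      unfolding sum_distrib_right using x by (intro sum.cong refl) (auto simp: power_diff field_simps)
    also have "fls_nth \<dots> 0 = (\<Sum>i\<le>d. if i = d then fls_nth (coeff p d) 0 else 0)"
      unfolding fls_nth_sum
    proof (rule sum.cong[OF refl])
      fix i assume "i \<in> {..d}"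
      moreover obtain c where "coeff p i = fls_const c" using p(2) by blast
      ultimately show "fls_nth (coeff p i * x ^ (d - i)) 0 = (if i = d then fls_nth (coeff p d) 0 else 0)"
        using pow0[of "d - i"] by auto
    qed
    finally have "fls_nth (coeff p d) 0 = 0" using pow0[of "d + 1"] by simp
    moreover obtain c where "coeff p d = fls_const c" using p(2) by blast
    ultimately have "coeff p d = 0" by simp
    then have "p = 0" by (simp add: d_def)
    then show False using p x by simp
  qed
  then obtain V where "valuation_ring V" "adjoin (range fls_const) (inverse x) \<subseteq> V" "inverse (inverse x) \<notin> V"
    using exists_valuation_ring[OF adjoin_subring[OF sC], of "inverse x" "inverse x"] adjoin_contains(2)[OF sC]
    by (metis inverse_inverse_eq)
  moreover have "range fls_const \<subseteq> adjoin (range fls_const) (inverse x)" by (rule adjoin_contains(1)[OF sC])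
  ultimately show ?thesis using that[of V] by (simp add: subset_trans)
qed

section \<open>Finite-rank kernels in one variable\<close>

text \<open>Finite-rank kernels; the second variable is the conjugate of the geometric one, so both
  factors are holomorphic.\<close>

definition sep_kernel :: "complex set \<Rightarrow> (complex \<Rightarrow> complex \<Rightarrow> complex) \<Rightarrow> bool" where
  "sep_kernel D H \<longleftrightarrow> (\<exists>(n::nat) U V. (\<forall>i. U i holomorphic_on D \<and> V i holomorphic_on D) \<and>
     (\<forall>z\<in>D. \<forall>s\<in>D. H z s = (\<Sum>i<n. U i z * V i s)))"

text \<open>Frees the index set: the definition uses initial segments of the naturals because an
  existential quantifier cannot range over index types.\<close>

lemma sep_kernelI:
  fixes I :: "'i set"
  assumes "finite I" "\<And>i. i \<in> I \<Longrightarrow> U i holomorphic_on D" "\<And>i. i \<in> I \<Longrightarrow> V i holomorphic_on D"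
    and H: "\<And>z s. z \<in> D \<Longrightarrow> s \<in> D \<Longrightarrow> H z s = (\<Sum>i\<in>I. U i z * V i s)"
  shows "sep_kernel D H"
proof -
  obtain h where h: "bij_betw h {..<card I} I"
    using ex_bij_betw_nat_finite[OF assms(1)] by (auto simp: atLeast0LessThan)
  define U' where "U' i = (if i < card I then U (h i) else (\<lambda>_. 0))" for i
  define V' where "V' i = (if i < card I then V (h i) else (\<lambda>_. 0))" for i
  have hI: "h i \<in> I" if "i < card I" for i using h that by (auto simp: bij_betw_def)
  have "(\<Sum>i\<in>I. U i z * V i s) = (\<Sum>i<card I. U' i z * V' i s)" for z s
    using sum.reindex_bij_betw[OF h, of "\<lambda>i. U i z * V i s"] by (simp add: U'_def V'_def)
  then show ?thesis using assms(2,3) H hI unfolding sep_kernel_def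
    by (intro exI[of _ "card I"] exI[of _ U'] exI[of _ V']) (auto simp: U'_def V'_def)
qed

lemma sep_kernelE:
  assumes "sep_kernel D H"
  obtains n :: nat and U V where "\<And>i. U i holomorphic_on D" "\<And>i. V i holomorphic_on D"
    "\<And>z s. z \<in> D \<Longrightarrow> s \<in> D \<Longrightarrow> H z s = (\<Sum>i<n. U i z * V i s)"
  using assms unfolding sep_kernel_def by blast

lemma sep_kernel_add:
  assumes "sep_kernel D H" "sep_kernel D H'"
  shows "sep_kernel D (\<lambda>z s. H z s + H' z s)"
proof -
  obtain n U V where 1: "\<And>i. U i holomorphic_on D" "\<And>i. V i holomorphic_on D"
    "\<And>z s. z \<in> D \<Longrightarrow> s \<in> D \<Longrightarrow> H z s = (\<Sum>i<n::nat. U i z * V i s)" using assms(1) by (elim sep_kernelE) blast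
  obtain m U' V' where 2: "\<And>i. U' i holomorphic_on D" "\<And>i. V' i holomorphic_on D"
    "\<And>z s. z \<in> D \<Longrightarrow> s \<in> D \<Longrightarrow> H' z s = (\<Sum>i<m::nat. U' i z * V' i s)" using assms(2) by (elim sep_kernelE) blast
  have "H z s + H' z s = (\<Sum>i\<in>{..<n} <+> {..<m}. case_sum U U' i z * case_sum V V' i s)"
    if "z \<in> D" "s \<in> D" for z s using 1(3)[OF that] 2(3)[OF that] by (simp add: sum.Plus)
  then show ?thesis
    by (intro sep_kernelI[where I = "{..<n} <+> {..<m}" and U = "case_sum U U'" and V = "case_sum V V'"])
      (use 1 2 in \<open>auto split: sum.splits\<close>)
qed

lemma sep_kernel_mult:
  assumes "sep_kernel D H" "sep_kernel D H'"
  shows "sep_kernel D (\<lambda>z s. H z s * H' z s)"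
proof -
  obtain n U V where 1: "\<And>i. U i holomorphic_on D" "\<And>i. V i holomorphic_on D"
    "\<And>z s. z \<in> D \<Longrightarrow> s \<in> D \<Longrightarrow> H z s = (\<Sum>i<n::nat. U i z * V i s)" using assms(1) by (elim sep_kernelE) blast
  obtain m U' V' where 2: "\<And>i. U' i holomorphic_on D" "\<And>i. V' i holomorphic_on D"
    "\<And>z s. z \<in> D \<Longrightarrow> s \<in> D \<Longrightarrow> H' z s = (\<Sum>i<m::nat. U' i z * V' i s)" using assms(2) by (elim sep_kernelE) blast
  have "H z s * H' z s = (\<Sum>(i,j)\<in>{..<n} \<times> {..<m}. (U i z * U' j z) * (V i s * V' j s))"
    if "z \<in> D" "s \<in> D" for z s
    unfolding 1(3)[OF that] 2(3)[OF that] sum_product sum.cartesian_product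
    by (intro sum.cong) auto
  then show ?thesis
    by (intro sep_kernelI[where I = "{..<n} \<times> {..<m}" and U = "\<lambda>(i,j) z. U i z * U' j z" and V = "\<lambda>(i,j) z. V i z * V' j z"])
      (use 1 2 in \<open>auto intro!: holomorphic_intros simp: case_prod_unfold\<close>)
qed

lemma sep_kernel_fst: "u holomorphic_on D \<Longrightarrow> sep_kernel D (\<lambda>z s. u z)"
  by (rule sep_kernelI[of "{0::nat}" "\<lambda>_. u" _ "\<lambda>_ _. 1"]) auto

lemma sep_kernel_snd: "v holomorphic_on D \<Longrightarrow> sep_kernel D (\<lambda>z s. v s)"
  by (rule sep_kernelI[of "{0::nat}" "\<lambda>_ _. 1" _ "\<lambda>_. v"]) auto

lemma sep_kernel_const: "sep_kernel D (\<lambda>z s. c)"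
  by (rule sep_kernel_fst) auto

lemma sep_kernel_diff:
  assumes "sep_kernel D H" "sep_kernel D H'"
  shows "sep_kernel D (\<lambda>z s. H z s - H' z s)"
  using sep_kernel_add[OF assms(1) sep_kernel_mult[OF sep_kernel_const[of D "-1"] assms(2)]] by simp

lemma sep_kernel_power: "sep_kernel D H \<Longrightarrow> sep_kernel D (\<lambda>z s. H z s ^ k)"
  by (induction k) (auto intro: sep_kernel_mult sep_kernel_const)

definition dz_kernel :: "(complex \<Rightarrow> complex \<Rightarrow> complex) \<Rightarrow> complex \<Rightarrow> complex \<Rightarrow> complex" where
  "dz_kernel H z s = deriv (\<lambda>z. H z s) z"

definition ds_kernel :: "(complex \<Rightarrow> complex \<Rightarrow> complex) \<Rightarrow> complex \<Rightarrow> complex \<Rightarrow> complex" where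
  "ds_kernel H z s = deriv (\<lambda>s. H z s) s"

lemma dz_kernel_sum:
  assumes "open D" "finite I" "\<And>i. i \<in> I \<Longrightarrow> U i holomorphic_on D" "z \<in> D" "s \<in> D"
    and H: "\<And>z s. z \<in> D \<Longrightarrow> s \<in> D \<Longrightarrow> H z s = (\<Sum>i\<in>I. U i z * V i s)"
  shows "((\<lambda>z. H z s) has_field_derivative (\<Sum>i\<in>I. deriv (U i) z * V i s)) (at z)"
    and "dz_kernel H z s = (\<Sum>i\<in>I. deriv (U i) z * V i s)"
proof -
  have "((\<lambda>z. \<Sum>i\<in>I. U i z * V i s) has_field_derivative (\<Sum>i\<in>I. deriv (U i) z * V i s)) (at z)"
    using assms by (intro DERIV_sum DERIV_cmult_right) (auto intro: holomorphic_derivI)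
  then show "((\<lambda>z. H z s) has_field_derivative (\<Sum>i\<in>I. deriv (U i) z * V i s)) (at z)"
    by (rule has_field_derivative_transform_within_open[OF _ \<open>open D\<close> \<open>z \<in> D\<close>]) (use H assms in auto)
  then show "dz_kernel H z s = (\<Sum>i\<in>I. deriv (U i) z * V i s)"
    unfolding dz_kernel_def by (rule DERIV_imp_deriv)
qed

lemma ds_kernel_sum:
  assumes "open D" "finite I" "\<And>i. i \<in> I \<Longrightarrow> V i holomorphic_on D" "z \<in> D" "s \<in> D"
    and H: "\<And>z s. z \<in> D \<Longrightarrow> s \<in> D \<Longrightarrow> H z s = (\<Sum>i\<in>I. U i z * V i s)"
  shows "((\<lambda>s. H z s) has_field_derivative (\<Sum>i\<in>I. U i z * deriv (V i) s)) (at s)"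
    and "ds_kernel H z s = (\<Sum>i\<in>I. U i z * deriv (V i) s)"
proof -
  have "((\<lambda>s. \<Sum>i\<in>I. U i z * V i s) has_field_derivative (\<Sum>i\<in>I. U i z * deriv (V i) s)) (at s)"
    using assms by (intro DERIV_sum DERIV_cmult) (auto intro: holomorphic_derivI)
  then show "((\<lambda>s. H z s) has_field_derivative (\<Sum>i\<in>I. U i z * deriv (V i) s)) (at s)"
    by (rule has_field_derivative_transform_within_open[OF _ \<open>open D\<close> \<open>s \<in> D\<close>]) (use H assms in auto)
  then show "ds_kernel H z s = (\<Sum>i\<in>I. U i z * deriv (V i) s)"
    unfolding ds_kernel_def by (rule DERIV_imp_deriv)
qed

lemma sep_kernel_dz:
  assumes "open D" "sep_kernel D H"
  shows "sep_kernel D (dz_kernel H)"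
    and "z \<in> D \<Longrightarrow> s \<in> D \<Longrightarrow> ((\<lambda>z. H z s) has_field_derivative dz_kernel H z s) (at z)"
proof -
  obtain n U V where 1: "\<And>i. U i holomorphic_on D" "\<And>i. V i holomorphic_on D"
    "\<And>z s. z \<in> D \<Longrightarrow> s \<in> D \<Longrightarrow> H z s = (\<Sum>i<n::nat. U i z * V i s)" using assms(2) by (elim sep_kernelE) blast
  show "sep_kernel D (dz_kernel H)"
    by (rule sep_kernelI[of "{..<n}" "\<lambda>i. deriv (U i)" _ V])
      (use dz_kernel_sum(2)[OF \<open>open D\<close>, of "{..<n}" U _ _ H V] 1 \<open>open D\<close> in \<open>auto intro: holomorphic_deriv\<close>)
  show "z \<in> D \<Longrightarrow> s \<in> D \<Longrightarrow> ((\<lambda>z. H z s) has_field_derivative dz_kernel H z s) (at z)"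
    using dz_kernel_sum[OF \<open>open D\<close>, of "{..<n}" U z s H V] 1 by auto
qed

lemma sep_kernel_ds:
  assumes "open D" "sep_kernel D H"
  shows "sep_kernel D (ds_kernel H)"
    and "z \<in> D \<Longrightarrow> s \<in> D \<Longrightarrow> ((\<lambda>s. H z s) has_field_derivative ds_kernel H z s) (at s)"
proof -
  obtain n U V where 1: "\<And>i. U i holomorphic_on D" "\<And>i. V i holomorphic_on D"
    "\<And>z s. z \<in> D \<Longrightarrow> s \<in> D \<Longrightarrow> H z s = (\<Sum>i<n::nat. U i z * V i s)" using assms(2) by (elim sep_kernelE) blast
  show "sep_kernel D (ds_kernel H)"
    by (rule sep_kernelI[of "{..<n}" U _ "\<lambda>i. deriv (V i)"])
      (use ds_kernel_sum(2)[OF \<open>open D\<close>, of "{..<n}" V _ _ H U] 1 \<open>open D\<close> in \<open>auto intro: holomorphic_deriv\<close>)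
  show "z \<in> D \<Longrightarrow> s \<in> D \<Longrightarrow> ((\<lambda>s. H z s) has_field_derivative ds_kernel H z s) (at s)"
    using ds_kernel_sum[OF \<open>open D\<close>, of "{..<n}" V z s H U] 1 by auto
qed

text \<open>Applying \<open>\<partial>/\<partial>z\<close> to \<open>H(z, cnj z) = 0\<close> only sees the first argument.\<close>

lemma sep_kernel_diagonal_dz:
  assumes H: "sep_kernel (ball 0 r) H" and 0: "\<And>z. z \<in> ball 0 r \<Longrightarrow> H z (cnj z) = 0" and z: "z \<in> ball 0 r"
  shows "dz_kernel H z (cnj z) = 0"
proof -
  let ?D = "ball (0::complex) r"
  obtain n U V where 1: "\<And>i. U i holomorphic_on ?D" "\<And>i. V i holomorphic_on ?D"
    "\<And>z s. z \<in> ?D \<Longrightarrow> s \<in> ?D \<Longrightarrow> H z s = (\<Sum>i<n::nat. U i z * V i s)" using H by (elim sep_kernelE) blast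
  define a where "a = (\<Sum>i<n. deriv (U i) z * V i (cnj z))"
  define b where "b = (\<Sum>i<n. U i z * deriv (V i) (cnj z))"
  have dU: "(U i has_derivative (\<lambda>h. deriv (U i) z * h)) (at z)" for i
    using holomorphic_derivI[OF 1(1) _ z] by (simp add: has_field_derivative_def)
  have dV: "((\<lambda>w. V i (cnj w)) has_derivative (\<lambda>h. deriv (V i) (cnj z) * cnj h)) (at z)" for i
  proof -
    have "(V i has_derivative (\<lambda>h. deriv (V i) (cnj z) * h)) (at (cnj z))"
      using holomorphic_derivI[OF 1(2), of "cnj z"] z by (simp add: has_field_derivative_def)
    then show ?thesis
      using has_derivative_compose[of cnj cnj z UNIV "V i"] bounded_linear_imp_has_derivative[OF bounded_linear_cnj]
      by auto
  qed
  have "((\<lambda>w. \<Sum>i<n. U i w * V i (cnj w)) has_derivative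
      (\<lambda>h. \<Sum>i<n. U i z * (deriv (V i) (cnj z) * cnj h) + deriv (U i) z * h * V i (cnj z))) (at z)"
    by (intro has_derivative_sum has_derivative_mult dU dV)
  moreover have "((\<lambda>w. \<Sum>i<n. U i w * V i (cnj w)) has_derivative (\<lambda>h. 0)) (at z)"
    by (rule has_derivative_transform_within_open[of "\<lambda>_. 0" _ _ _ ?D]) (use 0 1(3) z in auto)
  ultimately have "(\<lambda>h. \<Sum>i<n. U i z * (deriv (V i) (cnj z) * cnj h) + deriv (U i) z * h * V i (cnj z)) = (\<lambda>h. 0)"
    by (rule has_derivative_unique)
  then have *: "b * cnj h + a * h = 0" for h
    by (simp add: fun_eq_iff a_def b_def sum.distrib sum_distrib_left sum_distrib_right mult_ac)
  \<comment> \<open>\<open>a\<close> and \<open>b\<close> are the complex-linear and the antilinear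
    part of a vanishing differential. The directions 1 and \<open>\<i>\<close> separate
    them.\<close>
  have "a = 0" using *[of 1] *[of \<i>] by (auto simp: complex_eq_iff)
  then show ?thesis
    using dz_kernel_sum(2)[of ?D "{..<n}" U z "cnj z" H V] 1 z by (simp add: a_def)
qed

text \<open>Vanishing at \<open>s = cnj z\<close> survives differentiation in \<open>z\<close>. For
  fixed \<open>s\<close> all derivatives of the holomorphic function \<open>H\<close> in
  \<open>z\<close> therefore vanish at the point \<open>cnj s\<close>, and the identity theorem
  finishes the argument.\<close>

lemma sep_kernel_polarization:
  assumes H: "sep_kernel (ball 0 r) H" and 0: "\<And>z. z \<in> ball 0 r \<Longrightarrow> H z (cnj z) = 0"
    and z: "z \<in> ball 0 r" and s: "s \<in> ball 0 r"
  shows "H z s = 0"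
proof -
  let ?D = "ball (0::complex) r"
  define Hk where "Hk k = (dz_kernel ^^ k) H" for k
  have sep: "sep_kernel ?D (Hk k)" for k
    unfolding Hk_def by (induction k) (auto intro: H sep_kernel_dz)
  have diag: "Hk k z (cnj z) = 0" if "z \<in> ?D" for k z
    using that
  proof (induction k arbitrary: z)
    case (Suc k)
    have "dz_kernel (Hk k) z (cnj z) = 0" by (rule sep_kernel_diagonal_dz[OF sep Suc.IH Suc.prems])
    then show ?case by (simp add: Hk_def)
  qed (simp add: Hk_def 0)
  have der: "(deriv ^^ k) (\<lambda>z. H z s) z = Hk k z s" if "z \<in> ?D" for k z
    using that
  proof (induction k arbitrary: z)
    case (Suc k)
    have "deriv ((deriv ^^ k) (\<lambda>z. H z s)) z = deriv (\<lambda>z. Hk k z s) z"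
      by (rule deriv_cong_ev) (use Suc in \<open>auto intro!: eventually_nhds_in_open[THEN eventually_mono, of ?D]\<close>)
    then show ?case by (simp add: Hk_def dz_kernel_def)
  qed (simp add: Hk_def)
  have hol: "(\<lambda>z. H z s) holomorphic_on ?D"
    using sep_kernel_dz(2)[OF _ H _ s] unfolding holomorphic_on_open[OF open_ball] by blast
  have "(\<lambda>z. H z s) z = 0"
  proof (rule holomorphic_fun_eq_0_on_connected[OF hol _ _ _ _ z])
    show "(deriv ^^ k) (\<lambda>z. H z s) (cnj s) = 0" for k
      using der[of "cnj s" k] diag[of "cnj s" k] s by simp
  qed (use s in auto)
  then show ?thesis by simp
qed

text \<open>Laurent rather than power series in the first variable: the coefficients have to lie in a field
  for the valuation argument.\<close>

definition kernel_fps :: "(complex \<Rightarrow> complex \<Rightarrow> complex) \<Rightarrow> complex fls fps" where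
  "kernel_fps H = Abs_fps (\<lambda>k. fps_to_fls (fps_expansion (\<lambda>z. fps_nth (fps_expansion (H z) 0) k) 0))"

lemma fps_to_fls_sum': "fps_to_fls (sum f I) = (\<Sum>i\<in>I. fps_to_fls (f i))"
  by (induction I rule: infinite_finite_induct) auto

lemma fls_const_sum': "fls_const (sum f I) = (\<Sum>i\<in>I. fls_const (f i))"
  by (induction I rule: infinite_finite_induct) (auto simp: fls_plus_const[symmetric])

text \<open>Expansion works factor by factor on a finite-rank representation. The formula exhibits
  finite rank over the constants, and the algebraic properties of \<open>kernel_fps\<close> are read
  off from it.\<close>

lemma kernel_fps_sum:
  fixes I :: "'i set"
  assumes r: "r > 0" and I: "finite I"
    and U: "\<And>i. i \<in> I \<Longrightarrow> U i holomorphic_on ball 0 r" and V: "\<And>i. i \<in> I \<Longrightarrow> V i holomorphic_on ball 0 r"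
    and H: "\<And>z s. z \<in> ball 0 r \<Longrightarrow> s \<in> ball 0 r \<Longrightarrow> H z s = (\<Sum>i\<in>I. U i z * V i s)"
  shows "fps_nth (kernel_fps H) k =
    (\<Sum>i\<in>I. fls_const (fps_nth (fps_expansion (V i) 0) k) * fps_to_fls (fps_expansion (U i) 0))"
proof -
  let ?D = "ball (0::complex) r"
  have ev: "eventually (\<lambda>z. z \<in> ?D) (nhds 0)" using r by (intro eventually_nhds_in_open) auto
  have 1: "fps_expansion (H z) 0 = (\<Sum>i\<in>I. fps_const (U i z) * fps_expansion (V i) 0)" if z: "z \<in> ?D" for z
  proof (rule fps_expansion_eqI)
    have "(\<lambda>s. \<Sum>i\<in>I. U i z * V i s) has_fps_expansion (\<Sum>i\<in>I. fps_const (U i z) * fps_expansion (V i) 0)"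
      using r V by (intro has_fps_expansion_sum has_fps_expansion_cmult_left has_fps_expansion_fps_expansion[of ?D]) auto
    then show "H z has_fps_expansion (\<Sum>i\<in>I. fps_const (U i z) * fps_expansion (V i) 0)"
      by (subst has_fps_expansion_cong[OF _ refl]) (use ev H z in \<open>auto elim!: eventually_mono\<close>)
  qed
  have "fps_expansion (\<lambda>z. fps_nth (fps_expansion (H z) 0) k) 0
      = (\<Sum>i\<in>I. fps_expansion (U i) 0 * fps_const (fps_nth (fps_expansion (V i) 0) k))"
  proof (rule fps_expansion_eqI)
    have "(\<lambda>z. \<Sum>i\<in>I. U i z * fps_nth (fps_expansion (V i) 0) k) has_fps_expansion
        (\<Sum>i\<in>I. fps_expansion (U i) 0 * fps_const (fps_nth (fps_expansion (V i) 0) k))"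
      using r U by (intro has_fps_expansion_sum has_fps_expansion_cmult_right has_fps_expansion_fps_expansion[of ?D]) auto
    then show "(\<lambda>z. fps_nth (fps_expansion (H z) 0) k) has_fps_expansion
        (\<Sum>i\<in>I. fps_expansion (U i) 0 * fps_const (fps_nth (fps_expansion (V i) 0) k))"
      by (subst has_fps_expansion_cong[OF _ refl]) (use ev 1 in \<open>auto elim!: eventually_mono simp: fps_sum_nth\<close>)
  qed
  then show ?thesis
    by (simp add: kernel_fps_def fps_to_fls_sum' fls_times_fps_to_fls mult.commute)
qed

lemma kernel_fps_finite_rank:
  assumes "r > 0" "sep_kernel (ball 0 r) H"
  shows "finite_rank_fps fls_const (kernel_fps H)"
proof -
  obtain n U V where 1: "\<And>i. U i holomorphic_on ball 0 r" "\<And>i. V i holomorphic_on ball 0 r"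
    "\<And>z s. z \<in> ball 0 r \<Longrightarrow> s \<in> ball 0 r \<Longrightarrow> H z s = (\<Sum>i<n::nat. U i z * V i s)" using assms(2) by (elim sep_kernelE) blast
  show ?thesis unfolding finite_rank_fps_def
    using kernel_fps_sum[OF assms(1), of "{..<n}" U V H] 1
    by (intro exI[of _ n] exI[of _ "\<lambda>i. fps_to_fls (fps_expansion (U i) 0)"]
      exI[of _ "\<lambda>i k. fps_nth (fps_expansion (V i) 0) k"]) auto
qed

text \<open>Holds termwise: a product of two terms \<open>U i z * V i s\<close> expands by the
  Cauchy product in each variable separately, and the finite sums may be interchanged.\<close>

lemma kernel_fps_mult:
  assumes r: "r > 0" and "sep_kernel (ball 0 r) H" "sep_kernel (ball 0 r) H'"
  shows "kernel_fps (\<lambda>z s. H z s * H' z s) = kernel_fps H * kernel_fps H'"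
proof (rule fps_ext)
  fix k
  obtain n U V where 1: "\<And>i. U i holomorphic_on ball 0 r" "\<And>i. V i holomorphic_on ball 0 r"
    "\<And>z s. z \<in> ball 0 r \<Longrightarrow> s \<in> ball 0 r \<Longrightarrow> H z s = (\<Sum>i<n::nat. U i z * V i s)" using assms(2) by (elim sep_kernelE) blast
  obtain m U' V' where 2: "\<And>i. U' i holomorphic_on ball 0 r" "\<And>i. V' i holomorphic_on ball 0 r"
    "\<And>z s. z \<in> ball 0 r \<Longrightarrow> s \<in> ball 0 r \<Longrightarrow> H' z s = (\<Sum>i<m::nat. U' i z * V' i s)" using assms(3) by (elim sep_kernelE) blast
  have exp_mult: "fps_expansion (\<lambda>z. f z * g z) 0 = fps_expansion f 0 * fps_expansion g 0"
    if "f holomorphic_on ball 0 r" "g holomorphic_on ball 0 r" for f g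
    using r that by (intro fps_expansion_eqI has_fps_expansion_mult has_fps_expansion_fps_expansion[of "ball 0 r"]) auto
  let ?v = "\<lambda>i k. fls_const (fps_nth (fps_expansion (V i) 0) k)"
  let ?v' = "\<lambda>i k. fls_const (fps_nth (fps_expansion (V' i) 0) k)"
  let ?u = "\<lambda>i. fps_to_fls (fps_expansion (U i) 0)" let ?u' = "\<lambda>i. fps_to_fls (fps_expansion (U' i) 0)"
  have H: "H z s * H' z s = (\<Sum>p\<in>{..<n} \<times> {..<m}. (U (fst p) z * U' (snd p) z) * (V (fst p) s * V' (snd p) s))"
    if "z \<in> ball 0 r" "s \<in> ball 0 r" for z s
    unfolding 1(3)[OF that] 2(3)[OF that] sum_product sum.cartesian_product
    by (intro sum.cong) auto
  have "fps_nth (kernel_fps (\<lambda>z s. H z s * H' z s)) k =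
     (\<Sum>p\<in>{..<n} \<times> {..<m}. fls_const (fps_nth (fps_expansion (\<lambda>s. V (fst p) s * V' (snd p) s) 0) k) *
        fps_to_fls (fps_expansion (\<lambda>z. U (fst p) z * U' (snd p) z) 0))"
    by (rule kernel_fps_sum[OF r]) (use 1 2 H in \<open>auto intro!: holomorphic_intros\<close>)
  also have "\<dots> = (\<Sum>p\<in>{..<n} \<times> {..<m}. \<Sum>l=0..k. (?v (fst p) l * ?u (fst p)) * (?v' (snd p) (k - l) * ?u' (snd p)))"
  proof (rule sum.cong[OF refl])
    fix p
    let ?a = "fps_expansion (V (fst p)) 0" and ?b = "fps_expansion (V' (snd p)) 0"
    have "fls_const (fps_nth (?a * ?b) k) * fps_to_fls (fps_expansion (U (fst p)) 0 * fps_expansion (U' (snd p)) 0)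
       = (\<Sum>l=0..k. fls_const (fps_nth ?a l) * fls_const (fps_nth ?b (k - l))) * (?u (fst p) * ?u' (snd p))"
      by (simp only: fps_mult_nth fls_const_sum' fls_const_mult_const fls_times_fps_to_fls)
    also have "\<dots> = (\<Sum>l=0..k. (?v (fst p) l * ?u (fst p)) * (?v' (snd p) (k - l) * ?u' (snd p)))"
      unfolding sum_distrib_right by (intro sum.cong refl) (simp only: mult_ac)
    finally show "fls_const (fps_nth (fps_expansion (\<lambda>s. V (fst p) s * V' (snd p) s) 0) k) *
        fps_to_fls (fps_expansion (\<lambda>z. U (fst p) z * U' (snd p) z) 0) =
        (\<Sum>l=0..k. (?v (fst p) l * ?u (fst p)) * (?v' (snd p) (k - l) * ?u' (snd p)))"
      by (simp only: exp_mult 1 2)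
  qed
  also have "\<dots> = (\<Sum>l=0..k. \<Sum>p\<in>{..<n} \<times> {..<m}. (?v (fst p) l * ?u (fst p)) * (?v' (snd p) (k - l) * ?u' (snd p)))"
    by (rule sum.swap)
  also have "\<dots> = (\<Sum>l=0..k. fps_nth (kernel_fps H) l * fps_nth (kernel_fps H') (k - l))"
  proof (rule sum.cong[OF refl])
    fix l
    have "fps_nth (kernel_fps H) l = (\<Sum>i<n. ?v i l * ?u i)"
      by (rule kernel_fps_sum[OF r]) (use 1 in auto)
    moreover have "fps_nth (kernel_fps H') (k - l) = (\<Sum>i<m. ?v' i (k - l) * ?u' i)"
      by (rule kernel_fps_sum[OF r]) (use 2 in auto)
    ultimately show "(\<Sum>p\<in>{..<n} \<times> {..<m}. (?v (fst p) l * ?u (fst p)) * (?v' (snd p) (k - l) * ?u' (snd p))) =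
        fps_nth (kernel_fps H) l * fps_nth (kernel_fps H') (k - l)"
      by (simp add: sum_product sum.cartesian_product case_prod_unfold)
  qed
  finally show "fps_nth (kernel_fps (\<lambda>z s. H z s * H' z s)) k = fps_nth (kernel_fps H * kernel_fps H') k"
    by (simp add: fps_mult_nth)
qed

lemma kernel_fps_cong:
  assumes r: "r > 0" and "sep_kernel (ball 0 r) H"
    and "\<And>z s. z \<in> ball 0 r \<Longrightarrow> s \<in> ball 0 r \<Longrightarrow> H' z s = H z s"
  shows "kernel_fps H' = kernel_fps H"
proof (rule fps_ext)
  fix k
  obtain n U V where 1: "\<And>i. U i holomorphic_on ball 0 r" "\<And>i. V i holomorphic_on ball 0 r"
    "\<And>z s. z \<in> ball 0 r \<Longrightarrow> s \<in> ball 0 r \<Longrightarrow> H z s = (\<Sum>i<n::nat. U i z * V i s)" using assms(2) by (elim sep_kernelE) blast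
  show "fps_nth (kernel_fps H') k = fps_nth (kernel_fps H) k"
    using kernel_fps_sum[OF r, of "{..<n}" U V H k] kernel_fps_sum[OF r, of "{..<n}" U V H' k] 1 assms(3) by auto
qed

lemma kernel_fps_add:
  assumes r: "r > 0" and "sep_kernel (ball 0 r) H" "sep_kernel (ball 0 r) H'"
  shows "kernel_fps (\<lambda>z s. H z s + H' z s) = kernel_fps H + kernel_fps H'"
proof (rule fps_ext)
  fix k
  obtain n U V where 1: "\<And>i. U i holomorphic_on ball 0 r" "\<And>i. V i holomorphic_on ball 0 r"
    "\<And>z s. z \<in> ball 0 r \<Longrightarrow> s \<in> ball 0 r \<Longrightarrow> H z s = (\<Sum>i<n::nat. U i z * V i s)" using assms(2) by (elim sep_kernelE) blast
  obtain m U' V' where 2: "\<And>i. U' i holomorphic_on ball 0 r" "\<And>i. V' i holomorphic_on ball 0 r"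
    "\<And>z s. z \<in> ball 0 r \<Longrightarrow> s \<in> ball 0 r \<Longrightarrow> H' z s = (\<Sum>i<m::nat. U' i z * V' i s)" using assms(3) by (elim sep_kernelE) blast
  have "H z s + H' z s = (\<Sum>i\<in>{..<n} <+> {..<m}. case_sum U U' i z * case_sum V V' i s)"
    if "z \<in> ball 0 r" "s \<in> ball 0 r" for z s using 1(3)[OF that] 2(3)[OF that] by (simp add: sum.Plus)
  then have "fps_nth (kernel_fps (\<lambda>z s. H z s + H' z s)) k =
     (\<Sum>p\<in>{..<n} <+> {..<m}. fls_const (fps_nth (fps_expansion (case_sum V V' p) 0) k) * fps_to_fls (fps_expansion (case_sum U U' p) 0))"
    by (intro kernel_fps_sum[OF r]) (use 1 2 in \<open>auto split: sum.splits\<close>)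
  also have "\<dots> = fps_nth (kernel_fps H) k + fps_nth (kernel_fps H') k"
    using kernel_fps_sum[OF r, of "{..<n}" U V H k] kernel_fps_sum[OF r, of "{..<m}" U' V' H' k] 1 2
    by (simp add: sum.Plus)
  finally show "fps_nth (kernel_fps (\<lambda>z s. H z s + H' z s)) k = fps_nth (kernel_fps H + kernel_fps H') k" by simp
qed

lemma kernel_fps_const:
  "kernel_fps (\<lambda>z s. c) = fps_const (fls_const c)"
proof (rule fps_ext)
  fix k
  have "fps_expansion (\<lambda>_. c) 0 = fps_const c" for c :: complex
    by (intro fps_expansion_eqI) auto
  then show "fps_nth (kernel_fps (\<lambda>z s. c)) k = fps_nth (fps_const (fls_const c)) k"
    by (simp add: kernel_fps_def)
qed

lemma kernel_fps_ds:
  assumes r: "r > 0" and "sep_kernel (ball 0 r) H"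
  shows "kernel_fps (ds_kernel H) = fps_deriv (kernel_fps H)"
proof (rule fps_ext)
  fix k
  obtain n U V where 1: "\<And>i. U i holomorphic_on ball 0 r" "\<And>i. V i holomorphic_on ball 0 r"
    "\<And>z s. z \<in> ball 0 r \<Longrightarrow> s \<in> ball 0 r \<Longrightarrow> H z s = (\<Sum>i<n::nat. U i z * V i s)" using assms(2) by (elim sep_kernelE) blast
  have ex: "fps_expansion (deriv (V i)) 0 = fps_deriv (fps_expansion (V i) 0)" for i
    using r 1 by (intro fps_expansion_eqI has_fps_expansion_deriv has_fps_expansion_fps_expansion[of "ball 0 r"]) auto
  have "fps_nth (kernel_fps (ds_kernel H)) k =
    (\<Sum>i<n. fls_const (fps_nth (fps_expansion (deriv (V i)) 0) k) * fps_to_fls (fps_expansion (U i) 0))"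
    using ds_kernel_sum(2)[of "ball 0 r" "{..<n}" V _ _ H U] 1
    by (intro kernel_fps_sum[OF r]) (auto intro: holomorphic_deriv)
  also have "\<dots> = of_nat (k + 1) * fps_nth (kernel_fps H) (k + 1)"
    using kernel_fps_sum[OF r, of "{..<n}" U V H "k + 1"] 1
    by (simp add: ex fls_of_nat sum_distrib_left mult.assoc[symmetric] fls_const_mult_const del: of_nat_Suc)
  finally show "fps_nth (kernel_fps (ds_kernel H)) k = fps_nth (fps_deriv (kernel_fps H)) k" by simp
qed

text \<open>Identifies the coefficient whose integrality will be contradicted.\<close>

lemma kernel_fps_nth_0:
  assumes r: "r > 0" and "sep_kernel (ball 0 r) H"
  shows "fps_nth (kernel_fps H) 0 = fps_to_fls (fps_expansion (\<lambda>z. H z 0) 0)"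
proof -
  have "fps_expansion (\<lambda>z. fps_nth (fps_expansion (H z) 0) 0) 0 = fps_expansion (\<lambda>z. H z 0) 0"
    by (simp add: fps_expansion_def)
  then show ?thesis by (simp add: kernel_fps_def)
qed

section \<open>A flat potential against the logarithm of a quotient of finite-rank kernels\<close>

lemma vector_space_fls: "vector_space (\<lambda>c x. fls_const c * x :: complex fls)"
  by unfold_locales (simp_all add: algebra_simps fls_plus_const[symmetric] fls_const_mult_const[symmetric] del: fls_const_mult_const)

text \<open>\<open>diag\<close> says that the sum of the \<open>|f j|^2\<close> and
  \<open>log (N / M^2)\<close> have the same mixed second derivative on the disc. Polarized and
  integrated once in the first variable, this presents a finite-rank kernel \<open>P\<close> as a
  logarithmic derivative in \<open>s\<close>. If the claimed sum were nonzero, \<open>P\<close> at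
  \<open>s = 0\<close> would be a non-constant power series, contrary to
  \<open>log_derivative_integral\<close> for a suitable valuation ring.\<close>

theorem no_log_ratio_potential:
  fixes f :: "'j \<Rightarrow> complex \<Rightarrow> complex"
  defines "D r \<equiv> ball (0::complex) r"
  assumes r: "r > 0" and J: "finite J" and f: "\<And>j. j \<in> J \<Longrightarrow> f j holomorphic_on D r"
    and N: "sep_kernel (D r) N" and M: "sep_kernel (D r) M"
    and N0: "\<And>z s. z \<in> D r \<Longrightarrow> s \<in> D r \<Longrightarrow> N z s \<noteq> 0" and M0: "\<And>z s. z \<in> D r \<Longrightarrow> s \<in> D r \<Longrightarrow> M z s \<noteq> 0"
    and diag: "\<And>z s. z \<in> D r \<Longrightarrow> s = cnj z \<Longrightarrow>
      (\<Sum>j\<in>J. deriv (f j) z * cnj (deriv (f j) z)) =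
        (dz_kernel (ds_kernel N) z s * N z s - dz_kernel N z s * ds_kernel N z s) / (N z s)\<^sup>2
        - 2 * ((dz_kernel (ds_kernel M) z s * M z s - dz_kernel M z s * ds_kernel M z s) / (M z s)\<^sup>2)"
  shows "(\<Sum>j\<in>J. deriv (f j) 0 * cnj (deriv (f j) 0)) = 0"
proof (rule ccontr)
  let ?D = "ball (0::complex) r"
  note [unfolded D_def] = f N M N0 M0 diag
  note f = this(1) and N = this(2) and M = this(3) and N0 = this(4) and M0 = this(5) and diag = this(6)
  assume nz: "(\<Sum>j\<in>J. deriv (f j) 0 * cnj (deriv (f j) 0)) \<noteq> 0"
  \<comment> \<open>\<open>g j\<close> is the derivative of the reflected function
    \<open>cnj (f j (cnj s))\<close>. So \<open>F'\<close> at \<open>s = cnj z\<close> is the left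
    side of \<open>diag\<close>, and \<open>F\<close> is a primitive of \<open>F'\<close> in the
    first variable.\<close>
  define g where "g j s = cnj (deriv (f j) (cnj s))" for j s
  have df: "deriv (f j) holomorphic_on ?D" if "j \<in> J" for j
    using f[OF that] by (auto intro: holomorphic_deriv)
  have g: "g j holomorphic_on ?D" if "j \<in> J" for j
  proof -
    have "cnj ` ?D = ?D" by (auto simp: image_iff intro!: bexI[of _ "cnj _"])
    then have "cnj \<circ> deriv (f j) \<circ> cnj holomorphic_on ?D"
      using df[OF that] by (intro holomorphic_on_compose_cnj_cnj) auto
    then show ?thesis by (simp add: g_def[abs_def] o_def)
  qed
  define F where "F z s = (\<Sum>j\<in>J. f j z * g j s)" for z s
  define F' where "F' z s = (\<Sum>j\<in>J. deriv (f j) z * g j s)" for z s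
  note sN = sep_kernel_ds[OF open_ball N] note sM = sep_kernel_ds[OF open_ball M]
  note zN = sep_kernel_dz[OF open_ball N] note zM = sep_kernel_dz[OF open_ball M]
  note zsN = sep_kernel_dz[OF open_ball sN(1)] note zsM = sep_kernel_dz[OF open_ball sM(1)]
  have sepF: "sep_kernel ?D F" and sepF': "sep_kernel ?D F'"
    unfolding F_def[abs_def] F'_def[abs_def]
    by (rule sep_kernelI[OF J], use f g df in auto)+
  define N1 where "N1 z s = dz_kernel (ds_kernel N) z s * N z s - dz_kernel N z s * ds_kernel N z s" for z s
  define M1 where "M1 z s = dz_kernel (ds_kernel M) z s * M z s - dz_kernel M z s * ds_kernel M z s" for z s
  \<comment> \<open>Denominators are cleared before polarizing, because quotients of finite-rank
    kernels need not have finite rank.\<close>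
  have W0: "F' z s * ((N z s)\<^sup>2 * (M z s)\<^sup>2) - (N1 z s * (M z s)\<^sup>2 - 2 * (M1 z s * (N z s)\<^sup>2)) = 0"
    if "z \<in> ?D" "s \<in> ?D" for z s
  proof (rule sep_kernel_polarization[where H = "\<lambda>z s. F' z s * ((N z s)\<^sup>2 * (M z s)\<^sup>2) - (N1 z s * (M z s)\<^sup>2 - 2 * (M1 z s * (N z s)\<^sup>2))"])
    show "sep_kernel ?D (\<lambda>z s. F' z s * ((N z s)\<^sup>2 * (M z s)\<^sup>2) - (N1 z s * (M z s)\<^sup>2 - 2 * (M1 z s * (N z s)\<^sup>2)))"
      unfolding N1_def M1_def
      by (intro sep_kernel_diff sep_kernel_mult sep_kernel_power sep_kernel_const N M sepF' sN(1) sM(1) zN(1) zM(1) zsN(1) zsM(1))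
    show "F' z (cnj z) * ((N z (cnj z))\<^sup>2 * (M z (cnj z))\<^sup>2) - (N1 z (cnj z) * (M z (cnj z))\<^sup>2 - 2 * (M1 z (cnj z) * (N z (cnj z))\<^sup>2)) = 0"
      if z: "z \<in> ?D" for z
    proof -
      have "N z (cnj z) \<noteq> 0" "M z (cnj z) \<noteq> 0" using N0 M0 z by auto
      moreover have "F' z (cnj z) = N1 z (cnj z) / (N z (cnj z))\<^sup>2 - 2 * (M1 z (cnj z) / (M z (cnj z))\<^sup>2)"
        using diag[OF z refl] by (simp add: F'_def g_def N1_def M1_def)
      ultimately show ?thesis by (simp add: field_simps)
    qed
  qed (use that in auto)
  \<comment> \<open>The difference of the \<open>s\<close>-derivatives of the two polarized
    potentials. Its derivative in \<open>z\<close> is \<open>W0\<close> divided by the denominators,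
    so \<open>R\<close> depends on \<open>s\<close> alone.\<close>
  define R where "R z s = ds_kernel N z s / N z s - 2 * (ds_kernel M z s / M z s) - F z s" for z s
  have dF: "((\<lambda>z. F z s) has_field_derivative F' z s) (at z)" if "z \<in> ?D" "s \<in> ?D" for z s
    using dz_kernel_sum(1)[OF open_ball J f that, where H = F and V = g] by (simp add: F_def F'_def)
  have dR: "((\<lambda>z. R z s) has_field_derivative 0) (at z)" if "z \<in> ?D" "s \<in> ?D" for z s
  proof -
    have nz: "N z s \<noteq> 0" "M z s \<noteq> 0" using N0 M0 that by auto
    have "((\<lambda>z. R z s) has_field_derivative
       ((dz_kernel (ds_kernel N) z s * N z s - ds_kernel N z s * dz_kernel N z s) / (N z s * N z s)
        - 2 * ((dz_kernel (ds_kernel M) z s * M z s - ds_kernel M z s * dz_kernel M z s) / (M z s * M z s)) - F' z s)) (at z)"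
      unfolding R_def
      by (intro DERIV_diff DERIV_cmult DERIV_divide zsN(2) zN(2) zsM(2) zM(2) dF that nz)
    moreover have "N1 z s / (N z s)\<^sup>2 - 2 * (M1 z s / (M z s)\<^sup>2) - F' z s = 0"
      using W0[OF that] nz by (simp add: field_simps)
    ultimately show ?thesis by (simp add: N1_def M1_def power2_eq_square mult.commute)
  qed
  define h where "h s = R 0 s" for s
  have Rh: "R z s = h s" if "z \<in> ?D" "s \<in> ?D" for z s
  proof -
    have "\<exists>c. \<forall>z\<in>?D. R z s = c"
      using dR[OF _ that(2)] by (intro has_field_derivative_zero_constant) (auto intro: has_field_derivative_at_within)
    then show ?thesis using that r by (auto simp: h_def)
  qed
  have hol0: "(\<lambda>s. H 0 s) holomorphic_on ?D" if "sep_kernel ?D H" for H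
  proof -
    have "((\<lambda>s. H 0 s) has_field_derivative ds_kernel H 0 s) (at s)" if "s \<in> ?D" for s
      using sep_kernel_ds(2)[OF open_ball \<open>sep_kernel ?D H\<close> _ that, of 0] r by simp
    then show ?thesis unfolding holomorphic_on_open[OF open_ball] by blast
  qed
  have h: "h holomorphic_on ?D"
    unfolding h_def R_def using r N0[of 0] M0[of 0]
    by (intro holomorphic_intros hol0 sN(1) sM(1) N M sepF) auto
  \<comment> \<open>\<open>h\<close> is the constant of integration in \<open>z\<close>. As a
    function of \<open>s\<close> alone it has rank one, although it arises as a quotient; this is
    why \<open>P\<close> has finite rank.\<close>
  define P where "P z s = F z s + h s" for z s
  have sepP: "sep_kernel ?D P" unfolding P_def[abs_def] by (intro sep_kernel_add sepF sep_kernel_snd h)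
  have PNM: "P z s * N z s * M z s = ds_kernel N z s * M z s + (- 2) * (ds_kernel M z s * N z s)"
    if "z \<in> ?D" "s \<in> ?D" for z s
  proof -
    have "N z s \<noteq> 0" "M z s \<noteq> 0" using N0 M0 that by auto
    moreover have "P z s = ds_kernel N z s / N z s - 2 * (ds_kernel M z s / M z s)"
      using Rh[OF that, symmetric] by (simp add: P_def) (simp add: R_def)
    ultimately show ?thesis by (simp add: field_simps)
  qed
  have "kernel_fps (\<lambda>z s. P z s * N z s * M z s) = kernel_fps (\<lambda>z s. ds_kernel N z s * M z s + (- 2) * (ds_kernel M z s * N z s))"
    by (rule kernel_fps_cong[OF r _ PNM])
      (intro sep_kernel_add sep_kernel_mult sep_kernel_const sN(1) sM(1) N M, auto)
  also have "\<dots> = fps_deriv (kernel_fps N) * kernel_fps M + fps_const (fls_const (- 2)) * (fps_deriv (kernel_fps M) * kernel_fps N)"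
    using r by (simp only: kernel_fps_add kernel_fps_mult kernel_fps_ds kernel_fps_const sep_kernel_mult sep_kernel_const sN(1) sM(1) N M)
  also have "fps_const (fls_const (- 2)) = - (of_nat 2 :: complex fls fps)"
  proof -
    have "fls_const (- 2 :: complex) = - 2"
      by (metis fls_const_numeral fls_const_uminus)
    moreover have "fps_const (- 2 :: complex fls) = - fps_const 2" by (simp add: fps_const_neg)
    ultimately show ?thesis by (simp add: numeral_fps_const)
  qed
  also have "kernel_fps (\<lambda>z s. P z s * N z s * M z s) = kernel_fps P * kernel_fps N * kernel_fps M"
    using r by (simp only: kernel_fps_mult sep_kernel_mult sepP N M)
  finally have eq: "kernel_fps P * kernel_fps N * kernel_fps M =
      fps_deriv (kernel_fps N) * kernel_fps M - of_nat 2 * fps_deriv (kernel_fps M) * kernel_fps N"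
    by (simp add: algebra_simps)
  have nz_fps: "kernel_fps H \<noteq> 0" if "sep_kernel ?D H" "H 0 0 \<noteq> 0" for H
  proof
    assume "kernel_fps H = 0"
    then have "fps_to_fls (fps_expansion (\<lambda>z. H z 0) 0) = 0" using kernel_fps_nth_0[OF r that(1)] by simp
    then have "fps_nth (fps_expansion (\<lambda>z. H z 0) 0) 0 = 0" by simp
    then show False using that by (simp add: fps_expansion_def)
  qed
  define e where "e = fps_expansion (\<lambda>z. P z 0) 0"
  have e0: "fps_nth e 0 = P 0 0" by (simp add: e_def fps_expansion_def)
  have "((\<lambda>z. P z 0) has_field_derivative F' 0 0 + 0) (at 0)"
    unfolding P_def using r by (intro DERIV_add dF DERIV_const) auto
  then have "deriv (\<lambda>z. P z 0) 0 = F' 0 0" by (simp add: DERIV_imp_deriv)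
  then have e1: "fps_nth e 1 \<noteq> 0" using nz by (simp add: e_def fps_expansion_def F'_def g_def)
  \<comment> \<open>Without its constant term the series has positive order, and its linear
    coefficient, the value \<open>F' 0 0\<close>, keeps it from being zero.\<close>
  define x where "x = fps_to_fls (e - fps_const (P 0 0))"
  have e': "fps_nth (e - fps_const (P 0 0)) 1 \<noteq> 0" "fps_nth (e - fps_const (P 0 0)) 0 = 0" using e0 e1 by auto
  then have ne: "e - fps_const (P 0 0) \<noteq> 0" by (metis fps_zero_nth)
  then have x0: "x \<noteq> 0" by (simp add: x_def)
  have "subdegree (e - fps_const (P 0 0)) > 0" using ne e'(2) by (metis gr0I nth_subdegree_nonzero)
  then have "fls_subdegree x > 0" unfolding x_def by (simp only: fls_subdegree_fls_to_fps of_nat_0_less_iff)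
  then obtain V where V: "valuation_ring V" "range fls_const \<subseteq> V" "x \<notin> V"
    using exists_valuation_ring_fls[OF x0] by blast
  have "fps_nth (kernel_fps P) 0 \<in> V"
    using r V(2) N0[of 0 0] M0[of 0 0] by (intro log_derivative_integral[OF V(1) vector_space_fls _ _ _ _ _ _ eq])
      (auto simp: nz_fps N M intro!: kernel_fps_finite_rank sepP)
  then have "fps_to_fls e \<in> V" by (simp add: kernel_fps_nth_0[OF r sepP] e_def)
  moreover have "x = fps_to_fls e - fls_const (P 0 0)" by (simp add: x_def fps_const_to_fls)
  ultimately have "x \<in> V" using V(1,2) subring_setD(3) by (auto simp: valuation_ring_def)
  then show False using V by simp
qed

section \<open>Real and complex determinants\<close>

text \<open>A well-ordered type indexing the real coordinates of \<open>\<complex>\<^sup>n\<close>: the change of variables theorem is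
  stated for such index types. The order itself is irrelevant.\<close>

typedef 'a real_index = "UNIV :: ('a \<times> bool) set" by simp

definition index_code :: "'a::finite real_index \<Rightarrow> nat" where
  "index_code x = (SOME f :: 'a \<times> bool \<Rightarrow> nat. inj f) (Rep_real_index x)"

lemma inj_index_code: "inj index_code"
proof -
  have "\<exists>f :: 'a \<times> bool \<Rightarrow> nat. inj f"
    using finite_imp_inj_to_nat_seg[of "UNIV :: ('a \<times> bool) set"] by auto
  then have "inj (SOME f :: 'a \<times> bool \<Rightarrow> nat. inj f)" by (rule someI_ex)
  moreover have "inj Rep_real_index" by (rule injI) (simp add: Rep_real_index_inject)
  ultimately have "inj ((SOME f :: 'a \<times> bool \<Rightarrow> nat. inj f) \<circ> Rep_real_index)" by (rule inj_compose)
  then show ?thesis by (simp only: index_code_def[abs_def] comp_def)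
qed

instantiation real_index :: (finite) "{finite, wellorder}"
begin

definition "x \<le> y \<longleftrightarrow> index_code x \<le> index_code y"
definition "x < y \<longleftrightarrow> index_code x < index_code y"

instance
proof
  have eq: "(UNIV :: 'a real_index set) = Abs_real_index ` UNIV"
    by (simp add: type_definition.Abs_image[OF type_definition_real_index])
  show "finite (UNIV :: 'a real_index set)" by (subst eq) (rule finite_imageI, rule finite)
  fix x y z :: "'a real_index" and P
  show "(x < y) = (x \<le> y \<and> \<not> y \<le> x)" "x \<le> x" "x \<le> y \<Longrightarrow> y \<le> z \<Longrightarrow> x \<le> z" "x \<le> y \<or> y \<le> x"
    by (auto simp: less_eq_real_index_def less_real_index_def)
  show "x \<le> y \<Longrightarrow> y \<le> x \<Longrightarrow> x = y"
    using inj_index_code by (auto simp: less_eq_real_index_def inj_def)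
  show "(\<And>x. (\<And>y. y < x \<Longrightarrow> P y) \<Longrightarrow> P x) \<Longrightarrow> P x"
    by (rule measure_induct[of index_code P]) (auto simp: less_real_index_def)
qed

end

lemma bij_Abs_real_index: "bij (Abs_real_index :: 'a \<times> bool \<Rightarrow> _)"
  by (rule bij_betw_byWitness[where f' = Rep_real_index]) (auto simp: Abs_real_index_inverse Rep_real_index_inverse)

lemma sum_real_index:
  fixes f :: "'a::finite real_index \<Rightarrow> 'b::comm_monoid_add"
  shows "sum f UNIV = (\<Sum>i\<in>UNIV. f (Abs_real_index (i, False)) + f (Abs_real_index (i, True)))"
proof -
  have "sum f UNIV = (\<Sum>p\<in>UNIV. f (Abs_real_index p))"
    using sum.reindex_bij_betw[OF bij_Abs_real_index, of f] by simp
  also have "\<dots> = (\<Sum>i\<in>UNIV. \<Sum>b\<in>UNIV. f (Abs_real_index (i, b)))"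
    by (simp add: sum.cartesian_product split_def)
  finally show ?thesis by (simp add: UNIV_bool add.commute)
qed

definition realify :: "complex^'n \<Rightarrow> real^('n::finite real_index)" where
  "realify x = (\<chi> k. case Rep_real_index k of (i, b) \<Rightarrow> if b then Im (x $ i) else Re (x $ i))"

definition unrealify :: "real^('n::finite real_index) \<Rightarrow> complex^'n" where
  "unrealify y = (\<chi> i. Complex (y $ Abs_real_index (i, False)) (y $ Abs_real_index (i, True)))"

lemma realify_inverse [simp]: "unrealify (realify x) = x"
  by (simp add: realify_def unrealify_def Abs_real_index_inverse vec_eq_iff)

lemma unrealify_inverse [simp]: "realify (unrealify y) = y"
proof -
  have "realify (unrealify y) $ k = y $ k" for k
  proof -
    obtain i b where k: "k = Abs_real_index (i, b)"
      by (metis Rep_real_index_inverse prod.exhaust_sel)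
    show ?thesis by (cases b) (simp_all add: k realify_def unrealify_def Abs_real_index_inverse)
  qed
  then show ?thesis by (simp add: vec_eq_iff)
qed

lemma linear_realify: "linear realify" and linear_unrealify: "linear unrealify"
  by (auto intro!: linearI simp: realify_def unrealify_def vec_eq_iff complex_eq_iff split: prod.splits)

lemma inner_realify [simp]: "realify x \<bullet> realify y = x \<bullet> y"
  by (simp add: inner_vec_def sum_real_index realify_def Abs_real_index_inverse inner_complex_def)

lemma norm_realify [simp]: "norm (realify x) = norm x"
  by (simp add: norm_eq_sqrt_inner)

lemma norm_unrealify [simp]: "norm (unrealify x) = norm x"
  by (metis norm_realify unrealify_inverse)

text \<open>The factor by which \<open>L\<close> scales volume in the underlying real space. Passing
  to the absolute value turns it into a multiplicative function that is 1 on all isometries, and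
  most of the computations below rest on these two properties.\<close>

definition abs_rdet :: "(complex^'n \<Rightarrow> complex^'n) \<Rightarrow> real" where
  "abs_rdet L = \<bar>det (matrix (realify \<circ> L \<circ> unrealify))\<bar>"

lemma linear_conj_realify: "linear L \<Longrightarrow> linear (realify \<circ> L \<circ> unrealify)"
  by (intro linear_compose linear_realify linear_unrealify)

lemma abs_rdet_compose:
  assumes "linear L" "linear L'"
  shows "abs_rdet (L \<circ> L') = abs_rdet L * abs_rdet L'"
proof -
  have "realify \<circ> (L \<circ> L') \<circ> unrealify = (realify \<circ> L \<circ> unrealify) \<circ> (realify \<circ> L' \<circ> unrealify)"
    by (simp add: fun_eq_iff)
  then show ?thesis
    unfolding abs_rdet_def using assms
    by (simp add: matrix_compose[OF linear_conj_realify linear_conj_realify] det_mul abs_mult)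
qed

lemma abs_rdet_isometry:
  assumes "linear L" "\<And>x. norm (L x) = norm x"
  shows "abs_rdet L = 1"
proof -
  have "orthogonal_transformation (realify \<circ> L \<circ> unrealify)"
    using assms by (auto simp: orthogonal_transformation linear_conj_realify)
  then have "orthogonal_matrix (matrix (realify \<circ> L \<circ> unrealify))"
    by (simp add: orthogonal_transformation_matrix)
  then show ?thesis using det_orthogonal_matrix unfolding abs_rdet_def by fastforce
qed

lemma abs_rdet_id: "abs_rdet (\<lambda>x. x) = 1"
  by (rule abs_rdet_isometry) (auto intro: linear_ident)

lemma CARD_real_index: "CARD('n::finite real_index) = 2 * CARD('n)"
proof -
  have "CARD('n \<times> bool) = CARD('n real_index)"
    using bij_betw_same_card[OF bij_Abs_real_index] by blast
  then show ?thesis by simp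
qed

lemma abs_rdet_scaleR: "abs_rdet (\<lambda>x :: complex^'n. r *\<^sub>R x) = \<bar>r\<bar> ^ (2 * CARD('n))"
proof -
  have "realify \<circ> (\<lambda>x :: complex^'n. r *\<^sub>R x) \<circ> unrealify = (*\<^sub>R) r"
    by (simp add: fun_eq_iff linear_cmul[OF linear_realify])
  then show ?thesis by (simp add: abs_rdet_def det_matrix_scaleR CARD_real_index power_abs)
qed

lemma abs_rdet_eq_0:
  assumes "linear L" "\<not> inj L"
  shows "abs_rdet L = 0"
proof -
  have "\<not> inj (realify \<circ> L \<circ> unrealify)"
  proof
    assume i: "inj (realify \<circ> L \<circ> unrealify)"
    have "L = unrealify \<circ> (realify \<circ> L \<circ> unrealify) \<circ> realify" by (simp add: fun_eq_iff)
    moreover have "inj (unrealify \<circ> (realify \<circ> L \<circ> unrealify) \<circ> realify)"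
      by (rule inj_compose[OF inj_compose[OF _ i]])
        (rule injI, metis realify_inverse unrealify_inverse)+
    ultimately show False using assms by simp
  qed
  then show ?thesis using det_nz_iff_inj[OF linear_conj_realify[OF assms(1)]] by (simp add: abs_rdet_def)
qed

section \<open>Scalings, shears and row modifications\<close>

definition scale_on :: "'n set \<Rightarrow> complex \<Rightarrow> complex^'n \<Rightarrow> complex^'n" where
  "scale_on K c x = (\<chi> i. if i \<in> K then c * x $ i else x $ i)"

definition shear :: "'n \<Rightarrow> complex^'n \<Rightarrow> complex^'n \<Rightarrow> complex^'n" where
  "shear k w x = (\<chi> i. if i = k then x $ k + (\<Sum>l\<in>UNIV - {k}. w $ l * x $ l) else x $ i)"

lemma linear_scale_on: "linear (scale_on K c)"
  by (auto intro!: linearI simp: scale_on_def vec_eq_iff algebra_simps)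

lemma linear_shear: "linear (shear k w)"
  by (auto intro!: linearI simp: shear_def vec_eq_iff algebra_simps sum.distrib scaleR_sum_right)

text \<open>No determinant is expanded. Coordinate transpositions are isometries, so scaling any
  single coordinate gives the same value. Scaling all coordinates is a homothety of real dimension
  \<open>2 * CARD('n)\<close>, and the claim follows by taking roots of nonnegative numbers.\<close>

lemma abs_rdet_scale_on_real:
  assumes r: "r > 0"
  shows "abs_rdet (scale_on {k} (complex_of_real r) :: complex^'n::finite \<Rightarrow> _) = r\<^sup>2"
proof -
  let ?s = "\<lambda>K. abs_rdet (scale_on K (complex_of_real r) :: complex^'n \<Rightarrow> _)"
  have same: "?s {l} = ?s {k}" for l
  proof -
    define P :: "complex^'n \<Rightarrow> complex^'n" where "P x = (\<chi> i. x $ Transposition.transpose k l i)" for x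
    have lin: "linear P" by (auto intro!: linearI simp: P_def vec_eq_iff)
    have "norm (P x) = norm x" for x
      using sum.reindex_bij_betw[of "Transposition.transpose k l" UNIV UNIV "\<lambda>i. (norm (x $ i))\<^sup>2"]
      by (simp add: norm_vec_def P_def L2_set_def)
    then have "abs_rdet P = 1" by (rule abs_rdet_isometry[OF lin])
    moreover have "P \<circ> (scale_on {k} (complex_of_real r) \<circ> P) = scale_on {l} (complex_of_real r)"
      by (auto simp: fun_eq_iff P_def scale_on_def vec_eq_iff Transposition.transpose_def)
    ultimately show ?thesis
      using abs_rdet_compose[OF lin linear_compose[OF lin linear_scale_on], of "{k}" "complex_of_real r"] abs_rdet_compose[OF linear_scale_on lin, of "{k}" "complex_of_real r"]
      by simp
  qed
  have card: "?s K = ?s {k} ^ card K" for K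
  proof (induction K rule: infinite_finite_induct)
    case empty
    have "scale_on {} (complex_of_real r) = (\<lambda>x :: complex^'n. x)" by (simp add: fun_eq_iff scale_on_def)
    then show ?case by (simp add: abs_rdet_id)
  next
    case (insert l K)
    have "scale_on (insert l K) (complex_of_real r) = scale_on {l} (complex_of_real r) \<circ> (scale_on K (complex_of_real r) :: complex^'n \<Rightarrow> _)"
      using insert(2) by (auto simp: fun_eq_iff scale_on_def vec_eq_iff)
    then show ?case
      using insert same[of l] abs_rdet_compose[OF linear_scale_on linear_scale_on, of "{l}" "complex_of_real r" K "complex_of_real r"]
      by (simp del: comp_apply add: o_def[symmetric])
  qed auto
  have "scale_on UNIV (complex_of_real r) = (\<lambda>x :: complex^'n. r *\<^sub>R x)"
    by (simp add: fun_eq_iff scale_on_def vec_eq_iff scaleR_conv_of_real[symmetric])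
  then have "?s {k} ^ CARD('n) = (r\<^sup>2) ^ CARD('n)"
    using card[of UNIV] r by (simp add: abs_rdet_scaleR power_mult)
  moreover have "?s {k} \<ge> 0" by (simp add: abs_rdet_def)
  ultimately show ?thesis by (metis power_eq_imp_eq_base zero_le_power2 zero_less_card_finite)
qed

text \<open>Polar decomposition of \<open>c\<close>: the unimodular factor acts as an
  isometry.\<close>

lemma abs_rdet_scale_on:
  assumes c: "c \<noteq> 0"
  shows "abs_rdet (scale_on {k} c :: complex^'n::finite \<Rightarrow> _) = (cmod c)\<^sup>2"
proof -
  define u where "u = c / complex_of_real (cmod c)"
  have u: "cmod u = 1" "c = complex_of_real (cmod c) * u" using c by (auto simp: u_def norm_divide)
  have eq: "scale_on {k} c = scale_on {k} (complex_of_real (cmod c)) \<circ> (scale_on {k} u :: complex^'n \<Rightarrow> _)"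
    by (subst u(2)) (auto simp: fun_eq_iff scale_on_def vec_eq_iff)
  have "norm (scale_on {k} u x) = norm x" for x :: "complex^'n"
    unfolding norm_vec_def by (rule L2_set_cong) (auto simp: scale_on_def norm_mult u(1))
  then have "abs_rdet (scale_on {k} u :: complex^'n \<Rightarrow> _) = 1" by (rule abs_rdet_isometry[OF linear_scale_on])
  then show ?thesis
    using c unfolding eq abs_rdet_compose[OF linear_scale_on linear_scale_on] by (simp add: abs_rdet_scale_on_real)
qed

text \<open>A shear is conjugate, by a scaling, to its square.\<close>

lemma abs_rdet_shear: "abs_rdet (shear k w :: complex^'n::finite \<Rightarrow> _) = 1"
proof -
  have comp: "shear k v \<circ> shear k w = shear k (v + w)" for v w :: "complex^'n"
    by (auto simp: fun_eq_iff shear_def vec_eq_iff algebra_simps sum.distrib)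
  have "shear k 0 = (\<lambda>x :: complex^'n. x)" by (auto simp: fun_eq_iff shear_def vec_eq_iff)
  then have "abs_rdet (shear k w) * abs_rdet (shear k (- w)) = 1"
    using abs_rdet_compose[OF linear_shear linear_shear, of k w k "- w"] by (simp add: comp abs_rdet_id)
  then have nz: "abs_rdet (shear k w) \<noteq> 0" by auto
  have "scale_on {k} 2 \<circ> (shear k w \<circ> scale_on {k} (1/2)) = shear k (w + w)"
    by (auto simp: fun_eq_iff shear_def scale_on_def vec_eq_iff algebra_simps sum.distrib sum_distrib_left)
  then have "abs_rdet (scale_on {k} 2 \<circ> (shear k w \<circ> scale_on {k} (1/2))) = abs_rdet (shear k w \<circ> shear k w)"
    by (simp add: comp)
  then have "abs_rdet (shear k w) = abs_rdet (shear k w) * abs_rdet (shear k w)"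
    by (simp add: abs_rdet_compose linear_shear linear_scale_on linear_compose abs_rdet_scale_on power2_eq_square)
  then show ?thesis using nz by simp
qed

text \<open>The identity matrix with row \<open>k\<close> replaced by \<open>\<rho>\<close>. These
  matrices serve as the elementary factors in \<open>abs_rdet_matrix\<close>.\<close>

definition row_mod :: "'n \<Rightarrow> complex^'n \<Rightarrow> complex^'n^'n::finite" where
  "row_mod k \<rho> = (\<chi> i. if i = k then \<rho> else axis i 1)"

lemma row_mod_mult_vec: "(row_mod k \<rho> *v x) $ i = (if i = k then \<Sum>l\<in>UNIV. \<rho> $ l * x $ l else x $ i)"
proof -
  have "(\<Sum>j\<in>UNIV. axis i (1::complex) $ j * x $ j) = (\<Sum>j\<in>UNIV. if j = i then x $ j else 0)"
    by (intro sum.cong) (auto simp: axis_def)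
  then show ?thesis by (simp add: row_mod_def matrix_vector_mult_def)
qed

lemma det_row_mod:
  fixes k :: "'n::finite"
  shows "det (row_mod k \<rho>) = \<rho> $ k"
proof -
  have "(\<Sum>i\<in>UNIV. \<rho> $ i *s row i (mat 1 :: complex^'n^'n)) = \<rho>"
    by (simp add: vec_eq_iff row_def mat_def if_distrib[of "\<lambda>x. _ * x"] cong: if_cong)
  moreover have "row i (mat 1 :: complex^'n^'n) = axis i 1" for i
    by (auto simp: row_def mat_def vec_eq_iff axis_def)
  ultimately show ?thesis
    using cramer_lemma_transpose[of k \<rho> "mat 1 :: complex^'n^'n"] by (simp add: row_mod_def cong: if_cong)
qed

lemma linear_matrix_vector: "linear (\<lambda>x. (A :: complex^'n::finite^'n) *v x)"
  by (auto intro!: linearI simp: matrix_vector_mult_def vec_eq_iff scaleR_sum_right distrib_left sum.distrib)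

lemma abs_rdet_singular:
  assumes "det (A :: complex^'n::finite^'n) = 0"
  shows "abs_rdet ((*v) A) = 0"
proof (rule abs_rdet_eq_0[OF linear_matrix_vector])
  have "\<not> (\<exists>B. B ** A = mat 1)"
    using assms by (metis invertible_det_nz invertible_left_inverse)
  then obtain x where "x \<noteq> 0" "A *v x = 0" using matrix_left_invertible_ker[of A] by blast
  then show "\<not> inj ((*v) A)" by (metis injD matrix_vector_mult_0_right)
qed

text \<open>If the pivot is nonzero, a row modification is a shear followed by scaling coordinate
  \<open>k\<close> by the pivot; otherwise the matrix is singular.\<close>

lemma abs_rdet_row_mod: "abs_rdet ((*v) (row_mod k \<rho>)) = (cmod (\<rho> $ k))\<^sup>2"
proof (cases "\<rho> $ k = 0")
  case True then show ?thesis using abs_rdet_singular[of "row_mod k \<rho>"] by (simp add: det_row_mod)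
next
  case False
  have "(\<Sum>l\<in>UNIV. \<rho> $ l * x $ l) = \<rho> $ k * (x $ k + (\<Sum>l\<in>UNIV - {k}. ((1 / \<rho> $ k) *s \<rho>) $ l * x $ l))" for x
    using False by (subst sum.remove[of _ k]) (auto simp: algebra_simps sum_distrib_left intro!: sum.cong)
  then have "(*v) (row_mod k \<rho>) = scale_on {k} (\<rho> $ k) \<circ> shear k ((1 / \<rho> $ k) *s \<rho>)"
    by (simp add: fun_eq_iff vec_eq_iff row_mod_mult_vec scale_on_def shear_def)
  then show ?thesis using False
    by (simp add: abs_rdet_compose linear_scale_on linear_shear abs_rdet_shear abs_rdet_scale_on)
qed

text \<open>Induction on a set containing all rows that are not unit vectors, splitting off one row
  modification at a time. When all rows are unit vectors, a nonzero determinant makes them distinct;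
  the matrix is then a permutation matrix, hence an isometry.\<close>

theorem abs_rdet_matrix: "abs_rdet ((*v) A) = (cmod (det (A :: complex^'n::finite^'n)))\<^sup>2"
proof (cases "det A = 0")
  case True then show ?thesis by (simp add: abs_rdet_singular)
next
  case False
  have "abs_rdet ((*v) A) = (cmod (det A))\<^sup>2"
    if "det A \<noteq> 0" "\<forall>i. i \<notin> K \<longrightarrow> (\<exists>l. row i A = axis l 1)" for A :: "complex^'n^'n" and K
    using finite_class.finite[of K] that
  proof (induction K arbitrary: A rule: finite_induct)
    case empty
    then have "\<forall>i. \<exists>l. row i A = axis l 1" by blast
    then obtain f where f: "\<And>i. row i A = axis (f i) 1" by metis
    then have A: "A $ i $ j = (if j = f i then 1 else 0)" for i j by (auto simp: row_def vec_eq_iff axis_def)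
    have "inj f"
    proof (rule injI, rule ccontr)
      fix i j assume "f i = f j" "i \<noteq> j"
      then have "row i A = row j A" using f by simp
      then show False using det_identical_rows[OF \<open>i \<noteq> j\<close>] empty by blast
    qed
    then have bij: "bij f" by (simp add: finite_UNIV_inj_surj bij_def)
    then have perm: "f permutes UNIV" by (intro bij_imp_permutes) auto
    have "A = (\<chi> i. mat 1 $ f i)" by (auto simp: vec_eq_iff A mat_def)
    then have "det A = of_int (sign f)" using det_permute_rows[OF perm, of "mat 1 :: complex^'n^'n"] by simp
    then have 1: "cmod (det A) = 1" by (simp add: sign_def)
    have "(A *v x) $ i = x $ f i" for x i
      by (simp add: matrix_vector_mult_def A if_distrib[of "\<lambda>x. x * _"] cong: if_cong)
    then have "norm (A *v x) = norm x" for x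
      using sum.reindex_bij_betw[OF bij, of "\<lambda>i. (norm (x $ i))\<^sup>2"] by (simp add: norm_vec_def L2_set_def)
    then show ?case using 1 by (simp add: abs_rdet_isometry[OF linear_matrix_vector])
  next
    case (insert k K)
    define B where "B l = (\<chi> i. if i = k then axis l 1 else A $ i)" for l
    \<comment> \<open>Row \<open>k\<close> is expanded into unit vectors. By linearity some
      \<open>B l\<close>, which has one arbitrary row fewer, is invertible.\<close>
    have "det A = det (\<chi> i. if i = k then (\<Sum>l\<in>UNIV. A $ k $ l *s axis l 1) else A $ i)"
      by (rule arg_cong[of _ _ det]) (auto simp: vec_eq_iff axis_def if_distrib[of "\<lambda>x. _ * x"] cong: if_cong)
    also have "\<dots> = (\<Sum>l\<in>UNIV. A $ k $ l * det (B l))"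
      by (simp add: det_linear_row_sum det_row_mul B_def)
    finally obtain l where l: "det (B l) \<noteq> 0" using insert.prems(1) by (metis (no_types, lifting) mult_zero_right sum.neutral)
    have "\<exists>l'. row i (B l) = axis l' 1" if "i \<notin> K" for i
      using insert.prems(2) that by (cases "i = k") (auto simp: B_def row_def vec_eq_iff)
    then have IH: "abs_rdet ((*v) (B l)) = (cmod (det (B l)))\<^sup>2" using insert.IH[OF l] by blast
    obtain C where C: "C ** B l = mat 1" using l by (metis invertible_det_nz invertible_left_inverse)
    \<comment> \<open>The coefficients that express row \<open>k\<close> of \<open>A\<close> by the
      rows of \<open>B l\<close>; the other rows of the two matrices agree already.\<close>
    define \<rho> where "\<rho> = A $ k v* C"
    have \<rho>: "\<rho> v* B l = A $ k" by (simp add: \<rho>_def vector_matrix_mul_assoc C)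
    have "A = row_mod k \<rho> ** B l"
    proof -
      have "(row_mod k \<rho> ** B l) $ i $ j = A $ i $ j" for i j
      proof (cases "i = k")
        case True
        have "(\<Sum>h\<in>UNIV. \<rho> $ h * B l $ h $ j) = A $ k $ j"
          using arg_cong[OF \<rho>, of "\<lambda>v. v $ j"] by (simp add: vector_matrix_mult_def mult.commute)
        then show ?thesis using True by (simp add: matrix_matrix_mult_def row_mod_def)
      next
        case False
        then show ?thesis
          by (simp add: matrix_matrix_mult_def row_mod_def axis_def B_def if_distrib[of "\<lambda>x. x * _"] cong: if_cong)
      qed
      then show ?thesis by (simp add: vec_eq_iff)
    qed
    then have A: "(*v) A = (*v) (row_mod k \<rho>) \<circ> (*v) (B l)" "det A = \<rho> $ k * det (B l)"
      by (auto simp: fun_eq_iff matrix_vector_mul_assoc det_mul det_row_mod)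
    show ?case
      unfolding A abs_rdet_compose[OF linear_matrix_vector linear_matrix_vector]
      by (simp add: abs_rdet_row_mod IH norm_mult power_mult_distrib)
  qed
  from this[of A UNIV] False show ?thesis by auto
qed

section \<open>Change of variables in complex n-space\<close>

lemma unrealify_axis: "unrealify (axis (Abs_real_index (i, b)) 1) = axis i (if b then \<i> else 1)"
  by (auto simp: unrealify_def vec_eq_iff axis_def Abs_real_index_inject complex_eq_iff)

lemma Basis_unrealify: "bij_betw unrealify (Basis :: (real^'n::finite real_index) set) (Basis :: (complex^'n) set)"
proof (rule bij_betw_byWitness[where f' = realify])
  have sur: "\<exists>i b. k = Abs_real_index (i, b)" for k :: "'n real_index"
    by (metis Rep_real_index_inverse surj_pair)
  show "unrealify ` (Basis :: (real^'n real_index) set) \<subseteq> Basis"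
  proof
    fix y assume "y \<in> unrealify ` (Basis :: (real^'n real_index) set)"
    then obtain k where "y = unrealify (axis k 1)" by (auto simp: Basis_vec_def)
    moreover obtain i b where "k = Abs_real_index (i, b)" using sur by blast
    ultimately show "y \<in> Basis" by (auto simp: unrealify_axis Basis_vec_def Basis_complex_def)
  qed
  have "axis i 1 = unrealify (axis (Abs_real_index (i, False)) 1)" "axis i \<i> = unrealify (axis (Abs_real_index (i, True)) 1)" for i :: 'n
    by (simp_all add: unrealify_axis)
  then show "realify ` (Basis :: (complex^'n) set) \<subseteq> Basis"
    by (auto simp: Basis_vec_def Basis_complex_def)
qed auto

lemma inner_unrealify [simp]: "unrealify x \<bullet> unrealify y = x \<bullet> y"
  by (metis inner_realify unrealify_inverse)

lemma continuous_realify: "continuous_on S realify" and continuous_unrealify: "continuous_on S' unrealify"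
  using linear_realify linear_unrealify by (auto intro: linear_continuous_on simp: linear_linear)

text \<open>Standard bases correspond under \<open>unrealify\<close>, so boxes pull back to boxes
  with the same side lengths, and these determine Lebesgue measure.\<close>

lemma lborel_distr_realify: "distr lborel borel realify = (lborel :: (real^'n::finite real_index) measure)"
proof (rule lborel_eqI[symmetric])
  have [measurable]: "realify \<in> borel_measurable borel"
    by (intro borel_measurable_continuous_onI continuous_realify)
  fix l u :: "real^'n real_index" assume lu: "\<And>b. b \<in> Basis \<Longrightarrow> l \<bullet> b \<le> u \<bullet> b"
  have BU: "(Basis :: (complex^'n) set) = unrealify ` Basis"
    by (rule bij_betw_imp_surj_on[OF Basis_unrealify, symmetric])
  have "realify -` box l u = box (unrealify l) (unrealify u)"
    unfolding box_def BU by (auto simp: ) (metis inner_unrealify realify_inverse inner_realify unrealify_inverse)+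
  then have "emeasure (distr lborel borel realify) (box l u) = emeasure lborel (box (unrealify l) (unrealify u))"
    by (simp add: emeasure_distr)
  also have "\<dots> = ennreal (\<Prod>b\<in>Basis. (unrealify u - unrealify l) \<bullet> b)"
    using lu by (subst emeasure_lborel_box_eq) (auto simp: BU)
  also have "(\<Prod>b\<in>Basis. (unrealify u - unrealify l) \<bullet> b) = (\<Prod>b\<in>Basis. (u - l) \<bullet> b)"
    using prod.reindex_bij_betw[OF Basis_unrealify, of "\<lambda>b. (unrealify u - unrealify l) \<bullet> b"]
    by (simp add: inner_diff_left)
  finally show "emeasure (distr lborel borel realify) (box l u) = ennreal (\<Prod>b\<in>Basis. (u - l) \<bullet> b)" .
qed simp

lemma nn_integral_realify:
  assumes [measurable]: "f \<in> borel_measurable (borel :: (real^'n::finite real_index) measure)"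
  shows "(\<integral>\<^sup>+y. f y \<partial>lborel) = (\<integral>\<^sup>+x. f (realify x) \<partial>lborel)"
proof -
  have [measurable]: "realify \<in> borel_measurable borel"
    by (intro borel_measurable_continuous_onI continuous_realify)
  show ?thesis by (subst lborel_distr_realify[symmetric]) (simp add: nn_integral_distr)
qed

text \<open>Transported from real coordinates, where the available equivalence joins finite measure
  of the image to integrability of the Jacobian. The infinite case is its contrapositive.\<close>

theorem emeasure_complex_image:
  fixes g :: "complex^'n::finite \<Rightarrow> complex^'n"
  assumes S: "S \<in> sets borel" and inj: "inj_on g S" and im: "g ` S \<in> sets borel"
    and der: "\<And>x. x \<in> S \<Longrightarrow> (g has_derivative (\<lambda>h. A x *v h)) (at x)"
    and A: "(\<lambda>x. indicator S x * cmod (det (A x))) \<in> borel_measurable borel"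
  shows "emeasure lborel (g ` S) = (\<integral>\<^sup>+x. ennreal (indicator S x * (cmod (det (A x)))\<^sup>2) \<partial>lborel)"
proof -
  define R where "R = realify ` S"
  define f where "f = realify \<circ> g \<circ> unrealify"
  define f' where "f' y = realify \<circ> (\<lambda>h. A (unrealify y) *v h) \<circ> unrealify" for y
  have [measurable]: "realify \<in> borel_measurable borel" "unrealify \<in> borel_measurable borel"
    by (intro borel_measurable_continuous_onI continuous_realify continuous_unrealify)+
  have Rv: "realify ` X = unrealify -` X" for X :: "(complex^'n) set"
  proof
    show "unrealify -` X \<subseteq> realify ` X"
    proof
      fix y assume "y \<in> unrealify -` X"
      then show "y \<in> realify ` X" by (intro image_eqI[of _ _ "unrealify y"]) auto
    qed
  qed auto
  have RB: "realify ` X \<in> sets borel" if "X \<in> sets borel" for X :: "(complex^'n) set"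
    unfolding Rv using measurable_sets[of unrealify borel borel X] that by simp
  have em: "emeasure lborel (realify ` X) = emeasure lborel X" if "X \<in> sets borel" for X :: "(complex^'n) set"
  proof -
    have "emeasure (distr lborel borel realify) (realify ` X) = emeasure lborel (realify -` realify ` X)"
      using RB[OF that] by (simp add: emeasure_distr)
    also have "realify -` realify ` X = X" by (auto, metis realify_inverse)
    finally show ?thesis by (simp add: lborel_distr_realify)
  qed
  have fR: "f ` R = realify ` g ` S" by (force simp: f_def R_def image_image)
  have RL: "R \<in> sets lebesgue" unfolding R_def using RB[OF S] by simp
  have derf: "(f has_derivative f' y) (at y within R)" if "y \<in> R" for y
  proof -
    have "unrealify y \<in> S" using that by (auto simp: R_def)
    from der[OF this] have "(realify \<circ> (g \<circ> unrealify) has_derivative realify \<circ> ((\<lambda>h. A (unrealify y) *v h) \<circ> unrealify)) (at y)"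
      by (intro diff_chain_at linear_imp_has_derivative linear_realify linear_unrealify)
    then show ?thesis by (simp add: f_def f'_def o_assoc has_derivative_at_withinI)
  qed
  have injf: "inj_on f R"
    using inj unfolding f_def R_def inj_on_def by (auto) (metis realify_inverse)
  have detf: "\<bar>det (matrix (f' y))\<bar> = (cmod (det (A (unrealify y))))\<^sup>2" for y
    using abs_rdet_matrix[of "A (unrealify y)"] by (simp add: abs_rdet_def f'_def)
  define d where "d y = indicator R y * (cmod (det (A (unrealify y))))\<^sup>2" for y
  have d0: "d y \<ge> 0" for y by (simp add: d_def)
  have dS: "d y = (indicator S (unrealify y) * cmod (det (A (unrealify y))))\<^sup>2" for y
    using Rv[of S] by (auto simp: d_def R_def indicator_def)
  have dm[measurable]: "d \<in> borel_measurable borel"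
    unfolding dS using A by measurable
  have hi: "(d has_integral m) UNIV \<longleftrightarrow> f ` R \<in> lmeasurable \<and> measure lebesgue (f ` R) = m" for m
  proof -
    have "(d has_integral m) UNIV \<longleftrightarrow> ((\<lambda>y. if y \<in> R then \<bar>det (matrix (f' y))\<bar> else 0) has_integral m) UNIV"
      by (rule has_integral_cong) (simp add: d_def detf)
    also have "\<dots> \<longleftrightarrow> ((\<lambda>y. \<bar>det (matrix (f' y))\<bar>) has_integral m) R"
      by (rule has_integral_restrict_UNIV)
    finally show ?thesis using has_measure_differentiable_image[OF RL derf injf] by blast
  qed
  have gR: "realify ` g ` S \<in> sets borel" using RB[OF im] .
  have "emeasure lborel (realify ` g ` S) = (\<integral>\<^sup>+y. ennreal (d y) \<partial>lborel)"
  proof (cases "(\<integral>\<^sup>+y. ennreal (d y) \<partial>lborel) < \<infinity>")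
    case True
    then obtain m where m: "(\<integral>\<^sup>+y. ennreal (d y) \<partial>lborel) = ennreal m" "m \<ge> 0"
      by (cases "\<integral>\<^sup>+y. ennreal (d y) \<partial>lborel" rule: ennreal_cases) auto
    then have "(d has_integral m) UNIV" by (intro nn_integral_has_integral dm d0) auto
    then have l: "f ` R \<in> lmeasurable" "measure lebesgue (f ` R) = m" using hi by auto
    then have "emeasure lebesgue (f ` R) = ennreal m" by (simp add: emeasure_eq_measure2)
    then show ?thesis using m gR by (simp add: fR)
  next
    case False
    then have inf: "(\<integral>\<^sup>+y. ennreal (d y) \<partial>lborel) = \<infinity>"
      using less_top by (metis infinity_ennreal_def)
    have "emeasure lborel (realify ` g ` S) = \<infinity>"
    proof (rule ccontr)
      assume "emeasure lborel (realify ` g ` S) \<noteq> \<infinity>"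
      then have "emeasure lebesgue (f ` R) < \<infinity>" using gR by (simp add: fR top.not_eq_extremum)
      then have "f ` R \<in> lmeasurable" using gR by (simp add: fmeasurable_def fR)
      then have "(d has_integral (measure lebesgue (f ` R))) UNIV" using hi by blast
      then have "(\<integral>\<^sup>+y. ennreal (d y) \<partial>lborel) = ennreal (measure lebesgue (f ` R))"
        by (intro nn_integral_has_integral_lborel dm d0)
      then show False using inf by simp
    qed
    then show ?thesis using inf by simp
  qed
  also have "\<dots> = (\<integral>\<^sup>+x. ennreal (d (realify x)) \<partial>lborel)" by (rule nn_integral_realify) measurable
  also have "\<dots> = (\<integral>\<^sup>+x. ennreal (indicator S x * (cmod (det (A x)))\<^sup>2) \<partial>lborel)"
    by (intro nn_integral_cong arg_cong[of _ _ ennreal]) (auto simp: d_def R_def indicator_def dest: arg_cong[of _ _ unrealify])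
  finally show ?thesis using em[OF im] by simp
qed

text \<open>Here \<open>c\<close> is the number of preimages of a generic point.\<close>

theorem integral_pushforward:
  fixes g :: "'a::euclidean_space \<Rightarrow> 'b::euclidean_space" and \<phi> :: "'b \<Rightarrow> complex" and w :: "'a \<Rightarrow> real"
  assumes S: "S \<in> sets borel" and T: "T \<in> sets borel" and gST: "g ` S \<subseteq> T"
    and g: "continuous_on S g" and w: "continuous_on S w" "\<And>x. x \<in> S \<Longrightarrow> w x \<ge> 0" and \<phi>: "continuous_on T \<phi>" and c: "c > 0"
    and meas: "\<And>B. B \<in> sets borel \<Longrightarrow> ennreal c * emeasure lborel (T \<inter> B) =
      (\<integral>\<^sup>+x. ennreal (indicator (S \<inter> g -` B) x * w x) \<partial>lborel)"
  shows "set_integrable lborel S (\<lambda>x. w x * \<phi> (g x)) \<longleftrightarrow> set_integrable lborel T \<phi>"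
    and "set_lebesgue_integral lborel S (\<lambda>x. w x * \<phi> (g x)) = c * set_lebesgue_integral lborel T \<phi>"
proof -
  \<comment> \<open>Extension by zero turns functions that are continuous on \<open>S\<close> or
    \<open>T\<close> only into Borel functions on the whole space.\<close>
  define g0 where "g0 x = (if x \<in> S then g x else 0)" for x
  define w0 where "w0 x = (if x \<in> S then w x else 0)" for x
  define p0 where "p0 y = (if y \<in> T then \<phi> y else 0)" for y
  have ms: "g0 \<in> borel_measurable borel" "w0 \<in> borel_measurable borel" "p0 \<in> borel_measurable borel"
    unfolding g0_def[abs_def] w0_def[abs_def] p0_def[abs_def]
    using S T g w \<phi> by (auto intro!: borel_measurable_continuous_on_if)
  note [measurable] = ms S T
  \<comment> \<open>\<open>meas\<close> says that \<open>c\<close> times Lebesgue measure on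
    \<open>T\<close> is the image under \<open>g\<close> of Lebesgue measure on \<open>S\<close>
    with density \<open>w\<close>. Equality of these two measures then gives both claims about
    integrals.\<close>
  define M1 where "M1 = density lborel (\<lambda>y. ennreal (c * indicator T y))"
  define M2 where "M2 = distr (density lborel (\<lambda>x. ennreal (w0 x))) borel g0"
  have M12: "M1 = M2"
  proof (rule measure_eqI)
    show "sets M1 = sets M2" by (simp add: M1_def M2_def)
    fix B assume "B \<in> sets M1"
    then have B[measurable]: "B \<in> sets borel" by (simp add: M1_def)
    have "emeasure M1 B = (\<integral>\<^sup>+y. ennreal c * indicator (T \<inter> B) y \<partial>lborel)"
      using c unfolding M1_def
      by (subst emeasure_density) (auto intro!: nn_integral_cong simp: indicator_def)
    also have "\<dots> = ennreal c * emeasure lborel (T \<inter> B)"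
      by (subst nn_integral_cmult_indicator) auto
    also have "\<dots> = (\<integral>\<^sup>+x. ennreal (w0 x) * indicator (g0 -` B) x \<partial>lborel)"
      unfolding meas[OF B] by (intro nn_integral_cong) (auto simp: indicator_def w0_def g0_def)
    also have "\<dots> = emeasure M2 B"
      unfolding M2_def using measurable_sets[OF ms(1) B] by (subst emeasure_distr) (auto simp: emeasure_density)
    finally show "emeasure M1 B = emeasure M2 B" .
  qed
  have i1: "integrable M1 p0 \<longleftrightarrow> set_integrable lborel T \<phi>"
  proof -
    have "integrable M1 p0 \<longleftrightarrow> integrable lborel (\<lambda>y. (c * indicator T y) *\<^sub>R p0 y)"
      unfolding M1_def using c by (intro integrable_density) auto
    also have "(\<lambda>y. (c * indicator T y) *\<^sub>R p0 y) = (\<lambda>y. c *\<^sub>R (indicator T y *\<^sub>R \<phi> y))"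
      by (auto simp: p0_def fun_eq_iff indicator_def)
    also have "integrable lborel (\<lambda>y. c *\<^sub>R (indicator T y *\<^sub>R \<phi> y)) \<longleftrightarrow> integrable lborel (\<lambda>y. indicator T y *\<^sub>R \<phi> y)" (is "integrable _ (\<lambda>y. c *\<^sub>R ?h y) \<longleftrightarrow> _")
    proof
      assume "integrable lborel (\<lambda>y. c *\<^sub>R ?h y)"
      then have "integrable lborel (\<lambda>y. inverse c *\<^sub>R (c *\<^sub>R ?h y))" by (rule integrable_scaleR_right)
      moreover have "inverse c *\<^sub>R (c *\<^sub>R x) = x" for x :: complex using c by simp
      ultimately show "integrable lborel ?h" by (simp only:)
    qed (rule integrable_scaleR_right)
    finally show ?thesis by (simp add: set_integrable_def)
  qed
  have I1: "integral\<^sup>L M1 p0 = c * set_lebesgue_integral lborel T \<phi>"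
  proof -
    have "integral\<^sup>L M1 p0 = integral\<^sup>L lborel (\<lambda>y. (c * indicator T y) *\<^sub>R p0 y)"
      unfolding M1_def using c by (intro integral_density) auto
    also have "(\<lambda>y. (c * indicator T y) *\<^sub>R p0 y) = (\<lambda>y. c *\<^sub>R (indicator T y *\<^sub>R \<phi> y))"
      by (auto simp: p0_def fun_eq_iff indicator_def)
    finally show ?thesis by (simp add: set_lebesgue_integral_def scaleR_conv_of_real)
  qed
  have eqw: "(\<lambda>x. w0 x *\<^sub>R p0 (g0 x)) = (\<lambda>x. indicator S x *\<^sub>R (complex_of_real (w x) * \<phi> (g x)))"
    using gST by (auto simp: w0_def p0_def g0_def fun_eq_iff indicator_def scaleR_conv_of_real)
  have w0: "w0 x \<ge> 0" for x using w by (auto simp: w0_def)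
  have "integrable M2 p0 \<longleftrightarrow> integrable (density lborel (\<lambda>x. ennreal (w0 x))) (\<lambda>x. p0 (g0 x))"
    unfolding M2_def by (intro integrable_distr_eq) auto
  also have "\<dots> \<longleftrightarrow> integrable lborel (\<lambda>x. w0 x *\<^sub>R p0 (g0 x))"
    using w0 by (intro integrable_density) auto
  finally have i2: "integrable M2 p0 \<longleftrightarrow> set_integrable lborel S (\<lambda>x. w x * \<phi> (g x))"
    by (simp add: eqw set_integrable_def)
  have "integral\<^sup>L M2 p0 = integral\<^sup>L (density lborel (\<lambda>x. ennreal (w0 x))) (\<lambda>x. p0 (g0 x))"
    unfolding M2_def by (intro integral_distr) auto
  also have "\<dots> = integral\<^sup>L lborel (\<lambda>x. w0 x *\<^sub>R p0 (g0 x))"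
    using w0 by (intro integral_density) auto
  finally have I2: "integral\<^sup>L M2 p0 = set_lebesgue_integral lborel S (\<lambda>x. w x * \<phi> (g x))"
    by (simp add: eqw set_lebesgue_integral_def)
  show "set_integrable lborel S (\<lambda>x. w x * \<phi> (g x)) \<longleftrightarrow> set_integrable lborel T \<phi>"
    and "set_lebesgue_integral lborel S (\<lambda>x. w x * \<phi> (g x)) = c * set_lebesgue_integral lborel T \<phi>"
    using M12 i1 i2 I1 I2 by auto
qed

section \<open>The Bergman kernel of the polydisc\<close>

definition polydisc :: "(complex^'n) set" where
  "polydisc = {x. \<forall>j. cmod (x $ j) < 1}"

lemma open_polydisc: "open (polydisc :: (complex^'n::finite) set)"
proof -
  have "polydisc = (\<Inter>j\<in>UNIV. {x :: complex^'n. cmod (x $ j) < 1})" by (auto simp: polydisc_def)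
  also have "open \<dots>"
    by (intro open_INT) (auto intro!: open_Collect_less continuous_intros)
  finally show ?thesis .
qed

lemma bounded_polydisc: "bounded (polydisc :: (complex^'n::finite) set)"
proof (rule boundedI)
  fix x :: "complex^'n" assume "x \<in> polydisc"
  then have "cmod (x $ i) \<le> 1" for i by (auto simp: polydisc_def less_imp_le)
  then have "(\<Sum>i\<in>UNIV. cmod (x $ i)) \<le> (\<Sum>i\<in>(UNIV::'n set). 1)" by (intro sum_mono)
  then show "norm x \<le> real CARD('n)"
    using L2_set_le_sum[of UNIV "\<lambda>i. cmod (x $ i)"] by (simp add: norm_vec_def)
qed

lemma polydisc_measurable [measurable]: "(polydisc :: (complex^'n::finite) set) \<in> sets borel"
  using open_polydisc by (rule borel_open)

lemma emeasure_polydisc_finite: "emeasure lborel (polydisc :: (complex^'n::finite) set) < \<infinity>"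
  by (rule emeasure_bounded_finite[OF bounded_polydisc])

lemma measure_polydisc_pos: "measure lborel (polydisc :: (complex^'n::finite) set) > 0"
proof -
  have "0 \<in> (polydisc :: (complex^'n) set)" by (auto simp: polydisc_def)
  then obtain e where e: "e > 0" "ball 0 e \<subseteq> (polydisc :: (complex^'n) set)"
    using open_polydisc by (meson open_contains_ball)
  have "0 < measure lborel (ball (0 :: complex^'n) e)" using content_ball_pos[OF e(1)] by simp
  also have "\<dots> \<le> measure lborel (polydisc :: (complex^'n) set)"
    using e(2) emeasure_polydisc_finite by (intro measure_mono_fmeasurable) (auto simp: fmeasurable_def)
  finally show ?thesis .
qed

section \<open>The mean value property on the polydisc\<close>

definition vec_upd :: "'n \<Rightarrow> complex \<Rightarrow> complex^'n \<Rightarrow> complex^'n" where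
  "vec_upd j t x = (\<chi> i. if i = j then t else x $ i)"

lemma vec_upd_nth [simp]: "vec_upd j t x $ i = (if i = j then t else x $ i)"
  by (simp add: vec_upd_def)

text \<open>Continuity together with holomorphy in each variable is all that the mean value property
  uses.\<close>

definition slice_holomorphic :: "(complex^'n::finite \<Rightarrow> complex) \<Rightarrow> bool" where
  "slice_holomorphic F \<longleftrightarrow> continuous_on polydisc F \<and>
     (\<forall>x\<in>polydisc. \<forall>j. (\<lambda>t. F (vec_upd j t x)) holomorphic_on ball 0 1)"

lemma vec_upd_in_polydisc: "x \<in> polydisc \<Longrightarrow> cmod t < 1 \<Longrightarrow> vec_upd j t x \<in> polydisc"
  by (auto simp: polydisc_def)

lemma has_derivative_vec_lambda:
  fixes f :: "'n::finite \<Rightarrow> 'a::real_normed_vector \<Rightarrow> 'b::real_normed_vector"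
  assumes "\<And>i. (f i has_derivative f' i) (at x within S)"
  shows "((\<lambda>x. \<chi> i. f i x) has_derivative (\<lambda>h. \<chi> i. f' i h)) (at x within S)"
proof -
  have eq: "(\<chi> i. h i) = (\<Sum>i\<in>UNIV. axis i (h i))" for h :: "'n \<Rightarrow> 'b"
    by (simp add: vec_eq_iff axis_def if_distrib cong: if_cong)
  have "linear (axis i :: 'b \<Rightarrow> 'b^'n)" for i by (auto intro!: linearI simp: vec_eq_iff axis_def)
  moreover have "norm (axis i y :: 'b^'n) \<le> norm y * 1" for i and y :: 'b
  proof -
    have "(\<Sum>j\<in>UNIV. norm ((axis i y :: 'b^'n) $ j)) = norm y"
      by (simp add: axis_def if_distrib[of norm] cong: if_cong)
    then show ?thesis
      using L2_set_le_sum[of UNIV "\<lambda>j. norm ((axis i y :: 'b^'n) $ j)"] by (simp add: norm_vec_def)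
  qed
  ultimately have bl: "bounded_linear (axis i :: 'b \<Rightarrow> 'b^'n)" for i
    by (intro bounded_linear_intro[where K = 1]) (auto simp: linear_add linear_scale)
  show ?thesis unfolding eq by (intro has_derivative_sum bounded_linear.has_derivative[OF bl] assms)
qed

lemma has_derivative_vec_upd:
  fixes j :: "'n::finite"
  shows "((\<lambda>t. vec_upd j t x) has_derivative (\<lambda>h. axis j h)) (at t)"
proof -
  have *: "((\<lambda>t. vec_upd j t x) has_derivative (\<lambda>h. \<chi> i. if i = j then h else 0)) (at t)"
    unfolding vec_upd_def
  proof (rule has_derivative_vec_lambda)
    fix i show "((\<lambda>t. if i = j then t else x $ i) has_derivative (\<lambda>h. if i = j then h else 0)) (at t)"
      by (cases "i = j") (auto intro!: derivative_eq_intros)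
  qed
  show ?thesis using * by (simp add: axis_def eq_commute cong: if_cong)
qed

lemma holomorphic_fun_continuous: "holomorphic_fun_on F S \<Longrightarrow> continuous_on S F"
  unfolding holomorphic_fun_on_def continuous_on_eq_continuous_within
  by (metis has_derivative_continuous has_derivative_at_withinI)

lemma holomorphic_fun_slice:
  fixes F :: "complex^'n::finite \<Rightarrow> complex"
  assumes "holomorphic_fun_on F polydisc"
  shows "slice_holomorphic F"
  unfolding slice_holomorphic_def
proof (intro conjI ballI allI)
  show "continuous_on polydisc F" using assms by (rule holomorphic_fun_continuous)
  fix x :: "complex^'n" and j assume x: "x \<in> polydisc"
  show "(\<lambda>t. F (vec_upd j t x)) holomorphic_on ball 0 1"
    unfolding holomorphic_on_open[OF open_ball]
  proof
    fix t :: complex assume "t \<in> ball 0 1"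
    then have "vec_upd j t x \<in> polydisc" using x by (intro vec_upd_in_polydisc) auto
    then obtain a where a: "(F has_derivative (\<lambda>v. \<Sum>i\<in>UNIV. a $ i * v $ i)) (at (vec_upd j t x))"
      using assms by (auto simp: holomorphic_fun_on_def)
    have "((\<lambda>t. F (vec_upd j t x)) has_derivative (\<lambda>h. \<Sum>i\<in>UNIV. a $ i * axis j h $ i)) (at t)"
      using has_derivative_compose[OF has_derivative_vec_upd a] by simp
    also have "(\<lambda>h. \<Sum>i\<in>UNIV. a $ i * axis j h $ i) = (\<lambda>h. a $ j * h)"
      by (simp add: axis_def if_distrib[of "\<lambda>y. _ * y"] fun_eq_iff cong: if_cong)
    finally show "\<exists>f'. ((\<lambda>t. F (vec_upd j t x)) has_field_derivative f') (at t)"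
      by (auto simp: has_field_derivative_def)
  qed
qed

text \<open>Cauchy's formula on the unit circle for \<open>h (a * z)\<close>, which is holomorphic
  beyond the closed unit disc because \<open>cmod a < 1\<close>.\<close>

lemma circle_mean_value:
  assumes h: "h holomorphic_on ball 0 1" and a: "cmod a < 1"
  shows "((\<lambda>t. h (a * exp (2 * of_real pi * \<i> * of_real t))) has_integral h 0) {0..1}"
proof -
  define k where "k z = h (a * z)" for z
  \<comment> \<open>For \<open>a = 0\<close> the rescaled function is constant and any radius above
    1 serves, whereas the quotient would evaluate to 0.\<close>
  define R where "R = (if a = 0 then 2 else 1 / cmod a)"
  have R: "R > 1" using a by (auto simp: R_def divide_simps)
  have k: "k holomorphic_on ball 0 R"
    unfolding k_def
  proof (rule holomorphic_on_compose_gen[of _ _ h "ball 0 1", unfolded o_def])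
    show "(\<lambda>z. a * z) ` ball 0 R \<subseteq> ball 0 1"
      by (auto simp: R_def norm_mult field_simps split: if_splits)
  qed (use h in \<open>auto intro!: holomorphic_intros\<close>)
  have "((\<lambda>w. k w / (w - 0)) has_contour_integral 2 * of_real pi * \<i> * k 0) (circlepath 0 1)"
  proof (rule Cauchy_integral_circlepath)
    show "continuous_on (cball 0 1) k" "k holomorphic_on ball 0 1"
      using R by (auto intro!: holomorphic_on_imp_continuous_on holomorphic_on_subset[OF k])
  qed auto
  then have "((\<lambda>t. k (circlepath 0 1 t) / circlepath 0 1 t * (2 * of_real pi * \<i> * exp (2 * of_real pi * \<i> * of_real t)))
     has_integral 2 * of_real pi * \<i> * k 0) {0..1}"
    unfolding has_contour_integral by (simp add: vector_derivative_circlepath has_contour_integral vector_derivative_circlepath01 cong: has_integral_cong)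
  then have "((\<lambda>t. 2 * of_real pi * \<i> * k (exp (2 * of_real pi * \<i> * of_real t)))
     has_integral 2 * of_real pi * \<i> * k 0) {0..1}"
    by (simp add: circlepath mult_ac)
  from has_integral_mult_right[OF this, of "1 / (2 * of_real pi * \<i>)"]
  show ?thesis by (simp add: k_def)
qed

lemma borel_preimage_on:
  fixes g :: "'a::topological_space \<Rightarrow> 'b::{topological_space, zero}"
  assumes "S \<in> sets borel" "continuous_on S g" "B \<in> sets borel"
  shows "S \<inter> g -` B \<in> sets borel"
proof -
  have m: "(\<lambda>x. if x \<in> S then g x else 0) \<in> borel_measurable borel"
    using assms by (intro borel_measurable_continuous_on_if) auto
  have "S \<inter> g -` B = S \<inter> ((\<lambda>x. if x \<in> S then g x else 0) -` B \<inter> space borel)" by auto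
  then show ?thesis using assms(1) measurable_sets[OF m assms(3)] by auto
qed

lemma emeasure_image_preimage:
  fixes g :: "complex^'n::finite \<Rightarrow> complex^'n"
  assumes S: "S \<in> sets borel" and T: "T \<in> sets borel" and bij: "bij_betw g S T"
    and der: "\<And>x. x \<in> S \<Longrightarrow> (g has_derivative (\<lambda>h. A x *v h)) (at x)"
    and A: "continuous_on S (\<lambda>x. det (A x))" and B: "B \<in> sets borel"
  shows "emeasure lborel (T \<inter> B) = (\<integral>\<^sup>+x. ennreal (indicator (S \<inter> g -` B) x * (cmod (det (A x)))\<^sup>2) \<partial>lborel)"
proof -
  have g: "continuous_on S g"
    using der by (meson continuous_at_imp_continuous_on has_derivative_continuous)
  have SB: "S \<inter> g -` B \<in> sets borel" by (rule borel_preimage_on[OF S g B])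
  have im: "g ` (S \<inter> g -` B) = T \<inter> B" using bij by (auto simp: bij_betw_def)
  have "(\<lambda>x. if x \<in> S \<inter> g -` B then cmod (det (A x)) else 0) \<in> borel_measurable borel"
    using SB by (intro borel_measurable_continuous_on_if) (auto intro!: continuous_intros continuous_on_subset[OF A])
  also have "(\<lambda>x. if x \<in> S \<inter> g -` B then cmod (det (A x)) else 0) = (\<lambda>x. indicator (S \<inter> g -` B) x * cmod (det (A x)))"
    by (auto simp: indicator_def fun_eq_iff)
  finally have m: "(\<lambda>x. indicator (S \<inter> g -` B) x * cmod (det (A x))) \<in> borel_measurable borel" .
  show ?thesis unfolding im[symmetric]
  proof (rule emeasure_complex_image[OF SB])
    show "inj_on g (S \<inter> g -` B)" using bij by (auto simp: bij_betw_def inj_on_def)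
    show "g ` (S \<inter> g -` B) \<in> sets borel" unfolding im using T B by auto
  qed (use der m in auto)
qed

definition diag_map :: "('n \<Rightarrow> complex \<Rightarrow> complex) \<Rightarrow> complex^'n \<Rightarrow> complex^'n" where
  "diag_map \<phi> x = (\<chi> j. \<phi> j (x $ j))"

text \<open>Covers the two kinds of coordinatewise automorphism of the polydisc that are needed:
  rotation of one coordinate, and products of Moebius maps. The Jacobian matrix is diagonal.\<close>

lemma integral_diag_map:
  fixes \<phi> \<phi>' :: "'n::finite \<Rightarrow> complex \<Rightarrow> complex" and E :: "complex^'n \<Rightarrow> complex"
  assumes bij: "bij_betw (diag_map \<phi>) polydisc polydisc"
    and der: "\<And>j t. cmod t < 1 \<Longrightarrow> (\<phi> j has_field_derivative \<phi>' j t) (at t)"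
    and cont: "\<And>j. continuous_on (ball 0 1) (\<phi>' j)" and E: "continuous_on polydisc E"
  shows "set_integrable lborel polydisc (\<lambda>x. (\<Prod>j\<in>UNIV. (cmod (\<phi>' j (x $ j)))\<^sup>2) * E (diag_map \<phi> x)) \<longleftrightarrow> set_integrable lborel polydisc E"
    and "set_lebesgue_integral lborel polydisc (\<lambda>x. (\<Prod>j\<in>UNIV. (cmod (\<phi>' j (x $ j)))\<^sup>2) * E (diag_map \<phi> x)) =
      set_lebesgue_integral lborel polydisc E"
proof -
  let ?D = "polydisc :: (complex^'n) set"
  define A where "A x = (\<chi> i j. if i = j then \<phi>' i (x $ i) else 0)" for x :: "complex^'n"
  have detA: "det (A x) = (\<Prod>j\<in>UNIV. \<phi>' j (x $ j))" for x
    by (subst det_diagonal) (auto simp: A_def)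
  have D: "cmod (x $ j) < 1" if "x \<in> ?D" for x j using that by (simp add: polydisc_def)
  have derg: "(diag_map \<phi> has_derivative (\<lambda>h. A x *v h)) (at x)" if "x \<in> ?D" for x
  proof -
    have "(diag_map \<phi> has_derivative (\<lambda>h. \<chi> j. \<phi>' j (x $ j) * h $ j)) (at x)"
      unfolding diag_map_def
    proof (rule has_derivative_vec_lambda)
      fix j
      show "((\<lambda>x. \<phi> j (x $ j)) has_derivative (\<lambda>h. \<phi>' j (x $ j) * h $ j)) (at x)"
        using has_derivative_compose[of "\<lambda>x. x $ j" "\<lambda>h. h $ j" x UNIV "\<phi> j" "\<lambda>h. \<phi>' j (x $ j) * h"]
          der[OF D[OF that], of j] bounded_linear_imp_has_derivative[OF bounded_linear_vec_nth]
        by (auto simp: has_field_derivative_def)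
    qed
    also have "(\<lambda>h. \<chi> j. \<phi>' j (x $ j) * h $ j) = (\<lambda>h. A x *v h)"
      by (simp add: A_def matrix_vector_mult_def fun_eq_iff vec_eq_iff if_distrib[of "\<lambda>y. y * _"] cong: if_cong)
    finally show ?thesis .
  qed
  have cg: "continuous_on ?D (diag_map \<phi>)"
    using derg by (meson continuous_at_imp_continuous_on has_derivative_continuous)
  have cd: "continuous_on ?D (\<lambda>x. det (A x))"
    unfolding detA
    by (intro continuous_on_prod continuous_on_compose2[OF cont]) (auto intro!: continuous_intros dest: D)
  have w: "(cmod (det (A x)))\<^sup>2 = (\<Prod>j\<in>UNIV. (cmod (\<phi>' j (x $ j)))\<^sup>2)" for x
    by (simp add: detA prod_norm[symmetric] prod_power_distrib)
  have meas: "ennreal 1 * emeasure lborel (?D \<inter> B) =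
      (\<integral>\<^sup>+x. ennreal (indicator (?D \<inter> diag_map \<phi> -` B) x * (cmod (det (A x)))\<^sup>2) \<partial>lborel)" if "B \<in> sets borel" for B
    using emeasure_image_preimage[OF polydisc_measurable polydisc_measurable bij derg cd that] by simp
  note * = integral_pushforward[OF polydisc_measurable polydisc_measurable _ cg _ _ E zero_less_one meas]
  have im: "diag_map \<phi> ` ?D \<subseteq> ?D" using bij by (auto simp: bij_betw_def)
  have cw: "continuous_on ?D (\<lambda>x. (cmod (det (A x)))\<^sup>2)" by (intro continuous_intros cd)
  show "set_integrable lborel polydisc (\<lambda>x. (\<Prod>j\<in>UNIV. (cmod (\<phi>' j (x $ j)))\<^sup>2) * E (diag_map \<phi> x)) \<longleftrightarrow> set_integrable lborel polydisc E"
    using *(1)[OF im cw] by (simp add: w prod_nonneg)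
  show "set_lebesgue_integral lborel polydisc (\<lambda>x. (\<Prod>j\<in>UNIV. (cmod (\<phi>' j (x $ j)))\<^sup>2) * E (diag_map \<phi> x)) =
      set_lebesgue_integral lborel polydisc E"
    using *(2)[OF im cw] by (simp add: w prod_nonneg)
qed

definition rotate_coord :: "'n \<Rightarrow> complex \<Rightarrow> complex^'n \<Rightarrow> complex^'n" where
  "rotate_coord j u = diag_map (\<lambda>i t. if i = j then u * t else t)"

lemma rotate_coord_eq: "rotate_coord j u x = vec_upd j (u * x $ j) x"
  by (simp add: rotate_coord_def diag_map_def vec_eq_iff)

lemma integral_rotate:
  fixes F :: "complex^'n::finite \<Rightarrow> complex"
  assumes u: "cmod u = 1" and F: "continuous_on polydisc F"
  shows "set_integrable lborel polydisc (\<lambda>x. F (rotate_coord j u x)) \<longleftrightarrow> set_integrable lborel polydisc F"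
    and "set_lebesgue_integral lborel polydisc (\<lambda>x. F (rotate_coord j u x)) = set_lebesgue_integral lborel polydisc F"
proof -
  have u0: "u \<noteq> 0" using u by auto
  have "bij_betw (rotate_coord j u) polydisc polydisc"
    by (rule bij_betw_byWitness[where f' = "rotate_coord j (inverse u)"])
      (use u u0 in \<open>auto simp: rotate_coord_eq vec_eq_iff polydisc_def norm_mult norm_inverse\<close>)
  moreover have "((\<lambda>t. if i = j then u * t else t) has_field_derivative (if i = j then u else 1)) (at t)" for i t
    by (auto intro!: derivative_eq_intros)
  moreover have "(\<Prod>i\<in>UNIV. (cmod (if i = j then u else 1))\<^sup>2) = 1"
    using u by (intro prod.neutral) auto
  ultimately show "set_integrable lborel polydisc (\<lambda>x. F (rotate_coord j u x)) \<longleftrightarrow> set_integrable lborel polydisc F"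
    "set_lebesgue_integral lborel polydisc (\<lambda>x. F (rotate_coord j u x)) = set_lebesgue_integral lborel polydisc F"
    using integral_diag_map[of "\<lambda>i t. if i = j then u * t else t" "\<lambda>i t. if i = j then u else 1" F] F
    by (simp_all add: rotate_coord_def[symmetric])
qed

lemma set_lebesgue_integral_continuous_01:
  fixes f :: "real \<Rightarrow> complex"
  assumes "continuous_on {0..1} f"
  shows "(\<integral>t. indicator {0..1} t *\<^sub>R f t \<partial>lborel) = integral {0..1} f"
  using borel_integrable_atLeastAtMost'[OF assms] set_borel_integral_eq_integral(2)
  by (simp add: set_lebesgue_integral_def set_integrable_def)

text \<open>Averaging over rotations of coordinate \<open>j\<close> leaves the integral unchanged,
  and by \<open>circle_mean_value\<close> the average at \<open>x\<close> is the value with that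
  coordinate set to zero. Fubini's theorem exchanges the two integrations.\<close>

lemma integral_zero_coordinate:
  fixes F :: "complex^'n::finite \<Rightarrow> complex"
  assumes F: "slice_holomorphic F" and int: "set_integrable lborel polydisc F"
  shows "set_integrable lborel polydisc (\<lambda>x. F (vec_upd j 0 x))"
    and "set_lebesgue_integral lborel polydisc (\<lambda>x. F (vec_upd j 0 x)) = set_lebesgue_integral lborel polydisc F"
proof -
  let ?D = "polydisc :: (complex^'n) set"
  define u where "u t = exp (2 * complex_of_real pi * \<i> * complex_of_real t)" for t
  have u1: "cmod (u t) = 1" for t by (simp add: u_def norm_exp_eq_Re)
  have cont: "continuous_on ?D F" using F by (simp add: slice_holomorphic_def)
  define H where "H t x = indicator {0..1} t *\<^sub>R (indicator ?D x *\<^sub>R F (rotate_coord j (u t) x))" for t :: real and x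
  have Dr: "rotate_coord j (u t) x \<in> ?D" if "x \<in> ?D" for t x
    using that u1 by (auto simp: rotate_coord_eq polydisc_def norm_mult)
  have Hm: "case_prod H \<in> borel_measurable (lborel \<Otimes>\<^sub>M lborel)"
  proof -
    have "(\<lambda>p. if p \<in> {0..1} \<times> ?D then F (rotate_coord j (u (fst p)) (snd p)) else 0) \<in> borel_measurable borel"
    proof (rule borel_measurable_continuous_on_if)
      show "{0..1::real} \<times> ?D \<in> sets borel"
        using borel_Times[of "{0..1::real}" ?D] by auto
      show "continuous_on ({0..1} \<times> ?D) (\<lambda>p. F (rotate_coord j (u (fst p)) (snd p)))"
      proof (rule continuous_on_compose2[OF cont])
        show "continuous_on ({0..1} \<times> ?D) (\<lambda>p. rotate_coord j (u (fst p)) (snd p))"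
          unfolding rotate_coord_eq vec_upd_def u_def
        proof (intro continuous_on_vec_lambda)
          fix i
          show "continuous_on ({0..1} \<times> ?D) (\<lambda>x. if i = j then exp (2 * complex_of_real pi * \<i> * complex_of_real (fst x)) * snd x $ j else snd x $ i)"
            by (cases "i = j") (auto intro!: continuous_intros)
        qed
      qed (use Dr in auto)
    qed auto
    also have "(\<lambda>p. if p \<in> {0..1} \<times> ?D then F (rotate_coord j (u (fst p)) (snd p)) else 0) = case_prod H"
      by (auto simp: H_def fun_eq_iff indicator_def)
    finally show ?thesis by (simp add: lborel_prod)
  qed
  have rint: "integrable lborel (\<lambda>x. indicator ?D x *\<^sub>R F (rotate_coord j (u t) x))" for t
    using integral_rotate(1)[OF u1 cont] int by (simp add: set_integrable_def)
  have intH: "integrable (lborel \<Otimes>\<^sub>M lborel) (case_prod H)"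
  proof (rule lborel_pair.Fubini_integrable[OF Hm])
    \<comment> \<open>Rotations also preserve the integral of \<open>cmod (F x)\<close>, so the
      inner integral of the norm is the same for all \<open>t\<close> in the unit interval; this is
      the joint integrability that Fubini requires.\<close>
    define c where "c = (\<integral>x. norm (indicator ?D x *\<^sub>R F x) \<partial>lborel)"
    have "(\<integral>x. norm (indicator ?D x *\<^sub>R F (rotate_coord j (u t) x)) \<partial>lborel) = c" for t
    proof -
      have "continuous_on ?D (\<lambda>x. complex_of_real (cmod (F x)))" by (intro continuous_intros cont)
      from integral_rotate(2)[OF u1[of t] this, of j]
      have "complex_of_real (\<integral>x. indicator ?D x *\<^sub>R cmod (F (rotate_coord j (u t) x)) \<partial>lborel) = complex_of_real (\<integral>x. indicator ?D x *\<^sub>R cmod (F x) \<partial>lborel)"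
        unfolding set_lebesgue_integral_def
        by (simp only: integral_complex_of_real[symmetric] of_real_mult scaleR_conv_of_real) simp
      then show ?thesis by (simp add: c_def)
    qed
    then have "(\<lambda>t. \<integral>x. norm (case_prod H (t, x)) \<partial>lborel) = (\<lambda>t. indicator {0..1} t * c)"
      by (auto simp: H_def fun_eq_iff indicator_def)
    then show "integrable lborel (\<lambda>t. \<integral>x. norm (case_prod H (t, x)) \<partial>lborel)" by simp
    show "AE t in lborel. integrable lborel (\<lambda>x. case_prod H (t, x))"
      unfolding H_def prod.case by (intro always_eventually allI integrable_scaleR_right rint)
  qed
  have inner: "(\<integral>t. H t x \<partial>lborel) = indicator ?D x *\<^sub>R F (vec_upd j 0 x)" for x
  proof (cases "x \<in> ?D")
    case True
    then have x: "cmod (x $ j) < 1" by (auto simp: polydisc_def)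
    have h: "(\<lambda>t. F (vec_upd j t x)) holomorphic_on ball 0 1" using F True by (auto simp: slice_holomorphic_def)
    have "((\<lambda>t. F (vec_upd j (x $ j * u t) x)) has_integral F (vec_upd j 0 x)) {0..1}"
      using circle_mean_value[OF h x] by (simp add: u_def)
    moreover have "continuous_on {0..1} (\<lambda>t. F (vec_upd j (x $ j * u t) x))"
    proof (rule continuous_on_compose2[OF holomorphic_on_imp_continuous_on[OF h]])
      show "continuous_on {0..1} (\<lambda>t. x $ j * u t)" unfolding u_def by (intro continuous_intros)
    qed (use x u1 in \<open>auto simp: norm_mult\<close>)
    ultimately have "(\<integral>t. indicator {0..1} t *\<^sub>R F (vec_upd j (x $ j * u t) x) \<partial>lborel) = F (vec_upd j 0 x)"
      using set_lebesgue_integral_continuous_01 by (simp add: integral_unique)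
    then show ?thesis using True by (simp add: H_def rotate_coord_eq mult.commute)
  qed (simp add: H_def)
  have "integrable lborel (\<lambda>x. \<integral>t. H t x \<partial>lborel)"
    by (rule lborel_pair.integrable_snd[OF intH])
  then show "set_integrable lborel polydisc (\<lambda>x. F (vec_upd j 0 x))"
    by (simp add: inner set_integrable_def)
  have "(\<integral>x. (\<integral>t. H t x \<partial>lborel) \<partial>lborel) = (\<integral>t. (\<integral>x. H t x \<partial>lborel) \<partial>lborel)"
    by (rule lborel_pair.Fubini_integral[OF intH])
  also have "\<dots> = set_lebesgue_integral lborel ?D F"
    using integral_rotate(2)[OF u1 cont] by (simp add: H_def set_lebesgue_integral_def del: scaleR_scaleR)
  finally show "set_lebesgue_integral lborel polydisc (\<lambda>x. F (vec_upd j 0 x)) = set_lebesgue_integral lborel polydisc F"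
    by (simp add: inner set_lebesgue_integral_def)
qed

text \<open>Coordinates are set to zero one after another. The induction goes through because
  freezing coordinates at zero preserves \<open>slice_holomorphic\<close>.\<close>

theorem polydisc_mean_value:
  fixes F :: "complex^'n::finite \<Rightarrow> complex"
  assumes F: "slice_holomorphic F" and int: "set_integrable lborel polydisc F"
  shows "set_lebesgue_integral lborel polydisc F = measure lborel (polydisc :: (complex^'n) set) * F 0"
proof -
  let ?D = "polydisc :: (complex^'n) set"
  define z where "z J x = (\<chi> i. if i \<in> J then 0 else x $ i)" for J and x :: "complex^'n"
  have "set_integrable lborel ?D (\<lambda>x. F (z J x)) \<and> set_lebesgue_integral lborel ?D (\<lambda>x. F (z J x)) = set_lebesgue_integral lborel ?D F" for J
    using finite[of J]
  proof (induction J rule: finite_induct)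
    case empty
    then show ?case using int by (simp add: z_def)
  next
    case (insert j J)
    have "slice_holomorphic (\<lambda>x. F (z J x))"
      unfolding slice_holomorphic_def
    proof (intro conjI ballI allI)
      have c: "continuous_on ?D (z J)"
        unfolding z_def
      proof (intro continuous_on_vec_lambda)
        fix i show "continuous_on ?D (\<lambda>x. if i \<in> J then 0 else x $ i)"
          by (cases "i \<in> J") (auto intro!: continuous_intros)
      qed
      show "continuous_on ?D (\<lambda>x. F (z J x))"
        by (rule continuous_on_compose2[OF _ c, of ?D]) (use F in \<open>auto simp: slice_holomorphic_def z_def polydisc_def\<close>)
      fix x :: "complex^'n" and i assume x: "x \<in> ?D"
      then have zx: "z J x \<in> ?D" by (auto simp: z_def polydisc_def)
      show "(\<lambda>t. F (z J (vec_upd i t x))) holomorphic_on ball 0 1"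
      proof (cases "i \<in> J")
        case True
        then have "(\<lambda>t. F (z J (vec_upd i t x))) = (\<lambda>t. F (z J x))"
          by (intro ext arg_cong[of _ _ F]) (auto simp: z_def vec_eq_iff)
        then show ?thesis by simp
      next
        case False
        then have "(\<lambda>t. F (z J (vec_upd i t x))) = (\<lambda>t. F (vec_upd i t (z J x)))"
          by (intro ext arg_cong[of _ _ F]) (auto simp: z_def vec_eq_iff)
        then show ?thesis using F zx by (simp add: slice_holomorphic_def)
      qed
    qed
    note * = integral_zero_coordinate[OF this, of j]
    have "(\<lambda>x. F (z J (vec_upd j 0 x))) = (\<lambda>x. F (z (insert j J) x))"
      by (intro ext arg_cong[of _ _ F]) (auto simp: z_def vec_eq_iff)
    then show ?case using * insert.IH by simp
  qed
  from this[of UNIV] have "set_lebesgue_integral lborel ?D F = set_lebesgue_integral lborel ?D (\<lambda>x. F 0)"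
    by (simp add: z_def zero_vec_def)
  also have "\<dots> = measure lborel ?D * F 0"
    using emeasure_polydisc_finite[where 'n = 'n] by (simp add: set_lebesgue_integral_def scaleR_conv_of_real)
  finally show ?thesis .
qed

section \<open>Moebius maps and the reproducing formula on the polydisc\<close>

definition disc_moebius :: "complex \<Rightarrow> complex \<Rightarrow> complex" where
  "disc_moebius a t = (t + a) / (1 + cnj a * t)"

lemma one_plus_cnj_mult_nonzero:
  assumes "cmod a < 1" "cmod t < 1"
  shows "1 + cnj a * t \<noteq> 0"
proof
  assume "1 + cnj a * t = 0"
  then have "cmod (cnj a * t) = 1" by (metis add_eq_0_iff norm_minus_cancel norm_one)
  moreover have "cmod (cnj a * t) < 1"
    using assms mult_strict_mono'[of "cmod a" 1 "cmod t" 1] by (simp add: norm_mult)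
  ultimately show False by simp
qed

lemma moebius_in_disc:
  assumes "cmod a < 1" "cmod t < 1"
  shows "cmod (disc_moebius a t) < 1"
proof -
  have "disc_moebius a t = Moebius_function 0 (- a) t" by (simp add: disc_moebius_def Moebius_function_def)
  then show ?thesis using Moebius_function_norm_lt_1[of "- a" t 0] assms by simp
qed

lemma one_minus_cnj_self_nonzero: "cmod a < 1 \<Longrightarrow> 1 - a * cnj a \<noteq> 0"
proof -
  assume a: "cmod a < 1"
  then have "1 + cnj (- a) * a \<noteq> 0" by (intro one_plus_cnj_mult_nonzero) auto
  then show ?thesis by (simp add: mult.commute)
qed

lemma moebius_one_minus:
  assumes "cmod a < 1" "cmod t < 1"
  shows "1 - disc_moebius a t * cnj a = (1 - a * cnj a) / (1 + cnj a * t)"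
  using one_plus_cnj_mult_nonzero[OF assms] by (simp add: disc_moebius_def field_simps)

lemma moebius_inverse:
  assumes "cmod a < 1" "cmod t < 1"
  shows "disc_moebius (- a) (disc_moebius a t) = t"
proof -
  have "1 + cnj (- a) * disc_moebius a t = (1 - a * cnj a) / (1 + cnj a * t)"
    using moebius_one_minus[OF assms] by (simp add: mult.commute)
  moreover have "disc_moebius a t + - a = t * (1 - a * cnj a) / (1 + cnj a * t)"
    using one_plus_cnj_mult_nonzero[OF assms] by (simp add: disc_moebius_def field_simps)
  ultimately show ?thesis
    using one_plus_cnj_mult_nonzero[OF assms] one_minus_cnj_self_nonzero[OF assms(1)]
    unfolding disc_moebius_def[of "- a"] by simp
qed

lemma moebius_deriv:
  assumes "cmod a < 1" "cmod t < 1"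
  shows "(disc_moebius a has_field_derivative (1 - a * cnj a) / (1 + cnj a * t)\<^sup>2) (at t)"
  unfolding disc_moebius_def
  using one_plus_cnj_mult_nonzero[OF assms]
  by (auto intro!: derivative_eq_intros simp: power2_eq_square field_simps)

text \<open>The Bergman kernel for Lebesgue measure normalized to total mass 1. The volume of the
  polydisc is carried along separately until \<open>sym_kernel\<close>.\<close>

definition polydisc_kernel :: "complex^'n \<Rightarrow> complex^'n::finite \<Rightarrow> complex" where
  "polydisc_kernel x \<mu> = (\<Prod>j\<in>UNIV. 1 / (1 - x $ j * cnj (\<mu> $ j))\<^sup>2)"

lemma one_minus_mult_cnj_nonzero: "cmod a < 1 \<Longrightarrow> cmod t < 1 \<Longrightarrow> 1 - t * cnj a \<noteq> 0"
  using one_plus_cnj_mult_nonzero[of "- a" t] by (simp add: mult.commute)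

lemma cmod_one_minus_ge:
  assumes "cmod x \<le> 1"
  shows "1 - cmod a \<le> cmod (1 - x * cnj a)"
proof -
  have "1 - cmod a \<le> 1 - cmod (x * cnj a)"
    using assms mult_right_mono[of "cmod x" 1 "cmod a"] by (simp add: norm_mult)
  also have "\<dots> \<le> cmod (1 - x * cnj a)" using norm_triangle_ineq2[of 1 "x * cnj a"] by simp
  finally show ?thesis .
qed

lemma set_integrable_mult_bounded:
  fixes F k :: "'a::euclidean_space \<Rightarrow> complex"
  assumes S: "S \<in> sets borel" and F: "set_integrable lborel S F"
    and k: "continuous_on S k" "\<And>x. x \<in> S \<Longrightarrow> cmod (k x) \<le> C"
  shows "set_integrable lborel S (\<lambda>x. F x * k x)"
proof -
  have k0: "(\<lambda>x. if x \<in> S then k x else 0) \<in> borel_measurable borel"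
    using S k by (intro borel_measurable_continuous_on_if) auto
  have F0: "integrable lborel (\<lambda>x. indicator S x *\<^sub>R F x)" using F by (simp add: set_integrable_def)
  have eq: "(\<lambda>x. indicator S x *\<^sub>R (F x * k x)) = (\<lambda>x. (indicator S x *\<^sub>R F x) * (if x \<in> S then k x else 0))"
    by (auto simp: indicator_def fun_eq_iff)
  show ?thesis unfolding set_integrable_def
  proof (rule Bochner_Integration.integrable_bound[of _ "\<lambda>x. C *\<^sub>R (indicator S x *\<^sub>R F x)"])
    show "integrable lborel (\<lambda>x. C *\<^sub>R (indicator S x *\<^sub>R F x))" by (intro integrable_scaleR_right F0)
    show "(\<lambda>x. indicator S x *\<^sub>R (F x * k x)) \<in> borel_measurable lborel"
      unfolding eq using borel_measurable_times[OF borel_measurable_integrable[OF F0], of "\<lambda>x. if x \<in> S then k x else 0"] k0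
      by simp
    have "norm (indicator S x *\<^sub>R (F x * k x)) \<le> norm (C *\<^sub>R (indicator S x *\<^sub>R F x))" for x
    proof (cases "x \<in> S")
      case True
      have "cmod (F x) * cmod (k x) \<le> cmod (F x) * C" using k(2)[OF True] by (intro mult_left_mono) auto
      also have "\<dots> \<le> \<bar>C\<bar> * cmod (F x)" by (metis abs_ge_self mult.commute mult_right_mono norm_ge_zero)
      finally show ?thesis using True by (simp add: norm_mult)
    qed simp
    then show "AE x in lborel. norm (indicator S x *\<^sub>R (F x * k x)) \<le> norm (C *\<^sub>R (indicator S x *\<^sub>R F x))" by simp
  qed
qed

lemma polydisc_kernel_bound:
  assumes \<mu>: "\<mu> \<in> polydisc" and x: "x \<in> polydisc"
  shows "cmod (cnj (polydisc_kernel x \<mu>)) \<le> (\<Prod>j\<in>UNIV. 1 / (1 - cmod (\<mu> $ j))\<^sup>2)"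
proof -
  have "cmod (polydisc_kernel x \<mu>) = (\<Prod>j\<in>UNIV. 1 / (cmod (1 - x $ j * cnj (\<mu> $ j)))\<^sup>2)"
    by (simp add: polydisc_kernel_def prod_norm[symmetric] norm_divide norm_power)
  also have "\<dots> \<le> (\<Prod>j\<in>UNIV. 1 / (1 - cmod (\<mu> $ j))\<^sup>2)"
  proof (rule prod_mono, intro conjI)
    fix j
    have "0 < 1 - cmod (\<mu> $ j)" using \<mu> by (simp add: polydisc_def)
    moreover have "1 - cmod (\<mu> $ j) \<le> cmod (1 - x $ j * cnj (\<mu> $ j))"
      using x by (intro cmod_one_minus_ge) (auto simp: polydisc_def less_imp_le)
    ultimately show "1 / (cmod (1 - x $ j * cnj (\<mu> $ j)))\<^sup>2 \<le> 1 / (1 - cmod (\<mu> $ j))\<^sup>2"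
      by (intro divide_left_mono power_mono mult_pos_pos zero_less_power) auto
  qed simp
  finally show ?thesis by simp
qed

lemma continuous_polydisc_kernel:
  "\<mu> \<in> polydisc \<Longrightarrow> continuous_on polydisc (\<lambda>x. polydisc_kernel x \<mu>)"
proof -
  assume \<mu>: "\<mu> \<in> polydisc"
  have "1 - x $ j * cnj (\<mu> $ j) \<noteq> 0" if "x \<in> polydisc" for x j
    using \<mu> that by (intro one_minus_mult_cnj_nonzero) (auto simp: polydisc_def)
  then show ?thesis unfolding polydisc_kernel_def by (intro continuous_intros) auto
qed

text \<open>The product \<open>g\<close> of Moebius maps sends 0 to \<open>\<mu>\<close>. After
  substituting it, the conjugate half of the Jacobian cancels the conjugated kernel, and a function
  \<open>W\<close> with \<open>W 0 = F \<mu>\<close> remains that is holomorphic in each variable.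
  The mean value property at 0 evaluates its integral.\<close>

theorem polydisc_reproducing:
  fixes F :: "complex^'n::finite \<Rightarrow> complex"
  assumes F: "slice_holomorphic F" and int: "set_integrable lborel polydisc F" and \<mu>: "\<mu> \<in> polydisc"
  shows "set_lebesgue_integral lborel polydisc (\<lambda>x. F x * cnj (polydisc_kernel x \<mu>)) =
    measure lborel (polydisc :: (complex^'n) set) * F \<mu>"
proof -
  let ?D = "polydisc :: (complex^'n) set"
  define g where "g = diag_map (\<lambda>j. disc_moebius (\<mu> $ j))"
  define d where "d j t = (1 - \<mu> $ j * cnj (\<mu> $ j)) / (1 + cnj (\<mu> $ j) * t)\<^sup>2" for j t
  define E where "E x = F x * cnj (polydisc_kernel x \<mu>)" for x
  define W where "W x = F (g x) * (\<Prod>j\<in>UNIV. 1 / (1 + cnj (\<mu> $ j) * x $ j)\<^sup>2)" for x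
  have m: "cmod (\<mu> $ j) < 1" for j using \<mu> by (simp add: polydisc_def)
  have D: "cmod (x $ j) < 1" if "x \<in> ?D" for x j using that by (simp add: polydisc_def)
  have gD: "g x \<in> ?D" if "x \<in> ?D" for x
    using moebius_in_disc[OF m D[OF that]] by (simp add: polydisc_def g_def diag_map_def)
  have inv: "disc_moebius (- (\<mu> $ j)) (disc_moebius (\<mu> $ j) t) = t" "disc_moebius (\<mu> $ j) (disc_moebius (- (\<mu> $ j)) t) = t"
    if "cmod t < 1" for j t
    using moebius_inverse[OF m that, of j] moebius_inverse[of "- (\<mu> $ j)" t] m that by simp_all
  have bij: "bij_betw g ?D ?D"
  proof (rule bij_betw_byWitness[where f' = "diag_map (\<lambda>j. disc_moebius (- (\<mu> $ j)))"])
    show "\<forall>x\<in>?D. diag_map (\<lambda>j. disc_moebius (- (\<mu> $ j))) (g x) = x"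
      by (auto simp: g_def diag_map_def vec_eq_iff inv D)
    show "\<forall>x\<in>?D. g (diag_map (\<lambda>j. disc_moebius (- (\<mu> $ j))) x) = x"
      by (auto simp: g_def diag_map_def vec_eq_iff inv D)
    show "diag_map (\<lambda>j. disc_moebius (- (\<mu> $ j))) ` ?D \<subseteq> ?D"
      by (auto simp: diag_map_def polydisc_def m intro!: moebius_in_disc)
  qed (use gD in auto)
  have der: "(disc_moebius (\<mu> $ j) has_field_derivative d j t) (at t)" if "cmod t < 1" for j t
    unfolding d_def by (rule moebius_deriv[OF m that])
  have nz: "1 + cnj (\<mu> $ j) * t \<noteq> 0" if "cmod t < 1" for j t by (rule one_plus_cnj_mult_nonzero[OF m that])
  have cd: "continuous_on (ball 0 1) (d j)" for j
    unfolding d_def using nz by (intro continuous_intros) auto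
  have F': "continuous_on ?D F" using F by (simp add: slice_holomorphic_def)
  have cE: "continuous_on ?D E"
    unfolding E_def by (intro continuous_intros F' continuous_polydisc_kernel \<mu>)
  have intE: "set_integrable lborel ?D E"
    unfolding E_def
    by (rule set_integrable_mult_bounded[OF polydisc_measurable int _ polydisc_kernel_bound[OF \<mu>]])
      (intro continuous_intros continuous_polydisc_kernel \<mu>)
  have wE: "complex_of_real (\<Prod>j\<in>UNIV. (cmod (d j (x $ j)))\<^sup>2) * E (g x) = W x" if x: "x \<in> ?D" for x
  proof -
    have "complex_of_real ((cmod (d j (x $ j)))\<^sup>2) * cnj (1 / (1 - g x $ j * cnj (\<mu> $ j))\<^sup>2) = 1 / (1 + cnj (\<mu> $ j) * x $ j)\<^sup>2" for j
    proof -
      let ?c = "1 + cnj (\<mu> $ j) * x $ j" and ?e = "1 - \<mu> $ j * cnj (\<mu> $ j)"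
      have e: "cnj ?e = ?e" "?e \<noteq> 0" using one_minus_cnj_self_nonzero[OF m] by (auto simp: mult.commute)
      have c: "?c \<noteq> 0" "cnj ?c \<noteq> 0" using nz[OF D[OF x]] by (metis complex_cnj_zero_iff)+
      have "complex_of_real ((cmod (d j (x $ j)))\<^sup>2) = d j (x $ j) * cnj (d j (x $ j))"
        by (rule complex_norm_square)
      also have "\<dots> = ?e / ?c\<^sup>2 * (?e / (cnj ?c)\<^sup>2)"
        unfolding d_def complex_cnj_divide complex_cnj_power e(1) ..
      finally have 1: "complex_of_real ((cmod (d j (x $ j)))\<^sup>2) = ?e / ?c\<^sup>2 * (?e / (cnj ?c)\<^sup>2)" .
      have "1 - g x $ j * cnj (\<mu> $ j) = ?e / ?c"
        using moebius_one_minus[OF m D[OF x]] by (simp add: g_def diag_map_def)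
      then have 2: "cnj (1 / (1 - g x $ j * cnj (\<mu> $ j))\<^sup>2) = 1 / (?e / cnj ?c)\<^sup>2"
        unfolding complex_cnj_divide complex_cnj_power complex_cnj_one by (simp only: complex_cnj_divide e(1))
      have gen: "e / c\<^sup>2 * (e / c'\<^sup>2) * (1 / (e / c')\<^sup>2) = 1 / c\<^sup>2" if "e \<noteq> 0" "c \<noteq> 0" "c' \<noteq> 0" for e c c' :: complex
        using that by (simp add: field_simps power2_eq_square)
      show ?thesis unfolding 1 2 by (rule gen[OF e(2) c])
    qed
    then have "(\<Prod>j\<in>UNIV. complex_of_real ((cmod (d j (x $ j)))\<^sup>2) * cnj (1 / (1 - g x $ j * cnj (\<mu> $ j))\<^sup>2)) =
       (\<Prod>j\<in>UNIV. 1 / (1 + cnj (\<mu> $ j) * x $ j)\<^sup>2)" by (intro prod.cong) auto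
    then show ?thesis
      by (simp only: E_def W_def polydisc_kernel_def prod.distrib of_real_prod cnj_prod mult.left_commute[of _ "F (g x)"])
  qed
  note cov = integral_diag_map[OF bij[unfolded g_def] der cd cE, folded g_def]
  have cong: "set_lebesgue_integral lborel ?D f = set_lebesgue_integral lborel ?D h"
    "set_integrable lborel ?D f = set_integrable lborel ?D h" if "\<And>x. x \<in> ?D \<Longrightarrow> f x = h x" for f h :: "complex^'n \<Rightarrow> complex"
    using that by (auto intro!: set_lebesgue_integral_cong) (metis set_integrable_cong that)+
  have intW: "set_integrable lborel ?D W"
    using cov(1) intE cong(2)[OF wE] by simp
  have IW: "set_lebesgue_integral lborel ?D W = set_lebesgue_integral lborel ?D E"
    using cov(2) cong(1)[OF wE] by simp
  have "slice_holomorphic W"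
    unfolding slice_holomorphic_def
  proof (intro conjI ballI allI)
    have cg: "continuous_on ?D g"
      unfolding g_def diag_map_def disc_moebius_def using nz D by (intro continuous_intros) auto
    show "continuous_on ?D W"
      unfolding W_def using nz D gD
      by (intro continuous_intros continuous_on_compose2[OF F' cg]) auto
    fix x :: "complex^'n" and i assume x: "x \<in> ?D"
    have gu: "g (vec_upd i t x) = vec_upd i (disc_moebius (\<mu> $ i) t) (g x)" for t
      by (simp add: g_def diag_map_def vec_eq_iff)
    have "(\<lambda>s. F (vec_upd i s (g x))) \<circ> disc_moebius (\<mu> $ i) holomorphic_on ball 0 1"
    proof (rule holomorphic_on_compose_gen)
      show "disc_moebius (\<mu> $ i) holomorphic_on ball 0 1"
        unfolding holomorphic_on_open[OF open_ball] using der by (meson mem_ball_0)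
      show "(\<lambda>s. F (vec_upd i s (g x))) holomorphic_on ball 0 1"
        using F gD[OF x] by (simp add: slice_holomorphic_def)
      show "disc_moebius (\<mu> $ i) ` ball 0 1 \<subseteq> ball 0 1" using moebius_in_disc[OF m] by auto
    qed
    moreover have "(\<lambda>t. \<Prod>j\<in>UNIV. 1 / (1 + cnj (\<mu> $ j) * (if j = i then t else x $ j))\<^sup>2) holomorphic_on ball 0 1"
    proof (intro holomorphic_on_prod)
      fix j
      show "(\<lambda>t. 1 / (1 + cnj (\<mu> $ j) * (if j = i then t else x $ j))\<^sup>2) holomorphic_on ball 0 1"
        using nz by (cases "j = i") (auto intro!: holomorphic_intros)
    qed
    ultimately show "(\<lambda>t. W (vec_upd i t x)) holomorphic_on ball 0 1"
      unfolding W_def gu vec_upd_nth o_def by (intro holomorphic_on_mult)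
  qed
  from polydisc_mean_value[OF this intW] have "set_lebesgue_integral lborel ?D E = measure lborel ?D * W 0"
    by (simp add: IW)
  moreover have "g 0 = \<mu>" by (simp add: g_def diag_map_def disc_moebius_def vec_eq_iff)
  ultimately show ?thesis by (simp add: E_def[symmetric] W_def)
qed

section \<open>Elementary symmetric polynomials\<close>

text \<open>Zero-based position, for use as an exponent in Vandermonde matrices, whereas
  \<open>card {..k}\<close> numbers coordinates from 1.\<close>

definition ordpos :: "'n::{finite,linorder} \<Rightarrow> nat" where
  "ordpos k = card {..<k}"

lemma card_atMost_ordpos: "card {..k} = Suc (ordpos k)" for k :: "'n::{finite,linorder}"
proof -
  have "{..k} = insert k {..<k}" by auto
  then show ?thesis by (simp add: ordpos_def)
qed

lemma ordpos_strict_mono: "i < j \<Longrightarrow> ordpos i < ordpos j" for i j :: "'n::{finite,linorder}"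
  unfolding ordpos_def by (rule psubset_card_mono) auto

lemma ordpos_less_iff [simp]: "ordpos i < ordpos j \<longleftrightarrow> i < j" and ordpos_le_iff [simp]: "ordpos i \<le> ordpos j \<longleftrightarrow> i \<le> j"
  and ordpos_eq_iff [simp]: "ordpos i = ordpos j \<longleftrightarrow> i = j" for i j :: "'n::{finite,linorder}"
  using ordpos_strict_mono[of i j] ordpos_strict_mono[of j i] by (metis less_asym linorder_neqE not_less nless_le)+

lemma ordpos_less_card: "ordpos k < CARD('n)" for k :: "'n::{finite,linorder}"
  unfolding ordpos_def by (rule psubset_card_mono) auto

lemma bij_ordpos: "bij_betw ordpos (UNIV :: 'n::{finite,linorder} set) {..<CARD('n)}"
proof (rule bij_betw_imageI)
  show inj: "inj_on ordpos (UNIV :: 'n set)" by (auto simp: inj_on_def)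
  show "range (ordpos :: 'n \<Rightarrow> nat) = {..<CARD('n)}"
    by (rule card_subset_eq) (auto simp: ordpos_less_card card_image[OF inj])
qed

text \<open>The coordinates of \<open>\<xi>\<close> addressed by natural numbers, with the usual
  conventions: 1 at index 0 and 0 beyond the dimension. For \<open>r > 0\<close> the sum has at most
  one term.\<close>

definition ecoef :: "complex^'n::{finite,linorder} \<Rightarrow> nat \<Rightarrow> complex" where
  "ecoef \<xi> r = (if r = 0 then 1 else \<Sum>i\<in>{i. card {..i} = r}. \<xi> $ i)"

lemma ecoef_ordpos [simp]: "ecoef \<xi> (Suc (ordpos i)) = \<xi> $ i"
proof -
  have "{i'. card {..i'} = Suc (ordpos i)} = {i}" by (auto simp: card_atMost_ordpos)
  then show ?thesis by (simp add: ecoef_def)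
qed

lemma ecoef_symmetrization: "ecoef (symmetrization x) r = elem_sym r x"
  for x :: "complex^'n::{finite,linorder}"
proof (cases r)
  case 0
  have "{J :: 'n set. card J = 0} = {{}}" by auto
  then show ?thesis using 0 by (simp add: ecoef_def elem_sym_def)
next
  case (Suc k)
  show ?thesis
  proof (cases "k < CARD('n)")
    case True
    then obtain i :: 'n where "k = ordpos i" using bij_ordpos[where 'n = 'n] by (auto simp: bij_betw_def)
    then show ?thesis using Suc by (simp add: symmetrization_def card_atMost_ordpos)
  next
    case False
    have "card J \<noteq> r" for J :: "'n set" using card_mono[of UNIV J] False Suc by auto
    then have "{J :: 'n set. card J = r} = {}" by auto
    moreover have "{i :: 'n. card {..i} = r} = {}" using \<open>\<And>J. card J \<noteq> r\<close> by auto
    ultimately show ?thesis using Suc by (simp add: ecoef_def elem_sym_def)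
  qed
qed

lemma prod_elem_sym:
  fixes x :: "complex^'n::finite"
  shows "(\<Prod>j\<in>UNIV. t - x $ j * b) = (\<Sum>r\<le>CARD('n). (- b) ^ r * elem_sym r x * t ^ (CARD('n) - r))"
proof -
  have "(\<Prod>j\<in>UNIV. t - x $ j * b) = (\<Prod>j\<in>UNIV. (- b) * x $ j + t)" by (simp add: mult.commute)
  also have "\<dots> = (\<Sum>X\<in>UNIV. (\<Prod>j\<in>X. (- b) * x $ j) * (\<Prod>j\<in>UNIV - X. t))"
    by (subst prod_add) auto
  also have "\<dots> = (\<Sum>X\<in>UNIV. (- b) ^ card X * (\<Prod>j\<in>X. x $ j) * t ^ (CARD('n) - card X))"
  proof (rule sum.cong[OF refl])
    fix X :: "'n set"
    have "card (UNIV - X) = CARD('n) - card X" by (simp add: card_Diff_subset)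
    then show "(\<Prod>j\<in>X. (- b) * x $ j) * (\<Prod>j\<in>UNIV - X. t) = (- b) ^ card X * (\<Prod>j\<in>X. x $ j) * t ^ (CARD('n) - card X)"
      by (simp only: prod.distrib prod_constant)
  qed
  also have "\<dots> = (\<Sum>r\<le>CARD('n). \<Sum>X\<in>{X\<in>UNIV. card X = r}. (- b) ^ card X * (\<Prod>j\<in>X. x $ j) * t ^ (CARD('n) - card X))"
    by (rule sum.group[symmetric]) (auto simp: card_mono)
  also have "\<dots> = (\<Sum>r\<le>CARD('n). (- b) ^ r * elem_sym r x * t ^ (CARD('n) - r))"
    by (intro sum.cong refl) (simp add: elem_sym_def sum_distrib_left sum_distrib_right)
  finally show ?thesis .
qed

section \<open>The characteristic polynomial and membership in the symmetrized polydisc\<close>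

text \<open>The product of the factors \<open>t - x $ j * b\<close> written in symmetric
  coordinates. With \<open>b = 1\<close> it is the monic polynomial whose roots are the
  \<open>x $ j\<close>; with \<open>t = 1\<close> it is the reversed polynomial, which supplies the
  denominators of the kernel.\<close>

definition char_fun :: "complex^'n::{finite,linorder} \<Rightarrow> complex \<Rightarrow> complex \<Rightarrow> complex" where
  "char_fun \<xi> b t = (\<Sum>r\<le>CARD('n). (- b) ^ r * ecoef \<xi> r * t ^ (CARD('n) - r))"

lemma char_fun_symmetrization:
  fixes x :: "complex^'n::{finite,linorder}"
  shows "char_fun (symmetrization x) b t = (\<Prod>j\<in>UNIV. t - x $ j * b)"
  by (simp add: prod_elem_sym char_fun_def ecoef_symmetrization)

lemma char_fun_root: "char_fun (symmetrization x) 1 (x $ j) = 0"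
  by (simp add: char_fun_symmetrization prod_zero_iff) (metis diff_self)

definition char_poly :: "complex^'n::{finite,linorder} \<Rightarrow> complex poly" where
  "char_poly \<xi> = (\<Sum>r\<le>CARD('n). monom ((- 1) ^ r * ecoef \<xi> r) (CARD('n) - r))"

lemma poly_char_poly: "poly (char_poly \<xi>) t = char_fun \<xi> 1 t"
  by (simp add: char_poly_def char_fun_def poly_sum poly_monom)

lemma coeff_char_poly:
  fixes \<xi> :: "(complex, 'n::{finite,linorder}) vec"
  assumes r: "r \<le> CARD('n)"
  shows "coeff (char_poly \<xi>) (CARD('n) - r) = (- 1) ^ r * ecoef \<xi> r"
proof -
  have "coeff (char_poly \<xi>) (CARD('n) - r) = (\<Sum>r'\<le>CARD('n). if r' = r then (- 1) ^ r * ecoef \<xi> r else 0)"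
    unfolding char_poly_def coeff_sum using r by (intro sum.cong) (auto simp: coeff_monom)
  then show ?thesis using r by simp
qed

lemma degree_char_poly_le:
  fixes \<xi> :: "(complex, 'n::{finite,linorder}) vec"
  shows "degree (char_poly \<xi>) \<le> CARD('n)"
  unfolding char_poly_def
  by (intro degree_sum_le) (auto intro: order_trans[OF degree_monom_le])

lemma char_poly_inject:
  fixes \<xi> \<eta> :: "complex^'n::{finite,linorder}"
  assumes "char_poly \<xi> = char_poly \<eta>"
  shows "\<xi> = \<eta>"
proof -
  have "\<xi> $ i = \<eta> $ i" for i
  proof -
    have "Suc (ordpos i) \<le> CARD('n)" using ordpos_less_card[of i] by simp
    then have "(- 1) ^ Suc (ordpos i) * ecoef \<xi> (Suc (ordpos i)) = (- 1) ^ Suc (ordpos i) * ecoef \<eta> (Suc (ordpos i))"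
      using coeff_char_poly[of "Suc (ordpos i)" \<xi>] coeff_char_poly[of "Suc (ordpos i)" \<eta>] assms by metis
    then show ?thesis by (simp only: mult_cancel_left ecoef_ordpos) simp
  qed
  then show ?thesis by (simp add: vec_eq_iff)
qed

text \<open>The fundamental theorem of algebra, applied to the monic polynomial with coefficients
  taken from \<open>\<xi>\<close>; its coefficients determine \<open>\<xi>\<close>.\<close>

lemma symmetrization_surj:
  fixes \<xi> :: "complex^'n::{finite,linorder}"
  obtains x where "\<xi> = symmetrization x"
proof -
  let ?n = "CARD('n)"
  have lc: "coeff (char_poly \<xi>) ?n = 1" using coeff_char_poly[of 0 \<xi>] by (simp add: ecoef_def)
  have deg: "degree (char_poly \<xi>) = ?n"
    using degree_char_poly_le[of \<xi>] lc by (intro antisym le_degree) auto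
  obtain root where root: "smult (lead_coeff (char_poly \<xi>)) (\<Prod>i<degree (char_poly \<xi>). [:- root i, 1:]) = char_poly \<xi>"
    using complex_poly_decompose' by blast
  define x :: "(complex, 'n) vec" where "x = (\<chi> i. root (ordpos i))"
  have "poly (char_poly \<xi>) t = poly (char_poly (symmetrization x)) t" for t
  proof -
    have "poly (char_poly \<xi>) t = (\<Prod>i<?n. t - root i)"
      by (subst root[symmetric]) (simp add: deg lc poly_prod)
    also have "\<dots> = (\<Prod>i\<in>(UNIV::'n set). t - root (ordpos i))"
      using prod.reindex_bij_betw[OF bij_ordpos, of "\<lambda>i. t - root i", where 'n1 = 'n] by simp
    also have "\<dots> = poly (char_poly (symmetrization x)) t"
      by (simp add: poly_char_poly char_fun_symmetrization x_def)
    finally show ?thesis .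
  qed
  then have "char_poly \<xi> = char_poly (symmetrization x)" by (simp add: poly_eq_poly_eq_iff[symmetric] fun_eq_iff)
  then show ?thesis using that char_poly_inject by blast
qed

lemma symmetrization_range_eq:
  assumes "symmetrization x = symmetrization y"
  shows "range (\<lambda>j. x $ j) = range (\<lambda>j. y $ j)"
proof -
  have "range (\<lambda>j. x $ j) = {t. char_fun (symmetrization x) 1 t = 0}" for x :: "complex^'n::{finite,linorder}"
    by (auto simp: char_fun_symmetrization)
  then show ?thesis using assms by metis
qed

lemma symmetrized_polydisc_eq: "symmetrized_polydisc = symmetrization ` polydisc"
  by (simp add: symmetrized_polydisc_def polydisc_def)

text \<open>A preimage coordinate of modulus at least 1 has its inverse in the closed disc, and
  there the product of the \<open>1 - x $ j * b\<close> vanishes. In this form membership is a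
  condition over a compact set of parameters.\<close>

lemma in_symmetrized_polydisc_iff:
  fixes \<xi> :: "complex^'n::{finite,linorder}"
  shows "\<xi> \<in> symmetrized_polydisc \<longleftrightarrow> (\<forall>b\<in>cball 0 1. char_fun \<xi> b 1 \<noteq> 0)"
proof
  assume "\<xi> \<in> symmetrized_polydisc"
  then obtain x where x: "x \<in> polydisc" "\<xi> = symmetrization x" by (auto simp: symmetrized_polydisc_eq)
  show "\<forall>b\<in>cball 0 1. char_fun \<xi> b 1 \<noteq> 0"
  proof
    fix b :: complex assume b: "b \<in> cball 0 1"
    have "1 - x $ j * b \<noteq> 0" for j
    proof
      assume "1 - x $ j * b = 0"
      then have "cmod (x $ j * b) = 1" by (metis eq_iff_diff_eq_0 norm_one)
      moreover have "cmod (x $ j) * cmod b \<le> cmod (x $ j) * 1" using b by (intro mult_left_mono) auto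
      moreover have "cmod (x $ j) < 1" using x by (simp add: polydisc_def)
      ultimately show False by (simp add: norm_mult)
    qed
    then show "char_fun \<xi> b 1 \<noteq> 0" by (simp add: x char_fun_symmetrization prod_zero_iff)
  qed
next
  assume nz: "\<forall>b\<in>cball 0 1. char_fun \<xi> b 1 \<noteq> 0"
  obtain x where x: "\<xi> = symmetrization x" by (rule symmetrization_surj)
  have "cmod (x $ j) < 1" for j
  proof (rule ccontr)
    assume j: "\<not> cmod (x $ j) < 1"
    then have x0: "x $ j \<noteq> 0" by auto
    have "inverse (x $ j) \<in> cball 0 1" using j x0 by (simp add: norm_inverse inverse_le_1_iff)
    then have "(\<Prod>i\<in>UNIV. 1 - x $ i * inverse (x $ j)) \<noteq> 0" using nz by (auto simp: x char_fun_symmetrization)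
    then have "1 - x $ j * inverse (x $ j) \<noteq> 0" by (metis UNIV_I finite prod_zero_iff)
    then show False using x0 by simp
  qed
  then show "\<xi> \<in> symmetrized_polydisc" by (auto simp: symmetrized_polydisc_eq x polydisc_def)
qed

lemma continuous_ecoef [continuous_intros]:
  "continuous_on S f \<Longrightarrow> continuous_on S (\<lambda>x. ecoef (f x) r)"
  unfolding ecoef_def by (cases "r = 0") (auto intro!: continuous_intros)

text \<open>The complement is the projection of a closed set along the compact disc of parameters
  \<open>b\<close>, hence closed.\<close>

lemma open_symmetrized_polydisc: "open (symmetrized_polydisc :: (complex^'n::{finite,linorder}) set)"
proof -
  let ?U = "{p :: complex \<times> (complex, 'n) vec. char_fun (snd p) (fst p) 1 = 0}"
  have "closed ?U"
    unfolding char_fun_def by (intro closed_Collect_eq continuous_intros)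
  then have "closedin (top_of_set (cball 0 1 \<times> UNIV)) ((cball 0 1 \<times> UNIV) \<inter> ?U)"
    by (simp add: closedin_closed_Int)
  from closedin_compact_projection[OF compact_cball this]
  have "closed {y. \<exists>x. x \<in> cball 0 1 \<and> (x, y) \<in> (cball 0 1 \<times> UNIV) \<inter> ?U}" by simp
  moreover have "- symmetrized_polydisc = {y. \<exists>x. x \<in> cball 0 1 \<and> (x, y) \<in> (cball 0 1 \<times> UNIV) \<inter> ?U}"
    unfolding set_eq_iff Compl_iff in_symmetrized_polydisc_iff by fastforce
  ultimately have "closed (- symmetrized_polydisc :: (complex, 'n) vec set)" by simp
  then show ?thesis by (simp add: open_closed)
qed

lemma continuous_elem_sym [continuous_intros]:
  "continuous_on S f \<Longrightarrow> continuous_on S (\<lambda>x. elem_sym r (f x))"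
  unfolding elem_sym_def by (intro continuous_intros)

lemma continuous_symmetrization: "continuous_on S symmetrization"
  unfolding symmetrization_def by (intro continuous_intros)

lemma bounded_symmetrized_polydisc: "bounded (symmetrized_polydisc :: (complex^'n::{finite,linorder}) set)"
proof -
  have "compact (closure (polydisc :: (complex, 'n) vec set))" using bounded_polydisc by simp
  then have "bounded (symmetrization ` closure (polydisc :: (complex, 'n) vec set))"
    by (intro compact_imp_bounded compact_continuous_image continuous_symmetrization)
  then show ?thesis unfolding symmetrized_polydisc_eq
    by (rule bounded_subset) (use closure_subset in blast)
qed

section \<open>The Vandermonde determinant as Jacobian of the symmetrization map\<close>

definition vandermonde :: "complex^'n::{finite,linorder} \<Rightarrow> ((complex, 'n) vec, 'n) vec" where
  "vandermonde x = (\<chi> j k. x $ j ^ ordpos k)"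

text \<open>A vector in the kernel holds the coefficients of a polynomial of degree below
  \<open>CARD('n)\<close> with \<open>CARD('n)\<close> distinct roots.\<close>

lemma det_vandermonde_nonzero:
  fixes x :: "complex^'n::{finite,linorder}"
  assumes inj: "inj (\<lambda>j. x $ j)"
  shows "det (vandermonde x) \<noteq> 0"
proof
  assume "det (vandermonde x) = 0"
  then have "\<not> (\<exists>B. B ** vandermonde x = mat 1)" by (metis invertible_det_nz invertible_left_inverse)
  then obtain c where c: "c \<noteq> 0" "vandermonde x *v c = 0"
    using matrix_left_invertible_ker[of "vandermonde x"] by blast
  define p where "p = (\<Sum>k\<in>UNIV. monom (c $ k) (ordpos k))"
  have root: "poly p (x $ j) = 0" for j
    using arg_cong[OF c(2), of "\<lambda>v. v $ j"]
    by (simp add: p_def poly_sum poly_monom matrix_vector_mult_def vandermonde_def mult.commute)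
  have co: "coeff p (ordpos k) = c $ k" for k
    by (simp add: p_def coeff_sum coeff_monom if_distrib cong: if_cong)
  have p0: "p \<noteq> 0"
  proof
    assume "p = 0"
    then have "c $ k = 0" for k using co[of k] by simp
    then show False using c by (simp add: vec_eq_iff)
  qed
  have "degree p \<le> CARD('n) - 1"
    unfolding p_def
  proof (rule degree_sum_le)
    show "degree (monom (c $ k) (ordpos k)) \<le> CARD('n) - 1" for k
      using degree_monom_le[of "c $ k" "ordpos k"] ordpos_less_card[of k] by linarith
  qed simp
  then have "degree p < CARD('n)" using zero_less_card_finite[where 'a = 'n] by linarith
  moreover have "CARD('n) \<le> degree p"
  proof -
    have "CARD('n) = card (range (\<lambda>j. x $ j))" using card_image[OF inj] by simp
    also have "\<dots> \<le> card {t. poly p t = 0}"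
      using root poly_roots_finite[OF p0] by (intro card_mono) auto
    also have "\<dots> \<le> degree p" by (rule card_poly_roots_bound[OF p0])
    finally show ?thesis .
  qed
  ultimately show False by simp
qed

text \<open>Serves as the partial derivative of \<open>elem_sym (Suc k)\<close> in direction
  \<open>j\<close>.\<close>

definition elem_sym_omit :: "nat \<Rightarrow> 'n \<Rightarrow> complex^'n::finite \<Rightarrow> complex" where
  "elem_sym_omit k j x = (\<Sum>J\<in>{J. card J = k \<and> j \<notin> J}. \<Prod>i\<in>J. x $ i)"

lemma sum_over_insert:
  fixes f :: "'n::finite set \<Rightarrow> 'a::comm_monoid_add"
  shows "(\<Sum>J\<in>{J. card J = Suc k \<and> j \<in> J}. f (J - {j})) = (\<Sum>J\<in>{J. card J = k \<and> j \<notin> J}. f J)"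
  by (rule sum.reindex_bij_witness[of _ "insert j" "\<lambda>J. J - {j}"]) (auto simp: insert_absorb card_insert_if)

lemma has_derivative_elem_sym:
  "(elem_sym (Suc k) has_derivative (\<lambda>h. \<Sum>j\<in>UNIV. elem_sym_omit k j x * h $ j)) (at x)"
proof -
  have nth: "((\<lambda>x. x $ i) has_derivative (\<lambda>h. h $ i)) (at x)" for i
    by (rule bounded_linear_imp_has_derivative[OF bounded_linear_vec_nth])
  have "(elem_sym (Suc k) has_derivative (\<lambda>h. \<Sum>J\<in>{J. card J = Suc k}. \<Sum>j\<in>J. h $ j * (\<Prod>i\<in>J - {j}. x $ i))) (at x)"
    unfolding elem_sym_def by (intro has_derivative_sum has_derivative_prod nth)
  also have "(\<lambda>h. \<Sum>J\<in>{J. card J = Suc k}. \<Sum>j\<in>J. h $ j * (\<Prod>i\<in>J - {j}. x $ i)) = (\<lambda>h. \<Sum>j\<in>UNIV. elem_sym_omit k j x * h $ j)"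
  proof
    fix h :: "complex^'a"
    have "(\<Sum>J\<in>{J. card J = Suc k}. \<Sum>j\<in>J. h $ j * (\<Prod>i\<in>J - {j}. x $ i)) =
      (\<Sum>J\<in>{J. card J = Suc k}. \<Sum>j\<in>{j\<in>UNIV. j \<in> J}. h $ j * (\<Prod>i\<in>J - {j}. x $ i))" by simp
    also have "\<dots> = (\<Sum>j\<in>UNIV. \<Sum>J\<in>{J\<in>{J. card J = Suc k}. j \<in> J}. h $ j * (\<Prod>i\<in>J - {j}. x $ i))"
      by (rule sum.swap_restrict) auto
    also have "\<dots> = (\<Sum>j\<in>UNIV. elem_sym_omit k j x * h $ j)"
      by (simp add: sum_distrib_left[symmetric] sum_over_insert elem_sym_omit_def mult.commute)
    finally show "(\<Sum>J\<in>{J. card J = Suc k}. \<Sum>j\<in>J. h $ j * (\<Prod>i\<in>J - {j}. x $ i)) = (\<Sum>j\<in>UNIV. elem_sym_omit k j x * h $ j)" .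
  qed
  finally show ?thesis .
qed

lemma elem_sym_split: "elem_sym (Suc k) x = elem_sym_omit (Suc k) j x + x $ j * elem_sym_omit k j x"
proof -
  have "elem_sym (Suc k) x = (\<Sum>J\<in>{J. card J = Suc k \<and> j \<notin> J} \<union> {J. card J = Suc k \<and> j \<in> J}. \<Prod>i\<in>J. x $ i)"
    unfolding elem_sym_def by (rule sum.cong) auto
  also have "\<dots> = elem_sym_omit (Suc k) j x + (\<Sum>J\<in>{J. card J = Suc k \<and> j \<in> J}. \<Prod>i\<in>J. x $ i)"
    by (subst sum.union_disjoint) (auto simp: elem_sym_omit_def)
  also have "(\<Sum>J\<in>{J. card J = Suc k \<and> j \<in> J}. \<Prod>i\<in>J. x $ i) = (\<Sum>J\<in>{J. card J = Suc k \<and> j \<in> J}. x $ j * (\<Prod>i\<in>J - {j}. x $ i))"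
    by (intro sum.cong refl prod.remove) auto
  also have "\<dots> = x $ j * elem_sym_omit k j x"
    by (simp add: sum_distrib_left[symmetric] sum_over_insert elem_sym_omit_def)
  finally show ?thesis .
qed

text \<open>Iterating \<open>elem_sym_split\<close> leaves powers of \<open>x $ j\<close> with
  coefficients symmetric in all coordinates. This separates the Jacobian into a triangular matrix
  and a Vandermonde matrix.\<close>

lemma elem_sym_omit_eq: "elem_sym_omit k j x = (\<Sum>r\<le>k. (- (x $ j)) ^ r * elem_sym (k - r) x)"
proof (induction k)
  case 0
  have "{J :: 'a set. card J = 0 \<and> j \<notin> J} = {{}}" "{J :: 'a set. card J = 0} = {{}}" by auto
  then show ?case by (simp add: elem_sym_omit_def elem_sym_def)
next
  case (Suc k)
  have "elem_sym_omit (Suc k) j x = elem_sym (Suc k) x - x $ j * elem_sym_omit k j x"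
    using elem_sym_split[of k x j] by simp
  also have "\<dots> = (\<Sum>r\<le>Suc k. (- (x $ j)) ^ r * elem_sym (Suc k - r) x)"
    by (simp add: Suc.IH sum.atMost_Suc_shift sum_distrib_left mult.assoc sum_negf del: sum.atMost_Suc)
  finally show ?case .
qed

definition jacobian_factor :: "complex^'n::{finite,linorder} \<Rightarrow> ((complex, 'n) vec, 'n) vec" where
  "jacobian_factor x = (\<chi> k l. if l \<le> k then (- 1) ^ ordpos l * elem_sym (ordpos k - ordpos l) x else 0)"

text \<open>The matrix is triangular with signs on the diagonal. A permutation contributing to the
  determinant satisfies \<open>p i \<le> i\<close> for all \<open>i\<close>, and since the positions
  have the same sum before and after, it is the identity.\<close>

lemma cmod_det_jacobian_factor: "cmod (det (jacobian_factor x)) = 1"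
  for x :: "complex^'n::{finite,linorder}"
proof -
  have z: "(\<Prod>i\<in>UNIV. jacobian_factor x $ i $ p i) = 0" if p: "p permutes UNIV" "p \<noteq> id" for p
  proof (rule ccontr)
    assume nz: "(\<Prod>i\<in>UNIV. jacobian_factor x $ i $ p i) \<noteq> 0"
    have le: "p i \<le> i" for i
    proof (rule ccontr)
      assume "\<not> p i \<le> i"
      then have "jacobian_factor x $ i $ p i = 0" by (simp add: jacobian_factor_def)
      then show False using nz by (metis UNIV_I finite prod_zero_iff)
    qed
    have "(\<Sum>i\<in>UNIV. ordpos (p i)) = (\<Sum>i\<in>(UNIV :: 'n set). ordpos i)"
      by (rule sum.permute[OF p(1), of ordpos, symmetric, unfolded o_def])
    then have "ordpos (p i) = ordpos i" for i
      by (rule sum_mono_inv) (use le in auto)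
    then show False using p by (auto simp: fun_eq_iff)
  qed
  have "det (jacobian_factor x) = (\<Sum>p\<in>{id}. of_int (sign p) * (\<Prod>i\<in>UNIV. jacobian_factor x $ i $ p i))"
    unfolding det_def by (rule sum.mono_neutral_right) (auto simp: z finite_permutations permutes_id)
  also have "cmod \<dots> = 1"
  proof -
    have "{J :: 'n set. card J = 0} = {{}}" by auto
    then show ?thesis by (simp add: jacobian_factor_def elem_sym_def prod_norm[symmetric] norm_power)
  qed
  finally show ?thesis .
qed

definition sym_jacobian :: "complex^'n::{finite,linorder} \<Rightarrow> ((complex, 'n) vec, 'n) vec" where
  "sym_jacobian x = jacobian_factor x ** transpose (vandermonde x)"

lemma cmod_det_sym_jacobian: "cmod (det (sym_jacobian x)) = cmod (det (vandermonde x))"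
  by (simp add: sym_jacobian_def det_mul norm_mult cmod_det_jacobian_factor)

lemma has_derivative_symmetrization:
  "(symmetrization has_derivative (\<lambda>h. sym_jacobian x *v h)) (at x)"
  for x :: "complex^'n::{finite,linorder}"
proof -
  have "(symmetrization has_derivative (\<lambda>h. \<chi> k. \<Sum>j\<in>UNIV. elem_sym_omit (ordpos k) j x * h $ j)) (at x)"
    unfolding symmetrization_def card_atMost_ordpos
    by (intro has_derivative_vec_lambda has_derivative_elem_sym)
  also have "(\<lambda>h. \<chi> k. \<Sum>j\<in>UNIV. elem_sym_omit (ordpos k) j x * h $ j) = (\<lambda>h. sym_jacobian x *v h)"
  proof -
    have "elem_sym_omit (ordpos k) j x = sym_jacobian x $ k $ j" for k j
    proof -
      have im: "bij_betw ordpos {l. l \<le> k} {..ordpos k}"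
      proof (rule bij_betw_imageI)
        show "ordpos ` {l. l \<le> k} = {..ordpos k}"
        proof
          show "{..ordpos k} \<subseteq> ordpos ` {l. l \<le> k}"
          proof
            fix r assume "r \<in> {..ordpos k}"
            then have "r < CARD('n)" using ordpos_less_card[of k] by simp
            then obtain l :: 'n where "r = ordpos l" using bij_ordpos[where 'n = 'n] by (auto simp: bij_betw_def)
            then show "r \<in> ordpos ` {l. l \<le> k}" using \<open>r \<in> {..ordpos k}\<close> by auto
          qed
        qed auto
      qed (auto simp: inj_on_def)
      have "elem_sym_omit (ordpos k) j x = (\<Sum>l\<in>{l. l \<le> k}. (- (x $ j)) ^ ordpos l * elem_sym (ordpos k - ordpos l) x)"
        unfolding elem_sym_omit_eq using sum.reindex_bij_betw[OF im, of "\<lambda>r. (- (x $ j)) ^ r * elem_sym (ordpos k - r) x"] by simp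
      also have "\<dots> = (\<Sum>l\<in>UNIV. if l \<le> k then (- (x $ j)) ^ ordpos l * elem_sym (ordpos k - ordpos l) x else 0)"
        by (simp add: sum.If_cases)
      also have "\<dots> = sym_jacobian x $ k $ j"
        unfolding sym_jacobian_def matrix_matrix_mult_def jacobian_factor_def vandermonde_def transpose_def
        by (auto intro!: sum.cong simp: power_minus[of "x $ j"])
      finally show ?thesis .
    qed
    then show ?thesis by (simp add: matrix_vector_mult_def fun_eq_iff)
  qed
  finally show ?thesis .
qed

lemma elem_sym_permute:
  assumes "p permutes UNIV"
  shows "elem_sym k (\<chi> i. x $ p i) = elem_sym k x"
  unfolding elem_sym_def
proof (rule sum.reindex_bij_witness[of _ "\<lambda>J. inv p ` J" "\<lambda>J. p ` J"])
  have b: "bij p" using assms by (rule permutes_bij)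
  have inj: "inj_on p J" for J using b by (auto simp: bij_def inj_on_def)
  show "(\<Prod>j\<in>p ` J. x $ j) = (\<Prod>j\<in>J. (\<chi> i. x $ p i) $ j)" for J by (simp add: prod.reindex[OF inj])
  show "inv p ` p ` J = J" "p ` inv p ` J = J" for J
    using b by (auto simp: image_image bij_def surj_f_inv_f)
  have "inj (inv p)" using b by (simp add: bij_imp_bij_inv bij_is_inj)
  then show "J \<in> {J. card J = k} \<Longrightarrow> inv p ` J \<in> {J. card J = k}" for J
    by (simp add: card_image inj_on_subset)
  show "J \<in> {J. card J = k} \<Longrightarrow> p ` J \<in> {J. card J = k}" for J
    using card_image[OF inj, of J] by simp
qed

lemma symmetrization_permute: "p permutes UNIV \<Longrightarrow> symmetrization (\<chi> i. x $ p i) = symmetrization x"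
  by (simp add: symmetrization_def elem_sym_permute)

lemma det_vandermonde_permute:
  "p permutes UNIV \<Longrightarrow> det (vandermonde (\<chi> i. x $ p i)) = of_int (sign p) * det (vandermonde x)"
  using det_permute_rows[of p "vandermonde x"] by (simp add: vandermonde_def)

section \<open>The symmetrization map as a branched covering\<close>

text \<open>Sorting by real parts gives one open cell for each permutation. The cells are disjoint,
  have a common image under \<open>symmetrization\<close>, and cover the polydisc up to
  \<open>Re_collision\<close>.\<close>

definition sorted_region :: "('n::{finite,linorder} \<Rightarrow> 'n) \<Rightarrow> (complex, 'n) vec set" where
  "sorted_region p = {x \<in> polydisc. \<forall>i j. i < j \<longrightarrow> Re (x $ p i) < Re (x $ p j)}"

lemma open_sorted_region: "open (sorted_region p)"
proof -
  have "open {x :: (complex, 'a) vec. i < j \<longrightarrow> Re (x $ p i) < Re (x $ p j)}" for i j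
    by (cases "i < j") (auto intro!: open_Collect_less continuous_intros)
  then have "open (polydisc \<inter> (\<Inter>i\<in>UNIV. \<Inter>j\<in>UNIV. {x. i < j \<longrightarrow> Re (x $ p i) < Re (x $ p j)}))"
    by (intro open_Int open_polydisc open_INT ballI) auto
  also have "polydisc \<inter> (\<Inter>i\<in>UNIV. \<Inter>j\<in>UNIV. {x. i < j \<longrightarrow> Re (x $ p i) < Re (x $ p j)}) = sorted_region p"
    by (auto simp: sorted_region_def)
  finally show ?thesis .
qed

text \<open>The position of an entry in a sorted vector is the number of values with smaller real
  part, so the set of values determines the vector.\<close>

lemma sorted_vec_eq:
  fixes x y :: "(complex, 'n::{finite,linorder}) vec"
  assumes x: "\<And>i j. i < j \<Longrightarrow> Re (x $ i) < Re (x $ j)" and y: "\<And>i j. i < j \<Longrightarrow> Re (y $ i) < Re (y $ j)"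
    and eq: "range (\<lambda>j. x $ j) = range (\<lambda>j. y $ j)"
  shows "x = y"
proof -
  have *: "card {t \<in> range (\<lambda>j. z $ j). Re t < Re (z $ i)} = ordpos i"
    if z: "\<And>i j. i < j \<Longrightarrow> Re (z $ i) < Re (z $ j)" for z :: "(complex, 'n) vec" and i
  proof -
    have lt: "Re (z $ j) < Re (z $ i) \<longleftrightarrow> j < i" for i j using z by (metis less_asym linorder_neqE order_less_irrefl)
    have "{t \<in> range (\<lambda>j. z $ j). Re t < Re (z $ i)} = (\<lambda>j. z $ j) ` {..<i}" using lt by auto
    moreover have "inj_on (\<lambda>j. z $ j) {..<i}" using lt by (metis inj_onI linorder_neqE order_less_irrefl)
    ultimately show ?thesis by (simp add: card_image ordpos_def)
  qed
  have "x $ i = y $ i" for i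
  proof -
    obtain j where j: "x $ i = y $ j" using eq by (metis rangeI rangeE)
    have "ordpos i = ordpos j" using *[OF x, of i] *[OF y, of j] eq j by simp
    then show ?thesis using j by simp
  qed
  then show ?thesis by (simp add: vec_eq_iff)
qed

lemma permute_sorted_region:
  assumes p: "p permutes UNIV" and x: "x \<in> sorted_region p"
  shows "(\<chi> i. x $ p i) \<in> sorted_region id"
  using x by (auto simp: sorted_region_def polydisc_def)

lemma inj_on_sorted_region:
  assumes p: "p permutes UNIV"
  shows "inj_on symmetrization (sorted_region p)"
proof (rule inj_onI)
  fix x y assume x: "x \<in> sorted_region p" and y: "y \<in> sorted_region p" and eq: "symmetrization x = symmetrization y"
  have "symmetrization (\<chi> i. x $ p i) = symmetrization (\<chi> i. y $ p i)"
    using eq by (simp add: symmetrization_permute[OF p])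
  from symmetrization_range_eq[OF this] have "(\<chi> i. x $ p i) = (\<chi> i. y $ p i)"
    by (intro sorted_vec_eq) (use x y in \<open>auto simp: sorted_region_def\<close>)
  then have "x $ p i = y $ p i" for i by (simp add: vec_eq_iff)
  then have "x $ i = y $ i" for i using permutes_inverses(1)[OF p, of i] by metis
  then show "x = y" by (simp add: vec_eq_iff)
qed

lemma image_sorted_region:
  fixes p :: "'n::{finite,linorder} \<Rightarrow> 'n"
  assumes p: "p permutes UNIV"
  shows "symmetrization ` sorted_region p = symmetrization ` sorted_region id"
proof
  show "symmetrization ` sorted_region p \<subseteq> symmetrization ` sorted_region id"
  proof
    fix y assume "y \<in> symmetrization ` sorted_region p"
    then obtain x where "x \<in> sorted_region p" "y = symmetrization x" by auto
    then show "y \<in> symmetrization ` sorted_region id"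
      using permute_sorted_region[OF p] symmetrization_permute[OF p, of x] by (metis imageI)
  qed
  have ip: "inv p permutes UNIV" using p by (rule permutes_inv)
  show "symmetrization ` sorted_region id \<subseteq> symmetrization ` sorted_region p"
  proof
    fix y :: "(complex, 'n) vec" assume "y \<in> symmetrization ` sorted_region id"
    then obtain x where x: "x \<in> sorted_region id" "y = symmetrization x" by auto
    have "(\<chi> i. x $ inv p i) \<in> sorted_region p"
      using x(1) by (auto simp: sorted_region_def polydisc_def permutes_inverses(2)[OF p])
    then show "y \<in> symmetrization ` sorted_region p"
      using symmetrization_permute[OF ip, of x] x(2) by (metis imageI)
  qed
qed

lemma sorted_region_disjoint:
  assumes p: "p permutes UNIV" and q: "q permutes UNIV" and "x \<in> sorted_region p" "x \<in> sorted_region q"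
  shows "p = q"
proof -
  have "range (\<lambda>j. x $ p j) = range (\<lambda>j. x $ j)" if "p permutes UNIV" for p
  proof -
    have "range (\<lambda>j. x $ p j) = (\<lambda>j. x $ j) ` range p" by (simp only: image_image)
    then show ?thesis by (simp only: permutes_surj[OF that])
  qed
  then have "range (\<lambda>j. x $ p j) = range (\<lambda>j. x $ q j)" using p q by simp
  then have "(\<chi> i. x $ p i) = (\<chi> i. x $ q i)"
    by (intro sorted_vec_eq) (use assms in \<open>auto simp: sorted_region_def\<close>)
  then have eq: "x $ p i = x $ q i" for i by (simp add: vec_eq_iff)
  have "p i = q i" for i
  proof -
    define j where "j = inv p (q i)"
    have j: "p j = q i" using permutes_inverses(1)[OF p] by (simp add: j_def)
    have lt: "a < b \<Longrightarrow> Re (x $ p a) < Re (x $ p b)" for a b using assms by (auto simp: sorted_region_def)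
    have "x $ p j = x $ p i" using eq j by simp
    then have "j = i" using lt by (metis linorder_neqE order_less_irrefl)
    then show ?thesis using j by simp
  qed
  then show ?thesis by auto
qed

text \<open>Contains the branch locus, where two coordinates coincide. As a finite union of real
  hyperplanes it is closed and null.\<close>

definition Re_collision :: "(complex, 'n::finite) vec set" where
  "Re_collision = {x. \<exists>i j. i \<noteq> j \<and> Re (x $ i) = Re (x $ j)}"

lemma sorted_region_cover:
  fixes x :: "(complex, 'n::{finite,linorder}) vec"
  assumes x: "x \<in> polydisc" "x \<notin> Re_collision"
  obtains p where "p permutes UNIV" "x \<in> sorted_region p"
proof -
  \<comment> \<open>The rank by real part. Off \<open>Re_collision\<close> it is injective, and the
    sorting permutation is its inverse.\<close>
  define r where "r j = card {k. Re (x $ k) < Re (x $ j)}" for j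
  have rlt: "r i < r j" if "Re (x $ i) < Re (x $ j)" for i j
    unfolding r_def using that by (intro psubset_card_mono) auto
  have neq: "i \<noteq> j \<Longrightarrow> Re (x $ i) \<noteq> Re (x $ j)" for i j using x by (auto simp: Re_collision_def)
  have inj: "inj r" using rlt neq by (metis injI linorder_neqE order_less_irrefl)
  have rn: "r j < CARD('n)" for j
    unfolding r_def by (rule psubset_card_mono) auto
  have surj: "range r = {..<CARD('n)}"
    by (rule card_subset_eq) (auto simp: rn card_image[OF inj])
  define p where "p i = inv r (ordpos i)" for i :: 'n
  have rp: "r (p i) = ordpos i" for i
    using ordpos_less_card[of i] surj by (simp add: p_def f_inv_into_f)
  have "inj p" by (rule injI) (metis ordpos_eq_iff rp)
  then have perm: "p permutes UNIV"
    by (intro bij_imp_permutes) (auto simp: bij_def finite_UNIV_inj_surj)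
  have "Re (x $ p i) < Re (x $ p j)" if "i < j" for i j
  proof (rule ccontr)
    assume "\<not> Re (x $ p i) < Re (x $ p j)"
    moreover have "p i \<noteq> p j" using that \<open>inj p\<close> by (auto dest: injD)
    ultimately have "Re (x $ p j) < Re (x $ p i)" using neq by fastforce
    from rlt[OF this] show False using that by (simp add: rp)
  qed
  then show ?thesis using that perm x by (auto simp: sorted_region_def)
qed

lemma negligible_Re_collision: "negligible (Re_collision :: (complex, 'n::finite) vec set)"
proof -
  have "negligible {x :: (complex, 'n) vec. Re (x $ i) = Re (x $ j)}" if "i \<noteq> j" for i j
  proof -
    define a :: "(complex, 'n) vec" where "a = axis i 1 - axis j 1"
    have "a $ i = 1" using that by (simp add: a_def axis_def)
    then have "a \<noteq> 0" by auto
    then have "negligible {x. a \<bullet> x = 0}" by (intro negligible_hyperplane) auto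
    moreover have "a \<bullet> x = Re (x $ i) - Re (x $ j)" for x
      by (simp add: a_def inner_diff_left inner_axis' inner_complex_def)
    ultimately show ?thesis by simp
  qed
  then have "negligible (\<Union>p\<in>{p \<in> UNIV. fst p \<noteq> snd p}. {x :: (complex, 'n) vec. Re (x $ fst p) = Re (x $ snd p)})"
    by (intro negligible_Union finite_imageI) auto
  also have "(\<Union>p\<in>{p \<in> UNIV. fst p \<noteq> snd p}. {x :: (complex, 'n) vec. Re (x $ fst p) = Re (x $ snd p)}) = Re_collision"
    unfolding Re_collision_def by fastforce
  finally show ?thesis .
qed

lemma closed_Re_collision: "closed (Re_collision :: (complex, 'n::finite) vec set)"
proof -
  have "closed (\<Union>p\<in>{p \<in> UNIV. fst p \<noteq> snd p}. {x :: (complex, 'n) vec. Re (x $ fst p) = Re (x $ snd p)})"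
    by (intro closed_UN ballI closed_Collect_eq continuous_intros) auto
  also have "(\<Union>p\<in>{p \<in> UNIV. fst p \<noteq> snd p}. {x :: (complex, 'n) vec. Re (x $ fst p) = Re (x $ snd p)}) = Re_collision"
    unfolding Re_collision_def by fastforce
  finally show ?thesis .
qed

lemma emeasure_negligible_borel: "negligible S \<Longrightarrow> S \<in> sets borel \<Longrightarrow> emeasure lborel S = 0"
  by (metis emeasure_completion emeasure_eq_0_AE completion.complete2 negligible_iff_null_sets null_setsD1 null_sets_completion_iff sets_lborel)

lemma not_Re_collision_det: "x \<notin> Re_collision \<Longrightarrow> det (vandermonde x) \<noteq> 0"
  by (intro det_vandermonde_nonzero) (metis (mono_tags, lifting) Re_collision_def injI mem_Collect_eq)

lemma dense_not_Re_collision: "closure (- Re_collision) = (UNIV :: (complex, 'n::finite) vec set)"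
proof -
  have "interior (Re_collision :: (complex, 'n) vec set) = {}"
    using open_not_negligible[OF open_interior] negligible_subset[OF negligible_Re_collision interior_subset] by blast
  then show ?thesis by (simp add: closure_complement)
qed

definition num_perms :: "'n::finite itself \<Rightarrow> nat" where
  "num_perms _ = card {p :: 'n \<Rightarrow> 'n. p permutes UNIV}"

lemma num_perms_pos: "num_perms TYPE('n::finite) > 0"
proof -
  have "id \<in> {p :: 'n \<Rightarrow> 'n. p permutes UNIV}" by (simp add: permutes_id)
  then show ?thesis unfolding num_perms_def
    by (metis card_gt_0_iff empty_iff finite finite_permutations)
qed

text \<open>On every cell the map is injective with the same image and Jacobian
  \<open>cmod (det (vandermonde x))\<close> squared, so summing over the cells counts that image
  once per permutation.\<close>

theorem symmetrization_pushforward: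
  fixes B :: "(complex, 'n::{finite,linorder}) vec set"
  assumes B: "B \<in> sets borel"
  shows "ennreal (num_perms TYPE('n)) * emeasure lborel (symmetrized_polydisc \<inter> B) =
    (\<integral>\<^sup>+x. ennreal (indicator (polydisc \<inter> symmetrization -` B) x * (cmod (det (vandermonde x)))\<^sup>2) \<partial>lborel)"
proof -
  let ?G = "symmetrized_polydisc :: (complex, 'n) vec set"
  let ?T = "symmetrization ` sorted_region (id :: 'n \<Rightarrow> 'n)"
  let ?P = "{p :: 'n \<Rightarrow> 'n. p permutes UNIV}"
  let ?w = "\<lambda>x. (cmod (det (vandermonde x)))\<^sup>2"
  have fin: "finite ?P" by (simp add: finite_permutations)
  \<comment> \<open>Invariance of domain for an injective cell; openness supplies the Borel
    measurability of the common image.\<close>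
  have "open ?T"
    by (rule invariance_of_domain[OF continuous_symmetrization open_sorted_region inj_on_sorted_region[OF permutes_id]])
  then have T: "?T \<in> sets borel" by (rule borel_open)
  have cV: "continuous_on S (\<lambda>x. det (vandermonde x))" for S :: "(complex, 'n) vec set"
    unfolding det_def vandermonde_def by (intro continuous_intros)
  have cJ: "continuous_on S (\<lambda>x. det (sym_jacobian x))" for S :: "(complex, 'n) vec set"
    unfolding sym_jacobian_def det_mul det_transpose
  proof (intro continuous_on_mult cV)
    have "continuous_on S (\<lambda>x. jacobian_factor x $ k $ l)" for k l
      by (cases "l \<le> k") (auto simp: jacobian_factor_def intro!: continuous_intros)
    then show "continuous_on S (\<lambda>x. det (jacobian_factor x))"
      unfolding det_def by (intro continuous_on_sum continuous_on_mult continuous_on_const continuous_on_prod)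
  qed
  have one: "emeasure lborel (?T \<inter> B) = (\<integral>\<^sup>+x. ennreal (indicator (sorted_region p \<inter> symmetrization -` B) x * ?w x) \<partial>lborel)"
    if p: "p permutes UNIV" for p
  proof -
    have bij: "bij_betw symmetrization (sorted_region p) ?T"
      using inj_on_sorted_region[OF p] image_sorted_region[OF p] by (auto simp: bij_betw_def)
    show ?thesis
      using emeasure_image_preimage[OF borel_open[OF open_sorted_region] T bij has_derivative_symmetrization cJ B]
      by (simp add: cmod_det_sym_jacobian)
  qed
  have meas: "(\<lambda>x. ennreal (indicator (sorted_region p \<inter> symmetrization -` B) x * ?w x)) \<in> borel_measurable lborel" for p
  proof -
    have [measurable]: "sorted_region p \<inter> symmetrization -` B \<in> sets borel"
      by (rule borel_preimage_on[OF borel_open[OF open_sorted_region] continuous_symmetrization B])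
    have [measurable]: "(\<lambda>x. det (vandermonde x)) \<in> borel_measurable (borel :: (complex, 'n) vec measure)"
      by (rule borel_measurable_continuous_onI[OF cV])
    show ?thesis by measurable
  qed
  have "ennreal (num_perms TYPE('n)) * emeasure lborel (?T \<inter> B) = (\<Sum>p\<in>?P. emeasure lborel (?T \<inter> B))"
    by (simp add: num_perms_def ennreal_of_nat_eq_real_of_nat)
  also have "\<dots> = (\<Sum>p\<in>?P. \<integral>\<^sup>+x. ennreal (indicator (sorted_region p \<inter> symmetrization -` B) x * ?w x) \<partial>lborel)"
    using one by (intro sum.cong) auto
  also have "\<dots> = (\<integral>\<^sup>+x. (\<Sum>p\<in>?P. ennreal (indicator (sorted_region p \<inter> symmetrization -` B) x * ?w x)) \<partial>lborel)"
    using meas by (intro nn_integral_sum[symmetric]) auto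
  also have "\<dots> = (\<integral>\<^sup>+x. ennreal (indicator (polydisc \<inter> symmetrization -` B) x * ?w x) \<partial>lborel)"
  proof (rule nn_integral_cong_AE)
    have "AE x in lborel. x \<notin> (Re_collision :: (complex, 'n) vec set)"
      using emeasure_negligible_borel[OF negligible_Re_collision[where 'n = 'n] borel_closed[OF closed_Re_collision]]
        borel_closed[OF closed_Re_collision[where 'n = 'n]]
      by (intro AE_not_in) (auto simp: null_sets_def)
    then show "AE x in lborel. (\<Sum>p\<in>?P. ennreal (indicator (sorted_region p \<inter> symmetrization -` B) x * ?w x)) =
        ennreal (indicator (polydisc \<inter> symmetrization -` B) x * ?w x)"
    proof (rule AE_mp, intro AE_I2 impI)
      fix x :: "(complex, 'n) vec" assume x: "x \<notin> Re_collision"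
      show "(\<Sum>p\<in>?P. ennreal (indicator (sorted_region p \<inter> symmetrization -` B) x * ?w x)) =
        ennreal (indicator (polydisc \<inter> symmetrization -` B) x * ?w x)"
      proof (cases "x \<in> polydisc")
        case False
        then have "x \<notin> sorted_region p" for p by (auto simp: sorted_region_def)
        then show ?thesis using False by (simp add: indicator_def)
      next
        case True
        then obtain p where p: "p permutes UNIV" "x \<in> sorted_region p" using sorted_region_cover x by blast
        have "(\<Sum>q\<in>?P. ennreal (indicator (sorted_region q \<inter> symmetrization -` B) x * ?w x)) =
          (\<Sum>q\<in>?P. if q = p then ennreal (indicator (symmetrization -` B) x * ?w x) else 0)"
          using p sorted_region_disjoint[OF p(1)] by (intro sum.cong) (auto simp: indicator_def)
        then show ?thesis using True p fin by (simp add: indicator_def)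
      qed
    qed
  qed
  finally have main: "ennreal (num_perms TYPE('n)) * emeasure lborel (?T \<inter> B) =
    (\<integral>\<^sup>+x. ennreal (indicator (polydisc \<inter> symmetrization -` B) x * ?w x) \<partial>lborel)" .
  have TG: "?T \<subseteq> ?G" by (auto simp: symmetrized_polydisc_eq sorted_region_def)
  \<comment> \<open>The domain exceeds the common image of the cells only by images of points of
    \<open>Re_collision\<close>, and a differentiable map sends null sets to null sets.\<close>
  have sub: "?G \<inter> B - ?T \<subseteq> symmetrization ` Re_collision"
  proof
    fix y assume y: "y \<in> ?G \<inter> B - ?T"
    then obtain x where x: "x \<in> polydisc" "y = symmetrization x" by (auto simp: symmetrized_polydisc_eq)
    have "x \<in> Re_collision"
    proof (rule ccontr)
      assume "x \<notin> Re_collision"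
      then obtain p where "p permutes UNIV" "x \<in> sorted_region p" using sorted_region_cover x by blast
      then show False using image_sorted_region[of p] x y by blast
    qed
    then show "y \<in> symmetrization ` Re_collision" using x by blast
  qed
  have "negligible (symmetrization ` (Re_collision :: (complex, 'n) vec set))"
    by (rule negligible_differentiable_image_negligible[OF _ negligible_Re_collision])
      (auto simp: differentiable_on_def differentiable_def intro!: exI has_derivative_at_withinI[OF has_derivative_symmetrization])
  then have "negligible (?G \<inter> B - ?T)" using sub by (rule negligible_subset)
  moreover have GB: "?G \<inter> B \<in> sets borel" using B borel_open[OF open_symmetrized_polydisc] by auto
  ultimately have n0: "emeasure lborel (?G \<inter> B - ?T) = 0"
    using T by (intro emeasure_negligible_borel) auto
  have "emeasure lborel (?G \<inter> B) = emeasure lborel ((?T \<inter> B) \<union> (?G \<inter> B - ?T))"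
    using TG by (intro arg_cong[of _ _ "emeasure lborel"]) auto
  also have "\<dots> = emeasure lborel (?T \<inter> B)"
    using n0 T B GB by (intro emeasure_Un_null_set) (auto simp: null_sets_def)
  finally show ?thesis using main by simp
qed

section \<open>Reduction of antisymmetric kernels to polynomials\<close>

text \<open>The second argument stands for the complex conjugate of the second variable of a kernel.\<close>

inductive poly_kernel :: "((complex, 'n::finite) vec \<Rightarrow> (complex, 'n) vec \<Rightarrow> complex) \<Rightarrow> bool" where
  const: "poly_kernel (\<lambda>\<xi> \<tau>. c)"
| fst: "poly_kernel (\<lambda>\<xi> \<tau>. \<xi> $ i)"
| snd: "poly_kernel (\<lambda>\<xi> \<tau>. \<tau> $ i)"
| add: "poly_kernel H \<Longrightarrow> poly_kernel H' \<Longrightarrow> poly_kernel (\<lambda>\<xi> \<tau>. H \<xi> \<tau> + H' \<xi> \<tau>)"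
| mult: "poly_kernel H \<Longrightarrow> poly_kernel H' \<Longrightarrow> poly_kernel (\<lambda>\<xi> \<tau>. H \<xi> \<tau> * H' \<xi> \<tau>)"

lemma poly_kernel_sum: "(\<And>i. i \<in> I \<Longrightarrow> poly_kernel (H i)) \<Longrightarrow> poly_kernel (\<lambda>\<xi> \<tau>. \<Sum>i\<in>I. H i \<xi> \<tau>)"
  by (induction I rule: infinite_finite_induct) (auto intro: poly_kernel.intros)

lemma poly_kernel_prod: "(\<And>i. i \<in> I \<Longrightarrow> poly_kernel (H i)) \<Longrightarrow> poly_kernel (\<lambda>\<xi> \<tau>. \<Prod>i\<in>I. H i \<xi> \<tau>)"
  by (induction I rule: infinite_finite_induct) (auto intro: poly_kernel.intros)

lemma poly_kernel_swap: "poly_kernel H \<Longrightarrow> poly_kernel (\<lambda>\<xi> \<tau>. H \<tau> \<xi>)"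
  by (induction rule: poly_kernel.induct) (auto intro: poly_kernel.intros)

lemma poly_kernel_det:
  "(\<And>k l. poly_kernel (\<lambda>\<xi> \<tau>. A k l \<xi> \<tau>)) \<Longrightarrow> poly_kernel (\<lambda>\<xi> \<tau>. det (\<chi> k l. A k l \<xi> \<tau>))"
  unfolding det_def by (auto intro!: poly_kernel_sum poly_kernel.mult poly_kernel_prod poly_kernel.const)

lemma poly_kernel_continuous:
  assumes "poly_kernel H" "continuous_on S f" "continuous_on S g"
  shows "continuous_on S (\<lambda>x. H (f x) (g x))"
  using assms by (induction rule: poly_kernel.induct) (auto intro!: continuous_intros)

text \<open>The partial derivatives are again polynomial kernels, so that mixed second derivatives
  can be formed.\<close>

lemma poly_kernel_has_derivative:
  fixes H :: "(complex, 'n::finite) vec \<Rightarrow> (complex, 'n) vec \<Rightarrow> complex"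
  assumes "poly_kernel H"
  shows "\<exists>H1 H2. (\<forall>i. poly_kernel (H1 i)) \<and> (\<forall>i. poly_kernel (H2 i)) \<and>
    (\<forall>\<xi> \<tau>. ((\<lambda>p. H (fst p) (snd p)) has_derivative
       (\<lambda>h. (\<Sum>i\<in>UNIV. H1 i \<xi> \<tau> * fst h $ i) + (\<Sum>i\<in>UNIV. H2 i \<xi> \<tau> * snd h $ i))) (at (\<xi>, \<tau>)))"
  using assms
proof (induction rule: poly_kernel.induct)
  case (const c)
  show ?case
    by (rule exI[of _ "\<lambda>_ _ _. 0"], rule exI[of _ "\<lambda>_ _ _. 0"]) (auto intro: poly_kernel.const)
next
  case (fst i)
  have "bounded_linear (\<lambda>p :: (complex, 'n) vec \<times> (complex, 'n) vec. fst p $ i)"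
    by (rule bounded_linear_compose[OF bounded_linear_vec_nth bounded_linear_fst])
  from bounded_linear_imp_has_derivative[OF this]
  show ?case
    by (intro exI[of _ "\<lambda>j _ _. if j = i then 1 else 0"] exI[of _ "\<lambda>_ _ _. 0"])
      (auto intro: poly_kernel.const simp: if_distrib[of "\<lambda>x. x * _"] cong: if_cong)
next
  case (snd i)
  have "bounded_linear (\<lambda>p :: (complex, 'n) vec \<times> (complex, 'n) vec. snd p $ i)"
    by (rule bounded_linear_compose[OF bounded_linear_vec_nth bounded_linear_snd])
  from bounded_linear_imp_has_derivative[OF this]
  show ?case
    by (intro exI[of _ "\<lambda>_ _ _. 0"] exI[of _ "\<lambda>j _ _. if j = i then 1 else 0"])
      (auto intro: poly_kernel.const simp: if_distrib[of "\<lambda>x. x * _"] cong: if_cong)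
next
  case (add H H')
  obtain H1 H2 where 1: "\<forall>i. poly_kernel (H1 i)" "\<forall>i. poly_kernel (H2 i)"
    "\<And>\<xi> \<tau>. ((\<lambda>p. H (fst p) (snd p)) has_derivative
       (\<lambda>h. (\<Sum>i\<in>UNIV. H1 i \<xi> \<tau> * fst h $ i) + (\<Sum>i\<in>UNIV. H2 i \<xi> \<tau> * snd h $ i))) (at (\<xi>, \<tau>))"
    using add.IH(1) by blast
  obtain H1' H2' where 2: "\<forall>i. poly_kernel (H1' i)" "\<forall>i. poly_kernel (H2' i)"
    "\<And>\<xi> \<tau>. ((\<lambda>p. H' (fst p) (snd p)) has_derivative
       (\<lambda>h. (\<Sum>i\<in>UNIV. H1' i \<xi> \<tau> * fst h $ i) + (\<Sum>i\<in>UNIV. H2' i \<xi> \<tau> * snd h $ i))) (at (\<xi>, \<tau>))"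
    using add.IH(2) by blast
  show ?case
  proof (rule exI[of _ "\<lambda>i \<xi> \<tau>. H1 i \<xi> \<tau> + H1' i \<xi> \<tau>"], rule exI[of _ "\<lambda>i \<xi> \<tau>. H2 i \<xi> \<tau> + H2' i \<xi> \<tau>"], intro conjI allI)
    fix \<xi> \<tau>
    show "((\<lambda>p. H (fst p) (snd p) + H' (fst p) (snd p)) has_derivative
       (\<lambda>h. (\<Sum>i\<in>UNIV. (H1 i \<xi> \<tau> + H1' i \<xi> \<tau>) * fst h $ i) + (\<Sum>i\<in>UNIV. (H2 i \<xi> \<tau> + H2' i \<xi> \<tau>) * snd h $ i))) (at (\<xi>, \<tau>))"
      by (rule has_derivative_eq_rhs[OF has_derivative_add[OF 1(3) 2(3)]])
        (simp add: fun_eq_iff sum.distrib algebra_simps)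
  qed (use 1 2 in \<open>auto intro: poly_kernel.intros\<close>)
next
  case (mult H H')
  obtain H1 H2 where 1: "\<forall>i. poly_kernel (H1 i)" "\<forall>i. poly_kernel (H2 i)"
    "\<And>\<xi> \<tau>. ((\<lambda>p. H (fst p) (snd p)) has_derivative
       (\<lambda>h. (\<Sum>i\<in>UNIV. H1 i \<xi> \<tau> * fst h $ i) + (\<Sum>i\<in>UNIV. H2 i \<xi> \<tau> * snd h $ i))) (at (\<xi>, \<tau>))"
    using mult.IH(1) by blast
  obtain H1' H2' where 2: "\<forall>i. poly_kernel (H1' i)" "\<forall>i. poly_kernel (H2' i)"
    "\<And>\<xi> \<tau>. ((\<lambda>p. H' (fst p) (snd p)) has_derivative
       (\<lambda>h. (\<Sum>i\<in>UNIV. H1' i \<xi> \<tau> * fst h $ i) + (\<Sum>i\<in>UNIV. H2' i \<xi> \<tau> * snd h $ i))) (at (\<xi>, \<tau>))"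
    using mult.IH(2) by blast
  show ?case
  proof (rule exI[of _ "\<lambda>i \<xi> \<tau>. H1 i \<xi> \<tau> * H' \<xi> \<tau> + H \<xi> \<tau> * H1' i \<xi> \<tau>"],
      rule exI[of _ "\<lambda>i \<xi> \<tau>. H2 i \<xi> \<tau> * H' \<xi> \<tau> + H \<xi> \<tau> * H2' i \<xi> \<tau>"], intro conjI allI)
    fix \<xi> \<tau>
    show "((\<lambda>p. H (fst p) (snd p) * H' (fst p) (snd p)) has_derivative
       (\<lambda>h. (\<Sum>i\<in>UNIV. (H1 i \<xi> \<tau> * H' \<xi> \<tau> + H \<xi> \<tau> * H1' i \<xi> \<tau>) * fst h $ i) +
            (\<Sum>i\<in>UNIV. (H2 i \<xi> \<tau> * H' \<xi> \<tau> + H \<xi> \<tau> * H2' i \<xi> \<tau>) * snd h $ i))) (at (\<xi>, \<tau>))"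
      by (rule has_derivative_eq_rhs[OF has_derivative_mult[OF 1(3) 2(3)]])
        (simp add: fun_eq_iff sum.distrib sum_distrib_left sum_distrib_right algebra_simps)
  qed (intro poly_kernel.add poly_kernel.mult 1(1)[rule_format] 1(2)[rule_format] 2(1)[rule_format] 2(2)[rule_format] mult.hyps)+
qed

lemma poly_kernel_ecoef: "poly_kernel (\<lambda>\<xi> \<tau>. ecoef \<xi> r)"
  unfolding ecoef_def by (cases "r = 0") (auto intro: poly_kernel.intros poly_kernel_sum)

section \<open>Reduction of powers modulo the characteristic polynomial\<close>

text \<open>\<open>s\<close> is the remainder of \<open>t ^ m\<close> modulo the monic polynomial
  whose roots are the \<open>x $ j\<close>. Its coefficients depend polynomially on the symmetric
  functions and are the same for all roots.\<close>

definition reduces_power :: "nat \<Rightarrow> ('n \<Rightarrow> (complex, 'n::{finite,linorder}) vec \<Rightarrow> complex) \<Rightarrow> bool" where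
  "reduces_power m s \<longleftrightarrow> (\<forall>l. poly_kernel (\<lambda>\<xi> \<tau>. s l \<xi>)) \<and>
     (\<forall>x j. x $ j ^ m = (\<Sum>l\<in>UNIV. s l (symmetrization x) * x $ j ^ ordpos l))"

text \<open>Every root satisfies a monic equation of degree \<open>CARD('n)\<close>, which trades a
  high power for lower ones.\<close>

lemma ex_reduces_power: "\<exists>s :: 'n \<Rightarrow> (complex, 'n::{finite,linorder}) vec \<Rightarrow> complex. reduces_power m s"
proof (induction m rule: less_induct)
  case (less m)
  let ?n = "CARD('n)"
  show ?case
  proof (cases "m < ?n")
    case True
    then obtain l :: 'n where l: "m = ordpos l" using bij_ordpos[where 'n = 'n] by (auto simp: bij_betw_def)
    show ?thesis
      by (rule exI[of _ "\<lambda>l' _. if l' = l then 1 else 0"])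
        (auto simp: reduces_power_def l if_distrib[of "\<lambda>x. x * _"] intro: poly_kernel.const cong: if_cong)
  next
    case False
    obtain S :: "nat \<Rightarrow> 'n \<Rightarrow> (complex, 'n) vec \<Rightarrow> complex" where S: "\<And>m'. m' < m \<Longrightarrow> reduces_power m' (S m')"
      using less.IH by metis
    have lt: "m - r < m" if "r \<in> {1..?n}" for r using that False zero_less_card_finite[where 'a = 'n] by auto
    define s where "s l \<xi> = (\<Sum>r\<in>{1..?n}. (- 1) * (- 1) ^ r * ecoef \<xi> r * S (m - r) l \<xi>)" for l \<xi>
    have "poly_kernel (\<lambda>\<xi> \<tau>. s l \<xi>)" for l
      unfolding s_def using S[OF lt]
      by (intro poly_kernel_sum poly_kernel.mult poly_kernel.const poly_kernel_ecoef) (auto simp: reduces_power_def)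
    moreover have "x $ j ^ m = (\<Sum>l\<in>UNIV. s l (symmetrization x) * x $ j ^ ordpos l)" for x :: "(complex, 'n) vec" and j
    proof -
      let ?\<xi> = "symmetrization x" and ?t = "x $ j"
      have "0 = ?t ^ (m - ?n) * char_fun ?\<xi> 1 ?t" by (simp add: char_fun_root)
      also have "\<dots> = (\<Sum>r\<in>{0..?n}. (- 1) ^ r * ecoef ?\<xi> r * ?t ^ (m - r))"
        unfolding char_fun_def sum_distrib_left atMost_atLeast0
      proof (rule sum.cong[OF refl])
        fix r assume "r \<in> {0..?n}"
        then have "m - r = (m - ?n) + (?n - r)" using False by auto
        then show "?t ^ (m - ?n) * ((- 1) ^ r * ecoef ?\<xi> r * ?t ^ (?n - r)) = (- 1) ^ r * ecoef ?\<xi> r * ?t ^ (m - r)"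
          by (simp add: power_add)
      qed
      also have "\<dots> = ?t ^ m + (\<Sum>r\<in>{1..?n}. (- 1) ^ r * ecoef ?\<xi> r * ?t ^ (m - r))"
        by (subst sum.atLeast_Suc_atMost) (auto simp: ecoef_def)
      finally have "?t ^ m = - (\<Sum>r\<in>{1..?n}. (- 1) ^ r * ecoef ?\<xi> r * ?t ^ (m - r))"
        by (simp add: eq_neg_iff_add_eq_0)
      also have "\<dots> = (\<Sum>r\<in>{1..?n}. \<Sum>l\<in>UNIV. (- 1) * (- 1) ^ r * ecoef ?\<xi> r * S (m - r) l ?\<xi> * ?t ^ ordpos l)"
        unfolding sum_negf[symmetric]
      proof (rule sum.cong[OF refl])
        fix r assume r: "r \<in> {1..?n}"
        have "?t ^ (m - r) = (\<Sum>l\<in>UNIV. S (m - r) l ?\<xi> * ?t ^ ordpos l)" using S[OF lt[OF r]] by (simp add: reduces_power_def)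
        then show "- ((- 1) ^ r * ecoef ?\<xi> r * ?t ^ (m - r)) = (\<Sum>l\<in>UNIV. (- 1) * (- 1) ^ r * ecoef ?\<xi> r * S (m - r) l ?\<xi> * ?t ^ ordpos l)"
          by (simp add: sum_distrib_left sum_negf mult.assoc)
      qed
      also have "\<dots> = (\<Sum>l\<in>UNIV. s l ?\<xi> * ?t ^ ordpos l)"
        by (subst sum.swap) (simp only: s_def sum_distrib_right)
      finally show ?thesis .
    qed
    ultimately show ?thesis unfolding reduces_power_def by blast
  qed
qed

definition power_red :: "nat \<Rightarrow> 'n \<Rightarrow> (complex, 'n::{finite,linorder}) vec \<Rightarrow> complex" where
  "power_red m = (SOME s. reduces_power m s)"

lemma power_red: "reduces_power m (power_red m)"
  unfolding power_red_def by (rule someI_ex[OF ex_reduces_power])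

lemma poly_kernel_power_red: "poly_kernel (\<lambda>\<xi> \<tau>. power_red m l \<xi>)" "poly_kernel (\<lambda>\<xi> \<tau>. power_red m l \<tau>)"
  using power_red[of m] poly_kernel_swap[of "\<lambda>\<xi> \<tau>. power_red m l \<xi>"] by (auto simp: reduces_power_def)

lemma power_red_eq: "x $ j ^ m = (\<Sum>l\<in>UNIV. power_red m l (symmetrization x) * x $ j ^ ordpos l)"
  by (rule power_red[unfolded reduces_power_def, THEN conjunct2, rule_format])

text \<open>Dividing \<open>char_fun \<xi> b 1\<close> by \<open>1 - t b\<close> modulo \<open>char_fun \<xi> 1 t\<close>.\<close>

definition geom_quot :: "(complex, 'n::{finite,linorder}) vec \<Rightarrow> complex \<Rightarrow> complex \<Rightarrow> complex" where
  "geom_quot \<xi> t b = (\<Sum>m<CARD('n). b ^ m * (\<Sum>r\<le>m. (- 1) ^ r * ecoef \<xi> r * t ^ (m - r)))"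

lemma geom_quot:
  fixes \<xi> :: "(complex, 'n::{finite,linorder}) vec"
  assumes "char_fun \<xi> 1 t = 0"
  shows "(1 - t * b) * geom_quot \<xi> t b = char_fun \<xi> b 1"
proof -
  \<comment> \<open>The partial values of Horner's scheme at \<open>t\<close>. The sum telescopes up
    to \<open>h CARD('n)\<close>, which is \<open>char_fun \<xi> 1 t\<close> and vanishes at a
    root.\<close>
  define h where "h m = (\<Sum>r\<le>m. (- 1) ^ r * ecoef \<xi> r * t ^ (m - r))" for m
  have hS: "h (Suc m) = t * h m + (- 1) ^ Suc m * ecoef \<xi> (Suc m)" for m
    unfolding h_def by (simp add: sum_distrib_left Suc_diff_le mult_ac)
  have "(1 - t * b) * (\<Sum>m<M. b ^ m * h m) = (\<Sum>r<M. (- b) ^ r * ecoef \<xi> r) - b ^ M * (h M - (- 1) ^ M * ecoef \<xi> M)" for M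
  proof (induction M)
    case 0 show ?case by (simp add: h_def)
  next
    case (Suc M)
    have e1: "h (Suc M) - (- 1) ^ Suc M * ecoef \<xi> (Suc M) = t * h M" by (simp add: hS)
    have e2: "(- b) ^ M = b ^ M * (- 1) ^ M" by (simp add: power_minus[of b] mult.commute)
    have "(1 - t * b) * (\<Sum>m<Suc M. b ^ m * h m) =
        ((\<Sum>r<M. (- b) ^ r * ecoef \<xi> r) - b ^ M * (h M - (- 1) ^ M * ecoef \<xi> M)) + (1 - t * b) * (b ^ M * h M)"
      by (simp only: sum.lessThan_Suc distrib_left Suc.IH)
    also have "\<dots> = (\<Sum>r<M. (- b) ^ r * ecoef \<xi> r) + (b ^ M * (- 1) ^ M) * ecoef \<xi> M - b ^ Suc M * (t * h M)"
      by (simp add: algebra_simps)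
    finally show ?case unfolding e1 e2[symmetric] by simp
  qed
  from this[of "CARD('n)"] have "(1 - t * b) * geom_quot \<xi> t b =
      (\<Sum>r<CARD('n). (- b) ^ r * ecoef \<xi> r) - b ^ CARD('n) * (h CARD('n) - (- 1) ^ CARD('n) * ecoef \<xi> CARD('n))"
    by (simp add: geom_quot_def h_def)
  moreover have "h CARD('n) = 0" using assms by (simp add: h_def char_fun_def)
  moreover have "b ^ CARD('n) * (- 1) ^ CARD('n) = (- b) ^ CARD('n)" by (simp add: power_minus[of b] mult.commute)
  ultimately show ?thesis by (simp add: char_fun_def lessThan_Suc_atMost[symmetric] mult.assoc[symmetric])
qed

section \<open>Denominator and numerator as determinants of polynomial kernels\<close>

text \<open>A resultant: the determinant of multiplication by \<open>char_fun \<xi> b 1\<close>, as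
  a polynomial in \<open>b\<close>, modulo the monic polynomial whose coefficients come from
  \<open>\<tau>\<close>. It equals the product of all \<open>1 - x $ j * y $ i\<close>, here written
  polynomially in the symmetric coordinates of both points.\<close>

definition denom_kernel :: "(complex, 'n::{finite,linorder}) vec \<Rightarrow> (complex, 'n) vec \<Rightarrow> complex" where
  "denom_kernel \<xi> \<tau> = det (\<chi> l k. \<Sum>r\<le>CARD('n). (- 1) ^ r * ecoef \<xi> r * power_red (r + ordpos l) k \<tau>)"

lemma poly_kernel_denom: "poly_kernel denom_kernel"
proof -
  have "poly_kernel (\<lambda>\<xi> \<tau>. denom_kernel \<xi> \<tau>)" unfolding denom_kernel_def
    by (intro poly_kernel_det poly_kernel_sum poly_kernel.mult poly_kernel.const poly_kernel_ecoef poly_kernel_power_red)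
  then show ?thesis by simp
qed

lemma continuous_vandermonde: "continuous_on S (\<lambda>x. det (vandermonde x))"
  unfolding det_def vandermonde_def by (intro continuous_intros)

text \<open>Evaluation at the roots \<open>y $ i\<close> diagonalizes the multiplication, with the
  Vandermonde matrix as change of basis. Where that matrix is invertible it cancels; the remaining
  \<open>y\<close> follow by density and continuity.\<close>

lemma denom_kernel_eq:
  fixes \<xi> y :: "(complex, 'n::{finite,linorder}) vec"
  shows "denom_kernel \<xi> (symmetrization y) = (\<Prod>i\<in>UNIV. char_fun \<xi> (y $ i) 1)"
proof -
  have main: "(\<Prod>i\<in>UNIV. char_fun \<xi> (y $ i) 1) * det (vandermonde y) = det (vandermonde y) * denom_kernel \<xi> (symmetrization y)"
    for y :: "(complex, 'n) vec"
  proof -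
    let ?R = "\<chi> l k. \<Sum>r\<le>CARD('n). (- 1) ^ r * ecoef \<xi> r * power_red (r + ordpos l) k (symmetrization y)"
    have "(\<chi> i. char_fun \<xi> (y $ i) 1 *s vandermonde y $ i) = vandermonde y ** transpose ?R"
    proof -
      have "char_fun \<xi> (y $ i) 1 * y $ i ^ ordpos l = (\<Sum>k\<in>UNIV. y $ i ^ ordpos k * ?R $ l $ k)" for i l
      proof -
        have "char_fun \<xi> (y $ i) 1 * y $ i ^ ordpos l = (\<Sum>r\<le>CARD('n). (- 1) ^ r * ecoef \<xi> r * y $ i ^ (r + ordpos l))"
          unfolding char_fun_def sum_distrib_right
          by (intro sum.cong refl) (simp add: power_minus[of "y $ i"] power_add)
        also have "\<dots> = (\<Sum>r\<le>CARD('n). \<Sum>k\<in>UNIV. (- 1) ^ r * ecoef \<xi> r * (power_red (r + ordpos l) k (symmetrization y) * y $ i ^ ordpos k))"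
          by (simp only: power_red_eq[of y i "_ + _"] sum_distrib_left)
        also have "\<dots> = (\<Sum>k\<in>UNIV. y $ i ^ ordpos k * ?R $ l $ k)"
          by (subst sum.swap) (auto intro!: sum.cong simp: sum_distrib_left mult_ac)
        finally show ?thesis .
      qed
      then show ?thesis by (simp add: vec_eq_iff matrix_matrix_mult_def vandermonde_def transpose_def) blast
    qed
    then have "det (\<chi> i. char_fun \<xi> (y $ i) 1 *s vandermonde y $ i) = det (vandermonde y ** transpose ?R)" by simp
    then show ?thesis by (simp add: det_rows_mul det_mul denom_kernel_def)
  qed
  let ?E = "{y. denom_kernel \<xi> (symmetrization y) = (\<Prod>i\<in>UNIV. char_fun \<xi> (y $ i) 1)}"
  have "closed ?E"
    unfolding char_fun_def
    by (intro closed_Collect_eq poly_kernel_continuous[OF poly_kernel_denom] continuous_symmetrization continuous_intros)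
  moreover have "- Re_collision \<subseteq> ?E"
  proof
    fix y :: "(complex, 'n) vec" assume "y \<in> - Re_collision"
    then have "det (vandermonde y) \<noteq> 0" by (intro not_Re_collision_det) simp
    then show "y \<in> ?E" using main[of y] by (simp add: mult.commute)
  qed
  ultimately have "closure (- Re_collision) \<subseteq> ?E" by (intro closure_minimal)
  then show ?thesis by (auto simp: dense_not_Re_collision)
qed

text \<open>Flattens the double sum of \<open>geom_quot\<close>, so that its square becomes a sum
  over two such indices.\<close>

definition quot_index :: "nat \<Rightarrow> (nat \<times> nat) set" where
  "quot_index n = Sigma {..<n} (\<lambda>m. {..m})"

definition quot_coef :: "(complex, 'n::{finite,linorder}) vec \<Rightarrow> nat \<times> nat \<Rightarrow> complex" where
  "quot_coef \<xi> p = (- 1) ^ snd p * ecoef \<xi> (snd p)"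

lemma geom_quot_eq:
  "geom_quot (\<xi> :: (complex, 'n::{finite,linorder}) vec) t b =
    (\<Sum>p\<in>quot_index CARD('n). quot_coef \<xi> p * t ^ (fst p - snd p) * b ^ fst p)"
  by (simp add: geom_quot_def quot_index_def quot_coef_def sum.Sigma[symmetric] sum_distrib_left mult_ac sum.Sigma split_def)

text \<open>The coefficient at powers number \<open>k\<close> of \<open>t\<close> and
  \<open>l\<close> of \<open>b\<close> in the square of \<open>geom_quot \<xi> t b\<close>, reduced
  modulo the polynomial of \<open>\<xi>\<close> in \<open>t\<close> and that of
  \<open>\<tau>\<close> in \<open>b\<close>.\<close>

definition numer_entry :: "(complex, 'n::{finite,linorder}) vec \<Rightarrow> (complex, 'n) vec \<Rightarrow> 'n \<Rightarrow> 'n \<Rightarrow> complex" where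
  "numer_entry \<xi> \<tau> k l = (\<Sum>p\<in>quot_index CARD('n). \<Sum>q\<in>quot_index CARD('n).
     quot_coef \<xi> p * quot_coef \<xi> q * power_red ((fst p - snd p) + (fst q - snd q)) k \<xi> * power_red (fst p + fst q) l \<tau>)"

definition numer_kernel :: "(complex, 'n::{finite,linorder}) vec \<Rightarrow> (complex, 'n) vec \<Rightarrow> complex" where
  "numer_kernel \<xi> \<tau> = det (\<chi> k l. numer_entry \<xi> \<tau> k l)"

lemma poly_kernel_numer: "poly_kernel numer_kernel"
proof -
  have "poly_kernel (\<lambda>\<xi> \<tau>. numer_kernel \<xi> \<tau>)" unfolding numer_kernel_def numer_entry_def quot_coef_def
    by (intro poly_kernel_det poly_kernel_sum poly_kernel.mult poly_kernel.const poly_kernel_ecoef poly_kernel_power_red)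
  then show ?thesis by simp
qed

lemma sum_swap4:
  "(\<Sum>p\<in>A. \<Sum>q\<in>B. \<Sum>k\<in>C. \<Sum>l\<in>D. T p q k l) = (\<Sum>k\<in>C. \<Sum>l\<in>D. \<Sum>p\<in>A. \<Sum>q\<in>B. T p q k l)"
proof -
  have "(\<Sum>p\<in>A. \<Sum>q\<in>B. \<Sum>k\<in>C. \<Sum>l\<in>D. T p q k l) = (\<Sum>p\<in>A. \<Sum>k\<in>C. \<Sum>q\<in>B. \<Sum>l\<in>D. T p q k l)"
    by (intro sum.cong refl sum.swap)
  also have "\<dots> = (\<Sum>k\<in>C. \<Sum>p\<in>A. \<Sum>q\<in>B. \<Sum>l\<in>D. T p q k l)" by (rule sum.swap)
  also have "\<dots> = (\<Sum>k\<in>C. \<Sum>p\<in>A. \<Sum>l\<in>D. \<Sum>q\<in>B. T p q k l)" by (intro sum.cong refl sum.swap)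
  also have "\<dots> = (\<Sum>k\<in>C. \<Sum>l\<in>D. \<Sum>p\<in>A. \<Sum>q\<in>B. T p q k l)" by (intro sum.cong refl sum.swap)
  finally show ?thesis .
qed

lemma geom_quot_square:
  "(geom_quot (symmetrization x) (x $ j) (y $ i))\<^sup>2 =
     (\<Sum>k\<in>UNIV. \<Sum>l\<in>UNIV. x $ j ^ ordpos k * numer_entry (symmetrization x) (symmetrization y) k l * y $ i ^ ordpos l)"
  for x y :: "(complex, 'n::{finite,linorder}) vec"
proof -
  let ?I = "quot_index CARD('n)" and ?\<xi> = "symmetrization x" and ?\<tau> = "symmetrization y"
  have "(geom_quot ?\<xi> (x $ j) (y $ i))\<^sup>2 =
    (\<Sum>p\<in>?I. \<Sum>q\<in>?I. quot_coef ?\<xi> p * quot_coef ?\<xi> q * x $ j ^ ((fst p - snd p) + (fst q - snd q)) * y $ i ^ (fst p + fst q))"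
    unfolding geom_quot_eq power2_eq_square sum_product by (intro sum.cong refl) (simp add: power_add)
  also have "\<dots> = (\<Sum>p\<in>?I. \<Sum>q\<in>?I. \<Sum>k\<in>UNIV. \<Sum>l\<in>UNIV. x $ j ^ ordpos k * (quot_coef ?\<xi> p * quot_coef ?\<xi> q *
      power_red ((fst p - snd p) + (fst q - snd q)) k ?\<xi> * power_red (fst p + fst q) l ?\<tau>) * y $ i ^ ordpos l)"
  proof (intro sum.cong refl)
    fix p q :: "nat \<times> nat"
    let ?a = "(fst p - snd p) + (fst q - snd q)" and ?b = "fst p + fst q"
    have "x $ j ^ ?a * y $ i ^ ?b = (\<Sum>k\<in>UNIV. \<Sum>l\<in>UNIV. (power_red ?a k ?\<xi> * x $ j ^ ordpos k) * (power_red ?b l ?\<tau> * y $ i ^ ordpos l))"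
      unfolding power_red_eq[of x j ?a] power_red_eq[of y i ?b] by (rule sum_product)
    then have "quot_coef ?\<xi> p * quot_coef ?\<xi> q * (x $ j ^ ?a * y $ i ^ ?b) = (\<Sum>k\<in>UNIV. \<Sum>l\<in>UNIV. quot_coef ?\<xi> p * quot_coef ?\<xi> q * ((power_red ?a k ?\<xi> * x $ j ^ ordpos k) * (power_red ?b l ?\<tau> * y $ i ^ ordpos l)))"
      by (simp only: sum_distrib_left)
    then show "quot_coef ?\<xi> p * quot_coef ?\<xi> q * x $ j ^ ?a * y $ i ^ ?b = (\<Sum>k\<in>UNIV. \<Sum>l\<in>UNIV. x $ j ^ ordpos k * (quot_coef ?\<xi> p * quot_coef ?\<xi> q *
      power_red ?a k ?\<xi> * power_red ?b l ?\<tau>) * y $ i ^ ordpos l)"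
      by (simp only: mult_ac)
  qed
  also have "\<dots> = (\<Sum>k\<in>UNIV. \<Sum>l\<in>UNIV. \<Sum>p\<in>?I. \<Sum>q\<in>?I. x $ j ^ ordpos k * (quot_coef ?\<xi> p * quot_coef ?\<xi> q *
      power_red ((fst p - snd p) + (fst q - snd q)) k ?\<xi> * power_red (fst p + fst q) l ?\<tau>) * y $ i ^ ordpos l)"
    by (rule sum_swap4)
  also have "\<dots> = (\<Sum>k\<in>UNIV. \<Sum>l\<in>UNIV. x $ j ^ ordpos k * numer_entry ?\<xi> ?\<tau> k l * y $ i ^ ordpos l)"
    by (simp only: numer_entry_def sum_distrib_left sum_distrib_right)
  finally show ?thesis .
qed

text \<open>At the roots, \<open>geom_quot\<close> equals \<open>char_fun\<close> at
  \<open>y $ j\<close> over \<open>1 - x $ i * y $ j\<close>. The matrix of squares therefore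
  factors as Vandermonde, \<open>numer_entry\<close>, transposed Vandermonde, and is also the matrix
  on the left with column \<open>j\<close> scaled; the scaling factors multiply to the square of
  \<open>denom_kernel\<close>.\<close>

theorem det_square_kernel:
  fixes x y :: "(complex, 'n::{finite,linorder}) vec"
  assumes nz: "\<And>i j. 1 - x $ i * y $ j \<noteq> 0"
  shows "det (\<chi> i j. 1 / (1 - x $ i * y $ j)\<^sup>2) * (denom_kernel (symmetrization x) (symmetrization y))\<^sup>2 =
    det (vandermonde x) * numer_kernel (symmetrization x) (symmetrization y) * det (vandermonde y)"
proof -
  let ?\<xi> = "symmetrization x" and ?\<tau> = "symmetrization y"
  let ?q = "\<lambda>i j. geom_quot ?\<xi> (x $ i) (y $ j)"
  have q: "?q i j = char_fun ?\<xi> (y $ j) 1 / (1 - x $ i * y $ j)" for i j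
    using geom_quot[OF char_fun_root, of x i "y $ j"] nz[of i j] by (simp add: field_simps)
  have "(\<chi> i j. (?q i j)\<^sup>2) = vandermonde x ** (\<chi> k l. numer_entry ?\<xi> ?\<tau> k l) ** transpose (vandermonde y)"
  proof -
    have "(\<Sum>k\<in>UNIV. \<Sum>l\<in>UNIV. x $ i ^ ordpos k * numer_entry ?\<xi> ?\<tau> k l * y $ j ^ ordpos l) =
       (\<Sum>l\<in>UNIV. (\<Sum>k\<in>UNIV. x $ i ^ ordpos k * numer_entry ?\<xi> ?\<tau> k l) * y $ j ^ ordpos l)" for i j
      unfolding sum_distrib_right by (rule sum.swap)
    then show ?thesis
      by (simp add: vec_eq_iff matrix_matrix_mult_def vandermonde_def transpose_def geom_quot_square)
  qed
  then have "det (\<chi> i j. (?q i j)\<^sup>2) = det (vandermonde x) * numer_kernel ?\<xi> ?\<tau> * det (vandermonde y)"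
    by (simp add: det_mul numer_kernel_def)
  also have "det (\<chi> i j. (?q i j)\<^sup>2) = det (transpose (\<chi> i j. (?q i j)\<^sup>2))" by simp
  also have "transpose (\<chi> i j. (?q i j)\<^sup>2) = (\<chi> j. (char_fun ?\<xi> (y $ j) 1)\<^sup>2 *s (transpose (\<chi> i j. 1 / (1 - x $ i * y $ j)\<^sup>2)) $ j)"
    by (simp add: vec_eq_iff transpose_def q power_divide)
  also have "det \<dots> = (\<Prod>j\<in>UNIV. (char_fun ?\<xi> (y $ j) 1)\<^sup>2) * det (\<chi> i j. 1 / (1 - x $ i * y $ j)\<^sup>2)"
    by (subst det_rows_mul) simp
  also have "(\<Prod>j\<in>UNIV. (char_fun ?\<xi> (y $ j) 1)\<^sup>2) = (denom_kernel ?\<xi> ?\<tau>)\<^sup>2"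
    by (simp add: denom_kernel_eq prod_power_distrib)
  finally show ?thesis by (simp add: mult.commute)
qed

section \<open>The Bergman kernel of the symmetrized polydisc\<close>

definition cnjv :: "(complex, 'n::finite) vec \<Rightarrow> (complex, 'n) vec" where
  "cnjv x = (\<chi> i. cnj (x $ i))"

lemma cnjv_nth [simp]: "cnjv x $ i = cnj (x $ i)"
  by (simp add: cnjv_def)

lemma symmetrization_cnjv: "symmetrization (cnjv x) = cnjv (symmetrization x)"
  by (simp add: vec_eq_iff symmetrization_def elem_sym_def)

lemma continuous_cnjv [continuous_intros]: "continuous_on S f \<Longrightarrow> continuous_on S (\<lambda>x. cnjv (f x))"
  unfolding cnjv_def by (intro continuous_intros)

lemma symmetrized_polydisc_measurable [measurable]:
  "(symmetrized_polydisc :: (complex, 'n::{finite,linorder}) vec set) \<in> sets borel"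
  by (rule borel_open[OF open_symmetrized_polydisc])

lemma emeasure_symmetrized_polydisc: "emeasure lborel (symmetrized_polydisc :: (complex, 'n::{finite,linorder}) vec set) < \<infinity>"
  by (rule emeasure_bounded_finite[OF bounded_symmetrized_polydisc])

text \<open>By \<open>antisymmetrized_kernel\<close> this is the signed sum of polydisc kernels
  divided by two Vandermonde determinants and the volume. No factorial appears because the number of
  sheets cancels the number of permutations.\<close>

definition sym_kernel :: "(complex, 'n::{finite,linorder}) vec \<Rightarrow> (complex, 'n) vec \<Rightarrow> complex" where
  "sym_kernel \<xi> \<eta> = numer_kernel \<xi> (cnjv \<eta>) /
     (complex_of_real (measure lborel (polydisc :: (complex, 'n) vec set)) * (denom_kernel \<xi> (cnjv \<eta>))\<^sup>2)"

lemma denom_kernel_cnjv: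
  "denom_kernel (symmetrization x) (cnjv (symmetrization \<mu>)) = (\<Prod>i\<in>UNIV. \<Prod>j\<in>UNIV. 1 - x $ j * cnj (\<mu> $ i))"
  by (simp add: symmetrization_cnjv[symmetric] denom_kernel_eq char_fun_symmetrization)

lemma denom_kernel_bound:
  fixes x \<mu> :: "(complex, 'n::{finite,linorder}) vec"
  assumes x: "x \<in> polydisc" and \<mu>: "\<And>i. cmod (\<mu> $ i) \<le> \<rho>" and \<rho>: "\<rho> < 1"
  shows "(1 - \<rho>) ^ (CARD('n) * CARD('n)) \<le> cmod (denom_kernel (symmetrization x) (cnjv (symmetrization \<mu>)))"
proof -
  have "(\<Prod>i\<in>(UNIV::'n set). \<Prod>j\<in>(UNIV::'n set). 1 - \<rho>) \<le> (\<Prod>i\<in>UNIV. \<Prod>j\<in>UNIV. cmod (1 - x $ j * cnj (\<mu> $ i)))"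
  proof (intro prod_mono conjI prod_nonneg)
    fix i j
    have "1 - \<rho> \<le> 1 - cmod (\<mu> $ i)" using \<mu>[of i] by simp
    also have "\<dots> \<le> cmod (1 - x $ j * cnj (\<mu> $ i))"
      using x by (intro cmod_one_minus_ge) (simp add: polydisc_def less_imp_le)
    finally show "1 - \<rho> \<le> cmod (1 - x $ j * cnj (\<mu> $ i))" .
  qed (use \<rho> in auto)
  then show ?thesis by (simp add: denom_kernel_cnjv prod_norm power_mult)
qed

lemma polydisc_radius:
  fixes \<mu> :: "(complex, 'n::finite) vec"
  assumes "\<mu> \<in> polydisc"
  obtains \<rho> where "\<rho> < 1" "\<And>i. cmod (\<mu> $ i) < \<rho>"
proof -
  define m where "m = Max (range (\<lambda>i. cmod (\<mu> $ i)))"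
  have "m < 1" unfolding m_def using assms by (subst Max_less_iff) (auto simp: polydisc_def)
  moreover have "cmod (\<mu> $ i) < (1 + m) / 2" for i
  proof -
    have "cmod (\<mu> $ i) \<le> m" unfolding m_def by (rule Max_ge) auto
    then show ?thesis using \<open>m < 1\<close> by simp
  qed
  ultimately show ?thesis using that[of "(1 + m) / 2"] by simp
qed

lemma denom_kernel_nonzero:
  assumes "x \<in> polydisc" "\<mu> \<in> polydisc"
  shows "denom_kernel (symmetrization x) (cnjv (symmetrization \<mu>)) \<noteq> 0"
proof -
  have "1 - x $ j * cnj (\<mu> $ i) \<noteq> 0" for i j
    using assms by (intro one_minus_mult_cnj_nonzero) (auto simp: polydisc_def)
  then show ?thesis by (simp add: denom_kernel_cnjv)
qed

text \<open>The numerator is a polynomial on a compact closure, and the denominator is bounded below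
  while the roots of the second point stay within radius \<open>\<rho>\<close>. Uniformity in both
  points is required for dominated convergence.\<close>

lemma sym_kernel_bound:
  fixes \<rho> :: real
  assumes \<rho>: "\<rho> < 1"
  obtains C where "\<And>\<xi> (\<mu> :: (complex, 'n::{finite,linorder}) vec). \<xi> \<in> symmetrized_polydisc \<Longrightarrow> \<mu> \<in> polydisc \<Longrightarrow>
    (\<And>i. cmod (\<mu> $ i) \<le> \<rho>) \<Longrightarrow> cmod (sym_kernel \<xi> (symmetrization \<mu>)) \<le> C"
proof -
  let ?G = "symmetrized_polydisc :: (complex, 'n) vec set"
  let ?v = "measure lborel (polydisc :: (complex, 'n) vec set)"
  have v: "?v > 0" by (rule measure_polydisc_pos)
  let ?C = "closure ?G \<times> closure ?G"
  have "compact ?C"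
    using bounded_symmetrized_polydisc by (intro compact_Times) auto
  moreover have "continuous_on ?C (\<lambda>p. numer_kernel (fst p) (cnjv (snd p)))"
    by (intro poly_kernel_continuous[OF poly_kernel_numer] continuous_intros)
  ultimately have "bounded ((\<lambda>p. numer_kernel (fst p) (cnjv (snd p))) ` ?C)"
    by (intro compact_imp_bounded compact_continuous_image)
  then obtain A where A: "\<And>\<xi> \<eta>. \<xi> \<in> closure ?G \<Longrightarrow> \<eta> \<in> closure ?G \<Longrightarrow> cmod (numer_kernel \<xi> (cnjv \<eta>)) \<le> A"
    unfolding bounded_iff by fastforce
  define d where "d = (1 - \<rho>) ^ (CARD('n) * CARD('n))"
  have d: "d > 0" using \<rho> by (simp add: d_def)
  have "cmod (sym_kernel \<xi> (symmetrization \<mu>)) \<le> A / (?v * d\<^sup>2)"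
    if \<xi>: "\<xi> \<in> ?G" and \<mu>: "\<mu> \<in> polydisc" "\<And>i. cmod (\<mu> $ i) \<le> \<rho>" for \<xi> and \<mu> :: "(complex, 'n) vec"
  proof -
    obtain x where x: "x \<in> polydisc" "\<xi> = symmetrization x" using \<xi> by (auto simp: symmetrized_polydisc_eq)
    have \<eta>: "symmetrization \<mu> \<in> ?G" using \<mu> by (auto simp: symmetrized_polydisc_eq)
    have 1: "cmod (numer_kernel \<xi> (cnjv (symmetrization \<mu>))) \<le> A"
      using A \<xi> \<eta> closure_subset by blast
    have 2: "d \<le> cmod (denom_kernel \<xi> (cnjv (symmetrization \<mu>)))"
      unfolding x(2) d_def by (rule denom_kernel_bound[OF x(1) \<mu>(2) \<rho>])
    have 3: "?v * d\<^sup>2 \<le> ?v * (cmod (denom_kernel \<xi> (cnjv (symmetrization \<mu>))))\<^sup>2"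
      using 2 d v by (intro mult_left_mono power_mono) auto
    have A0: "A \<ge> 0" using 1 norm_ge_zero order_trans by blast
    have "cmod (sym_kernel \<xi> (symmetrization \<mu>)) =
        cmod (numer_kernel \<xi> (cnjv (symmetrization \<mu>))) / (?v * (cmod (denom_kernel \<xi> (cnjv (symmetrization \<mu>))))\<^sup>2)"
      using v by (simp add: sym_kernel_def norm_divide norm_mult norm_power)
    also have "\<dots> \<le> A / (?v * d\<^sup>2)"
      using v d by (intro frac_le A0 1 3) auto
    finally show ?thesis .
  qed
  then show ?thesis using that by blast
qed

lemma poly_kernel_has_derivative_fst:
  assumes "poly_kernel H"
  shows "\<exists>a :: (complex, 'n::finite) vec. ((\<lambda>\<xi>. H \<xi> \<tau>) has_derivative (\<lambda>v. \<Sum>i\<in>UNIV. a $ i * v $ i)) (at \<xi>)"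
proof -
  obtain H1 H2 where H: "((\<lambda>p. H (fst p) (snd p)) has_derivative
       (\<lambda>h. (\<Sum>i\<in>UNIV. H1 i \<xi> \<tau> * fst h $ i) + (\<Sum>i\<in>UNIV. H2 i \<xi> \<tau> * snd h $ i))) (at (\<xi>, \<tau>))"
    using poly_kernel_has_derivative[OF assms] by meson
  have p: "((\<lambda>\<xi>. (\<xi>, \<tau>)) has_derivative (\<lambda>h. (h, 0))) (at \<xi>)"
    by (intro has_derivative_Pair has_derivative_ident has_derivative_const)
  from has_derivative_compose[OF p H] have "((\<lambda>\<xi>. H \<xi> \<tau>) has_derivative (\<lambda>h. \<Sum>i\<in>UNIV. (\<chi> i. H1 i \<xi> \<tau>) $ i * h $ i)) (at \<xi>)"
    by simp
  then show ?thesis by blast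
qed

lemma holomorphic_fun_on_divide:
  assumes "\<And>z. z \<in> S \<Longrightarrow> \<exists>a :: (complex, 'n::finite) vec. (u has_derivative (\<lambda>v. \<Sum>i\<in>UNIV. a $ i * v $ i)) (at z)"
    "\<And>z. z \<in> S \<Longrightarrow> \<exists>a :: (complex, 'n) vec. (w has_derivative (\<lambda>v. \<Sum>i\<in>UNIV. a $ i * v $ i)) (at z)"
    and nz: "\<And>z. z \<in> S \<Longrightarrow> w z \<noteq> 0"
  shows "holomorphic_fun_on (\<lambda>z. u z / w z) S"
  unfolding holomorphic_fun_on_def
proof
  fix z assume z: "z \<in> S"
  obtain a b :: "(complex, 'n) vec" where a: "(u has_derivative (\<lambda>v. \<Sum>i\<in>UNIV. a $ i * v $ i)) (at z)"
    and b: "(w has_derivative (\<lambda>v. \<Sum>i\<in>UNIV. b $ i * v $ i)) (at z)" using assms(1,2)[OF z] by blast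
  have "((\<lambda>z. u z / w z) has_derivative (\<lambda>v. ((\<Sum>i\<in>UNIV. a $ i * v $ i) * w z - u z * (\<Sum>i\<in>UNIV. b $ i * v $ i)) / (w z * w z))) (at z)"
    by (rule has_derivative_divide'[OF a b nz[OF z]])
  also have "(\<lambda>v. ((\<Sum>i\<in>UNIV. a $ i * v $ i) * w z - u z * (\<Sum>i\<in>UNIV. b $ i * v $ i)) / (w z * w z)) =
     (\<lambda>v. \<Sum>i\<in>UNIV. (\<chi> i. (a $ i * w z - u z * b $ i) / (w z * w z)) $ i * v $ i)"
    by (simp add: fun_eq_iff sum_distrib_left sum_distrib_right sum_subtractf[symmetric] sum_divide_distrib algebra_simps)
  finally show "\<exists>a. ((\<lambda>z. u z / w z) has_derivative (\<lambda>v. \<Sum>i\<in>UNIV. a $ i * v $ i)) (at z)" by blast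
qed

lemma sym_kernel_holomorphic:
  assumes \<eta>: "\<eta> \<in> symmetrized_polydisc"
  shows "holomorphic_fun_on (\<lambda>\<xi>. sym_kernel \<xi> \<eta>) (symmetrized_polydisc :: (complex, 'n::{finite,linorder}) vec set)"
proof -
  let ?v = "complex_of_real (measure lborel (polydisc :: (complex, 'n) vec set))"
  obtain \<mu> where \<mu>: "\<mu> \<in> polydisc" "\<eta> = symmetrization \<mu>" using \<eta> by (auto simp: symmetrized_polydisc_eq)
  have D: "poly_kernel (\<lambda>\<xi> \<tau> :: (complex, 'n) vec. ?v * (denom_kernel \<xi> \<tau>)\<^sup>2)"
    unfolding power2_eq_square by (intro poly_kernel.mult poly_kernel.const poly_kernel_denom)
  show ?thesis
    unfolding sym_kernel_def
  proof (rule holomorphic_fun_on_divide)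
    fix \<xi> :: "(complex, 'n) vec" assume "\<xi> \<in> symmetrized_polydisc"
    then obtain x where x: "x \<in> polydisc" "\<xi> = symmetrization x" by (auto simp: symmetrized_polydisc_eq)
    show "?v * (denom_kernel \<xi> (cnjv \<eta>))\<^sup>2 \<noteq> 0"
      using denom_kernel_nonzero[OF x(1) \<mu>(1)] measure_polydisc_pos[where 'n = 'n] by (simp add: x \<mu>)
  qed (rule poly_kernel_has_derivative_fst[OF poly_kernel_numer] poly_kernel_has_derivative_fst[OF D])+
qed

lemma set_integrable_bounded:
  fixes k :: "'a::euclidean_space \<Rightarrow> complex"
  assumes S: "S \<in> sets borel" "emeasure lborel S < \<infinity>" and k: "continuous_on S k" "\<And>x. x \<in> S \<Longrightarrow> cmod (k x) \<le> C"
  shows "set_integrable lborel S k"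
proof -
  have "set_integrable lborel S (\<lambda>x. 1 :: complex)" using S by (simp add: set_integrable_def)
  from set_integrable_mult_bounded[OF S(1) this k] show ?thesis by simp
qed

text \<open>From \<open>y \<le> 1 + y\<^sup>2\<close>, where the constant is integrable over a set
  of finite measure.\<close>

lemma set_integrable_of_square:
  fixes F :: "'a::euclidean_space \<Rightarrow> complex"
  assumes S: "S \<in> sets borel" "emeasure lborel S < \<infinity>" and F: "continuous_on S F"
    and int: "set_integrable lborel S (\<lambda>x. (cmod (F x))\<^sup>2)"
  shows "set_integrable lborel S F"
  unfolding set_integrable_def
proof (rule Bochner_Integration.integrable_bound)
  have "integrable lborel (\<lambda>x. indicator S x :: real)" using S by simp
  then show "integrable lborel (\<lambda>x. indicator S x + indicator S x *\<^sub>R (cmod (F x))\<^sup>2)"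
    using int unfolding set_integrable_def by (rule Bochner_Integration.integrable_add)
  have "(\<lambda>x. if x \<in> S then F x else 0) \<in> borel_measurable borel"
    using S F by (intro borel_measurable_continuous_on_if) auto
  moreover have "(\<lambda>x. if x \<in> S then F x else 0) = (\<lambda>x. indicator S x *\<^sub>R F x)" by (auto simp: indicator_def)
  ultimately show "(\<lambda>x. indicator S x *\<^sub>R F x) \<in> borel_measurable lborel" by simp
  have "y \<le> 1 + y\<^sup>2" for y :: real
    using sum_squares_bound[of y 1] by (smt (verit) mult.right_neutral power_one zero_le_power2)
  then show "AE x in lborel. norm (indicator S x *\<^sub>R F x) \<le> norm (indicator S x + indicator S x *\<^sub>R (cmod (F x))\<^sup>2)"
    by (auto simp: indicator_def)
qed

lemma slice_holomorphic_mult: "slice_holomorphic F \<Longrightarrow> slice_holomorphic H \<Longrightarrow> slice_holomorphic (\<lambda>x. F x * H x)"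
  unfolding slice_holomorphic_def by (auto intro!: continuous_intros holomorphic_intros)

lemma slice_holomorphic_vandermonde: "slice_holomorphic (\<lambda>x. det (vandermonde x))"
  unfolding slice_holomorphic_def
proof (intro conjI ballI allI)
  show "continuous_on polydisc (\<lambda>x. det (vandermonde x))" by (rule continuous_vandermonde)
  fix x :: "(complex, 'n::{finite,linorder}) vec" and j
  have "(\<lambda>t. vec_upd j t x $ i) holomorphic_on ball 0 1" for i by (cases "i = j") auto
  then show "(\<lambda>t. det (vandermonde (vec_upd j t x))) holomorphic_on ball 0 1"
    unfolding det_def vandermonde_def vec_lambda_beta
    by (intro holomorphic_on_sum holomorphic_on_mult holomorphic_on_const holomorphic_on_prod holomorphic_on_power)
qed

lemma holomorphic_fun_symmetrization:
  fixes f :: "(complex, 'n::{finite,linorder}) vec \<Rightarrow> complex"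
  assumes "holomorphic_fun_on f symmetrized_polydisc"
  shows "holomorphic_fun_on (\<lambda>x. f (symmetrization x)) polydisc"
  unfolding holomorphic_fun_on_def
proof
  fix x :: "(complex, 'n) vec" assume x: "x \<in> polydisc"
  then have "symmetrization x \<in> symmetrized_polydisc" by (auto simp: symmetrized_polydisc_eq)
  then obtain a :: "(complex, 'n) vec" where a: "(f has_derivative (\<lambda>v. \<Sum>i\<in>UNIV. a $ i * v $ i)) (at (symmetrization x))"
    using assms by (auto simp: holomorphic_fun_on_def)
  have "((\<lambda>x. f (symmetrization x)) has_derivative (\<lambda>h. \<Sum>i\<in>UNIV. a $ i * (sym_jacobian x *v h) $ i)) (at x)"
    by (rule has_derivative_compose[OF has_derivative_symmetrization a])
  also have "(\<lambda>h. \<Sum>i\<in>UNIV. a $ i * (sym_jacobian x *v h) $ i) = (\<lambda>h. \<Sum>j\<in>UNIV. (\<chi> j. \<Sum>i\<in>UNIV. a $ i * sym_jacobian x $ i $ j) $ j * h $ j)"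
  proof
    fix h
    have "(\<Sum>i\<in>UNIV. a $ i * (sym_jacobian x *v h) $ i) = (\<Sum>i\<in>UNIV. \<Sum>j\<in>UNIV. a $ i * sym_jacobian x $ i $ j * h $ j)"
      by (simp add: matrix_vector_mult_def sum_distrib_left mult.assoc)
    also have "\<dots> = (\<Sum>j\<in>UNIV. \<Sum>i\<in>UNIV. a $ i * sym_jacobian x $ i $ j * h $ j)" by (rule sum.swap)
    finally show "(\<Sum>i\<in>UNIV. a $ i * (sym_jacobian x *v h) $ i) = (\<Sum>j\<in>UNIV. (\<chi> j. \<Sum>i\<in>UNIV. a $ i * sym_jacobian x $ i $ j) $ j * h $ j)"
      by (simp add: sum_distrib_right)
  qed
  finally show "\<exists>a. ((\<lambda>x. f (symmetrization x)) has_derivative (\<lambda>v. \<Sum>i\<in>UNIV. a $ i * v $ i)) (at x)" by blast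
qed

lemma integral_symmetrization:
  fixes \<phi> :: "(complex, 'n::{finite,linorder}) vec \<Rightarrow> complex"
  assumes "continuous_on symmetrized_polydisc \<phi>"
  shows "set_integrable lborel polydisc (\<lambda>x. (cmod (det (vandermonde x)))\<^sup>2 * \<phi> (symmetrization x)) \<longleftrightarrow>
      set_integrable lborel symmetrized_polydisc \<phi>"
    and "set_lebesgue_integral lborel polydisc (\<lambda>x. (cmod (det (vandermonde x)))\<^sup>2 * \<phi> (symmetrization x)) =
      num_perms TYPE('n) * set_lebesgue_integral lborel symmetrized_polydisc \<phi>"
proof -
  have c: "real (num_perms TYPE('n)) > 0" using num_perms_pos[where 'n = 'n] by simp
  have w: "continuous_on polydisc (\<lambda>x :: (complex, 'n) vec. (cmod (det (vandermonde x)))\<^sup>2)"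
    by (intro continuous_intros continuous_vandermonde)
  have im: "symmetrization ` polydisc \<subseteq> symmetrized_polydisc" by (simp add: symmetrized_polydisc_eq)
  note * = integral_pushforward[OF polydisc_measurable symmetrized_polydisc_measurable im continuous_symmetrization w _ assms c symmetrization_pushforward]
  show "set_integrable lborel polydisc (\<lambda>x. (cmod (det (vandermonde x)))\<^sup>2 * \<phi> (symmetrization x)) \<longleftrightarrow>
      set_integrable lborel symmetrized_polydisc \<phi>" using *(1) by simp
  show "set_lebesgue_integral lborel polydisc (\<lambda>x. (cmod (det (vandermonde x)))\<^sup>2 * \<phi> (symmetrization x)) =
      num_perms TYPE('n) * set_lebesgue_integral lborel symmetrized_polydisc \<phi>" using *(2) by simp
qed

lemma polydisc_permute: "p permutes UNIV \<Longrightarrow> x \<in> polydisc \<Longrightarrow> (\<chi> i. x $ p i) \<in> polydisc"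
  by (auto simp: polydisc_def)

section \<open>The reproducing property on the symmetrized polydisc\<close>

text \<open>The signed sum is the Leibniz expansion of a determinant, evaluated by
  \<open>det_square_kernel\<close> at \<open>x\<close> and the conjugate of
  \<open>\<mu>\<close>.\<close>

lemma antisymmetrized_kernel:
  fixes x \<mu> :: "(complex, 'n::{finite,linorder}) vec"
  assumes x: "x \<in> polydisc" and \<mu>: "\<mu> \<in> polydisc"
  shows "(\<Sum>p\<in>{p. p permutes UNIV}. of_int (sign p) * polydisc_kernel x (\<chi> i. \<mu> $ p i)) =
    complex_of_real (measure lborel (polydisc :: (complex, 'n) vec set)) * det (vandermonde x) *
      sym_kernel (symmetrization x) (symmetrization \<mu>) * cnj (det (vandermonde \<mu>))"
proof -
  let ?v = "complex_of_real (measure lborel (polydisc :: (complex, 'n) vec set))"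
  let ?d = "denom_kernel (symmetrization x) (cnjv (symmetrization \<mu>))"
  have d0: "?d \<noteq> 0" by (rule denom_kernel_nonzero[OF x \<mu>])
  have v0: "?v \<noteq> 0" using measure_polydisc_pos[where 'n = 'n] by simp
  have "(\<Sum>p\<in>{p. p permutes UNIV}. of_int (sign p) * polydisc_kernel x (\<chi> i. \<mu> $ p i)) = det (\<chi> i j. 1 / (1 - x $ i * cnjv \<mu> $ j)\<^sup>2)"
    by (simp add: det_def polydisc_kernel_def)
  moreover have "1 - x $ i * cnjv \<mu> $ j \<noteq> 0" for i j
    using x \<mu> by (simp add: polydisc_def) (metis one_minus_mult_cnj_nonzero right_minus_eq)
  from det_square_kernel[OF this]
  have "det (\<chi> i j. 1 / (1 - x $ i * cnjv \<mu> $ j)\<^sup>2) * ?d\<^sup>2 =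
      det (vandermonde x) * numer_kernel (symmetrization x) (cnjv (symmetrization \<mu>)) * det (vandermonde (cnjv \<mu>))"
    by (simp add: symmetrization_cnjv)
  moreover have "det (vandermonde (cnjv \<mu>)) = cnj (det (vandermonde \<mu>))"
    by (simp add: det_def vandermonde_def)
  ultimately show ?thesis
    using d0 v0 by (simp add: sym_kernel_def field_simps)
qed

lemma bergman_space_continuous: "f \<in> bergman_space S \<Longrightarrow> continuous_on S f"
  by (auto simp: bergman_space_def intro: holomorphic_fun_continuous)

lemma bergman_space_integrable:
  "f \<in> bergman_space symmetrized_polydisc \<Longrightarrow> set_integrable lborel symmetrized_polydisc f"
  by (intro set_integrable_of_square symmetrized_polydisc_measurable emeasure_symmetrized_polydisc bergman_space_continuous)
    (auto simp: bergman_space_def)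

lemma sym_kernel_bounded_fst:
  fixes \<eta> :: "(complex, 'n::{finite,linorder}) vec"
  assumes "\<eta> \<in> symmetrized_polydisc"
  obtains C where "\<And>\<xi>. \<xi> \<in> symmetrized_polydisc \<Longrightarrow> cmod (sym_kernel \<xi> \<eta>) \<le> C"
proof -
  obtain \<mu> where \<mu>: "\<mu> \<in> polydisc" "\<eta> = symmetrization \<mu>" using assms by (auto simp: symmetrized_polydisc_eq)
  obtain \<rho> where \<rho>: "\<rho> < 1" "\<And>i. cmod (\<mu> $ i) < \<rho>" using polydisc_radius[OF \<mu>(1)] by blast
  obtain C where "\<And>\<xi> (\<mu> :: (complex, 'n) vec). \<xi> \<in> symmetrized_polydisc \<Longrightarrow> \<mu> \<in> polydisc \<Longrightarrow>
    (\<And>i. cmod (\<mu> $ i) \<le> \<rho>) \<Longrightarrow> cmod (sym_kernel \<xi> (symmetrization \<mu>)) \<le> C" using sym_kernel_bound[OF \<rho>(1)] by blast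
  then show ?thesis using that[of C] \<mu> \<rho> by (simp add: less_imp_le)
qed

lemma sym_kernel_continuous:
  "\<eta> \<in> symmetrized_polydisc \<Longrightarrow> continuous_on symmetrized_polydisc (\<lambda>\<xi>. sym_kernel \<xi> \<eta>)"
  by (rule holomorphic_fun_continuous[OF sym_kernel_holomorphic])

text \<open>Multiplying the pulled back \<open>f\<close> by the Vandermonde determinant gives an
  antisymmetric function on the polydisc. Its reproducing formulas at all permutations of
  \<open>\<mu>\<close> are summed with signs, and the sum of kernels becomes
  \<open>sym_kernel\<close>. The final division requires distinct coordinates of
  \<open>\<mu>\<close>.\<close>

lemma sym_kernel_reproducing_generic:
  fixes f :: "(complex, 'n::{finite,linorder}) vec \<Rightarrow> complex"
  assumes f: "f \<in> bergman_space symmetrized_polydisc" and \<mu>: "\<mu> \<in> polydisc" and V: "det (vandermonde \<mu>) \<noteq> 0"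
  shows "f (symmetrization \<mu>) = set_lebesgue_integral lborel symmetrized_polydisc (\<lambda>\<xi>. f \<xi> * cnj (sym_kernel \<xi> (symmetrization \<mu>)))"
proof -
  let ?D = "polydisc :: (complex, 'n) vec set" and ?G = "symmetrized_polydisc :: (complex, 'n) vec set"
  let ?P = "{p :: 'n \<Rightarrow> 'n. p permutes UNIV}"
  let ?v = "complex_of_real (measure lborel ?D)"
  let ?V = "\<lambda>x :: (complex, 'n) vec. det (vandermonde x)"
  let ?K = "\<lambda>\<xi>. sym_kernel \<xi> (symmetrization \<mu>)"
  have \<eta>: "symmetrization \<mu> \<in> ?G" using \<mu> by (auto simp: symmetrized_polydisc_eq)
  define F where "F x = f (symmetrization x) * ?V x" for x
  have hol: "holomorphic_fun_on f ?G" and int: "set_integrable lborel ?G (\<lambda>z. (cmod (f z))\<^sup>2)"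
    using f by (auto simp: bergman_space_def)
  have cf: "continuous_on ?G f" by (rule bergman_space_continuous[OF f])
  have sF: "slice_holomorphic F"
    unfolding F_def
    by (intro slice_holomorphic_mult slice_holomorphic_vandermonde holomorphic_fun_slice holomorphic_fun_symmetrization hol)
  have intF: "set_integrable lborel ?D F"
  proof (rule set_integrable_of_square[OF polydisc_measurable emeasure_polydisc_finite])
    show "continuous_on ?D F" using sF by (simp add: slice_holomorphic_def)
    \<comment> \<open>\<open>integral_symmetrization\<close> concerns complex integrands, hence the
      passage through \<open>complex_of_real\<close> and back by \<open>Re\<close>.\<close>
    have "set_integrable lborel ?G (\<lambda>z. complex_of_real ((cmod (f z))\<^sup>2))"
    proof -
      have "integrable lborel (\<lambda>z. complex_of_real (indicator ?G z *\<^sub>R (cmod (f z))\<^sup>2))"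
        using int unfolding set_integrable_def by (rule integrable_of_real)
      then show ?thesis by (simp add: set_integrable_def scaleR_conv_of_real)
    qed
    then have "set_integrable lborel ?D (\<lambda>x. complex_of_real ((cmod (?V x))\<^sup>2) * complex_of_real ((cmod (f (symmetrization x)))\<^sup>2))"
      using integral_symmetrization(1)[of "\<lambda>z. complex_of_real ((cmod (f z))\<^sup>2)"] cf by (simp add: continuous_intros)
    then have "integrable lborel (\<lambda>x. indicator ?D x *\<^sub>R (complex_of_real ((cmod (?V x))\<^sup>2) * complex_of_real ((cmod (f (symmetrization x)))\<^sup>2)))"
      by (simp add: set_integrable_def)
    then have "integrable lborel (\<lambda>x. Re (indicator ?D x *\<^sub>R (complex_of_real ((cmod (?V x))\<^sup>2) * complex_of_real ((cmod (f (symmetrization x)))\<^sup>2))))"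
      by (rule integrable_Re)
    also have "(\<lambda>x. Re (indicator ?D x *\<^sub>R (complex_of_real ((cmod (?V x))\<^sup>2) * complex_of_real ((cmod (f (symmetrization x)))\<^sup>2)))) =
       (\<lambda>x. indicator ?D x *\<^sub>R (cmod (F x))\<^sup>2)"
      by (simp add: F_def fun_eq_iff norm_mult power_mult_distrib mult.commute flip: of_real_mult of_real_power)
    finally show "set_integrable lborel ?D (\<lambda>x. (cmod (F x))\<^sup>2)" by (simp add: set_integrable_def)
  qed
  let ?n = "complex_of_nat (num_perms TYPE('n))"
  have cK: "continuous_on ?G (\<lambda>\<xi>. f \<xi> * cnj (?K \<xi>))"
    by (intro continuous_intros cf sym_kernel_continuous \<eta>)
  have sgn2: "of_int (sign p) * (of_int (sign p) :: complex) = 1" for p :: "'n \<Rightarrow> 'n"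
    by (simp add: sign_def)
  have intp: "set_integrable lborel ?D (\<lambda>x. F x * cnj (polydisc_kernel x (\<chi> i. \<mu> $ p i)))" if "p \<in> ?P" for p
    using polydisc_permute[OF _ \<mu>] that
    by (intro set_integrable_mult_bounded[OF polydisc_measurable intF _ polydisc_kernel_bound]) (auto intro!: continuous_intros continuous_polydisc_kernel)
  \<comment> \<open>\<open>F\<close> changes by the sign of the permutation, so each signed term
    contributes the same value.\<close>
  have "?n * (?v * (f (symmetrization \<mu>) * ?V \<mu>)) = (\<Sum>p\<in>?P. of_int (sign p) * (?v * F (\<chi> i. \<mu> $ p i)))"
  proof -
    have "of_int (sign p) * (?v * F (\<chi> i. \<mu> $ p i)) = ?v * (f (symmetrization \<mu>) * ?V \<mu>)" if "p \<in> ?P" for p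
    proof -
      have "of_int (sign p) * (?v * F (\<chi> i. \<mu> $ p i)) = (of_int (sign p) * of_int (sign p)) * (?v * (f (symmetrization \<mu>) * ?V \<mu>))"
        using that by (simp add: F_def symmetrization_permute det_vandermonde_permute mult_ac)
      then show ?thesis by (simp only: sgn2 mult_1_left)
    qed
    then have "(\<Sum>p\<in>?P. of_int (sign p) * (?v * F (\<chi> i. \<mu> $ p i))) = (\<Sum>p\<in>?P. ?v * (f (symmetrization \<mu>) * ?V \<mu>))"
      by (intro sum.cong) auto
    then show ?thesis by (simp add: num_perms_def)
  qed
  also have "\<dots> = (\<Sum>p\<in>?P. of_int (sign p) * set_lebesgue_integral lborel ?D (\<lambda>x. F x * cnj (polydisc_kernel x (\<chi> i. \<mu> $ p i))))"
    using polydisc_reproducing[OF sF intF polydisc_permute[OF _ \<mu>]] by (intro sum.cong) auto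
  also have "\<dots> = set_lebesgue_integral lborel ?D (\<lambda>x. \<Sum>p\<in>?P. of_int (sign p) * (F x * cnj (polydisc_kernel x (\<chi> i. \<mu> $ p i))))"
  proof -
    have "set_lebesgue_integral lborel ?D (\<lambda>x. \<Sum>p\<in>?P. of_int (sign p) * (F x * cnj (polydisc_kernel x (\<chi> i. \<mu> $ p i)))) =
      (\<integral>x. (\<Sum>p\<in>?P. of_int (sign p) * (indicator ?D x *\<^sub>R (F x * cnj (polydisc_kernel x (\<chi> i. \<mu> $ p i))))) \<partial>lborel)"
      by (simp add: set_lebesgue_integral_def scaleR_sum_right)
    also have "\<dots> = (\<Sum>p\<in>?P. \<integral>x. of_int (sign p) * (indicator ?D x *\<^sub>R (F x * cnj (polydisc_kernel x (\<chi> i. \<mu> $ p i)))) \<partial>lborel)"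
      using intp by (intro Bochner_Integration.integral_sum integrable_mult_right) (auto simp: set_integrable_def)
    also have "\<dots> = (\<Sum>p\<in>?P. of_int (sign p) * set_lebesgue_integral lborel ?D (\<lambda>x. F x * cnj (polydisc_kernel x (\<chi> i. \<mu> $ p i))))"
      by (simp add: set_lebesgue_integral_def del: mult_scaleR_right)
    finally show ?thesis by simp
  qed
  also have "\<dots> = set_lebesgue_integral lborel ?D (\<lambda>x. (?v * ?V \<mu>) * (complex_of_real ((cmod (?V x))\<^sup>2) * (f (symmetrization x) * cnj (?K (symmetrization x)))))"
  proof (rule set_lebesgue_integral_cong)
    show "\<forall>x. x \<in> ?D \<longrightarrow> (\<Sum>p\<in>?P. of_int (sign p) * (F x * cnj (polydisc_kernel x (\<chi> i. \<mu> $ p i)))) =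
       (?v * ?V \<mu>) * (complex_of_real ((cmod (?V x))\<^sup>2) * (f (symmetrization x) * cnj (?K (symmetrization x))))"
    proof (intro allI impI)
      fix x assume x: "x \<in> ?D"
      have "(\<Sum>p\<in>?P. of_int (sign p) * (F x * cnj (polydisc_kernel x (\<chi> i. \<mu> $ p i)))) =
        F x * cnj (\<Sum>p\<in>?P. of_int (sign p) * polydisc_kernel x (\<chi> i. \<mu> $ p i))"
        by (simp add: sum_distrib_left mult_ac)
      also have "\<dots> = (?v * ?V \<mu>) * ((?V x * cnj (?V x)) * (f (symmetrization x) * cnj (?K (symmetrization x))))"
        unfolding antisymmetrized_kernel[OF x \<mu>] by (simp add: F_def mult_ac)
      finally show "(\<Sum>p\<in>?P. of_int (sign p) * (F x * cnj (polydisc_kernel x (\<chi> i. \<mu> $ p i)))) =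
        (?v * ?V \<mu>) * (complex_of_real ((cmod (?V x))\<^sup>2) * (f (symmetrization x) * cnj (?K (symmetrization x))))"
        by (simp only: complex_norm_square)
    qed
  qed simp
  also have "\<dots> = (?v * ?V \<mu>) * (?n * set_lebesgue_integral lborel ?G (\<lambda>\<xi>. f \<xi> * cnj (?K \<xi>)))"
    using integral_symmetrization(2)[OF cK] by simp
  finally have "(?n * ?v * ?V \<mu>) * f (symmetrization \<mu>) = (?n * ?v * ?V \<mu>) * set_lebesgue_integral lborel ?G (\<lambda>\<xi>. f \<xi> * cnj (?K \<xi>))"
    by (simp only: mult_ac)
  moreover have "?n * ?v * ?V \<mu> \<noteq> 0"
    using num_perms_pos[where 'n = 'n] measure_polydisc_pos[where 'n = 'n] V by simp
  ultimately show ?thesis by simp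
qed

lemma sym_kernel_bergman_space:
  assumes w: "w \<in> (symmetrized_polydisc :: (complex, 'n::{finite,linorder}) vec set)"
  shows "(\<lambda>z. sym_kernel z w) \<in> bergman_space symmetrized_polydisc"
proof -
  let ?G = "symmetrized_polydisc :: (complex, 'n) vec set"
  obtain C where C: "\<And>z. z \<in> ?G \<Longrightarrow> cmod (sym_kernel z w) \<le> C" using sym_kernel_bounded_fst[OF w] by blast
  have "set_integrable lborel ?G (\<lambda>z. complex_of_real ((cmod (sym_kernel z w))\<^sup>2))"
  proof (rule set_integrable_bounded[OF symmetrized_polydisc_measurable emeasure_symmetrized_polydisc])
    show "continuous_on ?G (\<lambda>z. complex_of_real ((cmod (sym_kernel z w))\<^sup>2))"
      by (intro continuous_intros sym_kernel_continuous w)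
    show "cmod (complex_of_real ((cmod (sym_kernel z w))\<^sup>2)) \<le> C\<^sup>2" if "z \<in> ?G" for z
      using power_mono[OF C[OF that], of 2] by (simp add: norm_power)
  qed
  then have "integrable lborel (\<lambda>z. Re (indicator ?G z *\<^sub>R complex_of_real ((cmod (sym_kernel z w))\<^sup>2)))"
    unfolding set_integrable_def by (rule integrable_Re)
  then have "set_integrable lborel ?G (\<lambda>z. (cmod (sym_kernel z w))\<^sup>2)"
    by (simp add: set_integrable_def flip: of_real_power)
  then show ?thesis using sym_kernel_holomorphic[OF w] by (simp add: bergman_space_def)
qed

lemma sym_kernel_continuous_snd:
  fixes \<xi> :: "(complex, 'n::{finite,linorder}) vec"
  assumes \<xi>: "\<xi> \<in> symmetrized_polydisc"
  shows "continuous_on symmetrized_polydisc (\<lambda>\<eta>. sym_kernel \<xi> \<eta>)"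
  unfolding sym_kernel_def
proof (intro continuous_intros poly_kernel_continuous[OF poly_kernel_numer] poly_kernel_continuous[OF poly_kernel_denom])
  show "\<forall>\<eta>\<in>symmetrized_polydisc. complex_of_real (measure lborel (polydisc :: (complex, 'n) vec set)) * (denom_kernel \<xi> (cnjv \<eta>))\<^sup>2 \<noteq> 0"
    using \<xi> denom_kernel_nonzero measure_polydisc_pos[where 'n = 'n] by (auto simp: symmetrized_polydisc_eq)
qed

text \<open>At branch points the Vandermonde determinant cannot be cancelled. Such a point is
  approximated by generic ones, and the integrals converge by domination with a constant multiple of
  \<open>|f|\<close>.\<close>

theorem is_bergman_kernel_sym:
  "is_bergman_kernel symmetrized_polydisc (sym_kernel :: (complex, 'n::{finite,linorder}) vec \<Rightarrow> _)"
  unfolding is_bergman_kernel_def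
proof (intro ballI conjI)
  let ?G = "symmetrized_polydisc :: (complex, 'n) vec set"
  fix w f assume w: "w \<in> ?G" and f: "f \<in> bergman_space ?G"
  obtain \<mu> where \<mu>: "\<mu> \<in> polydisc" "w = symmetrization \<mu>" using w by (auto simp: symmetrized_polydisc_eq)
  obtain \<rho> where \<rho>: "\<rho> < 1" "\<And>i. cmod (\<mu> $ i) < \<rho>" using polydisc_radius[OF \<mu>(1)] by blast
  obtain C where C: "\<And>\<xi> (\<mu> :: (complex, 'n) vec). \<xi> \<in> ?G \<Longrightarrow> \<mu> \<in> polydisc \<Longrightarrow>
    (\<And>i. cmod (\<mu> $ i) \<le> \<rho>) \<Longrightarrow> cmod (sym_kernel \<xi> (symmetrization \<mu>)) \<le> C" using sym_kernel_bound[OF \<rho>(1)] by blast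
  have cf: "continuous_on ?G f" by (rule bergman_space_continuous[OF f])
  have intf: "set_integrable lborel ?G f" by (rule bergman_space_integrable[OF f])
  obtain s0 where s0: "\<And>n. s0 n \<in> - Re_collision" "s0 \<longlonglongrightarrow> \<mu>"
    using dense_not_Re_collision[where 'n = 'n] closure_sequential[of \<mu>] by blast
  define W where "W = {x :: (complex, 'n) vec. \<forall>i. cmod (x $ i) < \<rho>}"
  have "W = (\<Inter>i\<in>UNIV. {x. cmod (x $ i) < \<rho>})" by (auto simp: W_def)
  then have "open W" by (auto intro!: open_INT open_Collect_less continuous_intros)
  moreover have "\<mu> \<in> W" using \<rho> by (simp add: W_def)
  ultimately have "eventually (\<lambda>n. s0 n \<in> W) sequentially" using s0(2) topological_tendstoD by blast
  then obtain m where m: "\<And>n. n \<ge> m \<Longrightarrow> s0 n \<in> W" by (auto simp: eventually_sequentially)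
  \<comment> \<open>Dropping the first \<open>m\<close> terms keeps the whole sequence within the
    radius \<open>\<rho>\<close> for which \<open>C\<close> is a bound.\<close>
  define s where "s n = s0 (n + m)" for n
  have s: "s n \<notin> Re_collision" "s n \<in> W" for n using s0(1)[of "n + m"] m[of "n + m"] by (auto simp: s_def)
  have slim: "s \<longlonglongrightarrow> \<mu>" unfolding s_def using s0(2) by (rule LIMSEQ_ignore_initial_segment)
  have sD: "s n \<in> polydisc" for n using s(2)[of n] \<rho>(1) by (auto simp: W_def polydisc_def intro: less_trans)
  have sG: "symmetrization (s n) \<in> ?G" for n using sD by (auto simp: symmetrized_polydisc_eq)
  have lim\<eta>: "(\<lambda>n. symmetrization (s n)) \<longlonglongrightarrow> w"
    using continuous_on_tendsto_compose[OF continuous_symmetrization[of UNIV] slim] by (simp add: \<mu>)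
  have limG: "(\<lambda>n. h (symmetrization (s n))) \<longlonglongrightarrow> h w" if "continuous_on ?G h" for h :: "(complex, 'n) vec \<Rightarrow> complex"
    by (rule continuous_on_tendsto_compose[OF that lim\<eta> w]) (use sG in auto)
  have bnd: "cmod (f \<xi> * cnj (sym_kernel \<xi> (symmetrization (s n)))) \<le> cmod (f \<xi>) * C" if "\<xi> \<in> ?G" for \<xi> n
    using C[OF that sD, of n] s(2)[of n] by (auto simp: norm_mult W_def less_imp_le intro!: mult_left_mono)
  have cK: "continuous_on ?G (\<lambda>\<xi>. f \<xi> * cnj (sym_kernel \<xi> \<eta>))" if "\<eta> \<in> ?G" for \<eta>
    by (intro continuous_intros cf sym_kernel_continuous that)
  have meas: "(\<lambda>\<xi>. indicator ?G \<xi> *\<^sub>R h \<xi>) \<in> borel_measurable lborel" if "continuous_on ?G h" for h :: "(complex, 'n) vec \<Rightarrow> complex"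
  proof -
    have "(\<lambda>x. if x \<in> ?G then h x else 0) \<in> borel_measurable borel"
      using that by (intro borel_measurable_continuous_on_if) auto
    moreover have "(\<lambda>x. if x \<in> ?G then h x else 0) = (\<lambda>x. indicator ?G x *\<^sub>R h x)" by (auto simp: indicator_def)
    ultimately show ?thesis by simp
  qed
  have "(\<lambda>n. \<integral>\<xi>. indicator ?G \<xi> *\<^sub>R (f \<xi> * cnj (sym_kernel \<xi> (symmetrization (s n)))) \<partial>lborel) \<longlonglongrightarrow>
     (\<integral>\<xi>. indicator ?G \<xi> *\<^sub>R (f \<xi> * cnj (sym_kernel \<xi> w)) \<partial>lborel)"
  proof (rule integral_dominated_convergence)
    show "integrable lborel (\<lambda>\<xi>. norm (indicator ?G \<xi> *\<^sub>R f \<xi>) * C)"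
      using integrable_norm[OF intf[unfolded set_integrable_def]] by (rule integrable_mult_left)
    show "AE \<xi> in lborel. (\<lambda>n. indicator ?G \<xi> *\<^sub>R (f \<xi> * cnj (sym_kernel \<xi> (symmetrization (s n))))) \<longlonglongrightarrow> indicator ?G \<xi> *\<^sub>R (f \<xi> * cnj (sym_kernel \<xi> w))"
    proof (rule AE_I2)
      fix \<xi>
      show "(\<lambda>n. indicator ?G \<xi> *\<^sub>R (f \<xi> * cnj (sym_kernel \<xi> (symmetrization (s n))))) \<longlonglongrightarrow> indicator ?G \<xi> *\<^sub>R (f \<xi> * cnj (sym_kernel \<xi> w))"
      proof (cases "\<xi> \<in> ?G")
        case True
        then show ?thesis by (intro tendsto_intros limG[OF sym_kernel_continuous_snd])
      qed simp
    qed
    show "AE \<xi> in lborel. norm (indicator ?G \<xi> *\<^sub>R (f \<xi> * cnj (sym_kernel \<xi> (symmetrization (s n))))) \<le> norm (indicator ?G \<xi> *\<^sub>R f \<xi>) * C" for n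
    proof (rule AE_I2)
      fix \<xi>
      show "norm (indicator ?G \<xi> *\<^sub>R (f \<xi> * cnj (sym_kernel \<xi> (symmetrization (s n))))) \<le> norm (indicator ?G \<xi> *\<^sub>R f \<xi>) * C"
        using bnd[of \<xi> n] by (cases "\<xi> \<in> ?G") auto
    qed
  qed (intro meas cK w sG)+
  moreover have "(\<integral>\<xi>. indicator ?G \<xi> *\<^sub>R (f \<xi> * cnj (sym_kernel \<xi> (symmetrization (s n)))) \<partial>lborel) = f (symmetrization (s n))" for n
    using sym_kernel_reproducing_generic[OF f sD not_Re_collision_det[OF s(1)], of n] by (simp add: set_lebesgue_integral_def)
  ultimately have "(\<lambda>n. f (symmetrization (s n))) \<longlonglongrightarrow> (\<integral>\<xi>. indicator ?G \<xi> *\<^sub>R (f \<xi> * cnj (sym_kernel \<xi> w)) \<partial>lborel)" by simp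
  then show "f w = set_lebesgue_integral lborel ?G (\<lambda>z. f z * cnj (sym_kernel z w))"
    unfolding set_lebesgue_integral_def using limG[OF cf] LIMSEQ_unique by blast
qed (rule sym_kernel_bergman_space)

section \<open>Uniqueness of the kernel and positivity on the diagonal\<close>

text \<open>Each kernel reproduces the sections of the other; the two resulting integrals are
  conjugate to each other.\<close>

lemma bergman_kernel_hermitian:
  assumes K: "is_bergman_kernel S K" and K': "is_bergman_kernel S K'" and z: "z \<in> S" and w: "w \<in> S"
  shows "K z w = cnj (K' w z)"
proof -
  have 1: "K z w = set_lebesgue_integral lborel S (\<lambda>x. K x w * cnj (K' x z))"
    using K K' z w by (auto simp: is_bergman_kernel_def)
  have "K' w z = set_lebesgue_integral lborel S (\<lambda>x. K' x z * cnj (K x w))"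
    using K K' z w by (auto simp: is_bergman_kernel_def)
  then have "cnj (K' w z) = (\<integral>x. cnj (indicator S x *\<^sub>R (K' x z * cnj (K x w))) \<partial>lborel)"
    unfolding set_lebesgue_integral_def by (simp only: Bochner_Integration.integral_cnj)
  then show ?thesis unfolding 1 by (simp add: set_lebesgue_integral_def mult.commute)
qed

lemma bergman_kernel_unique:
  assumes K: "is_bergman_kernel S K" and K': "is_bergman_kernel S K'" and z: "z \<in> S" and w: "w \<in> S"
  shows "K z w = K' z w"
  using bergman_kernel_hermitian[OF K K' z w] bergman_kernel_hermitian[OF K' K' z w] by simp

lemma bergman_kernel_symmetrized_polydisc:
  "\<xi> \<in> symmetrized_polydisc \<Longrightarrow> \<eta> \<in> symmetrized_polydisc \<Longrightarrow>
    bergman_kernel symmetrized_polydisc \<xi> \<eta> = sym_kernel \<xi> \<eta>"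
  unfolding bergman_kernel_def
  by (rule bergman_kernel_unique[OF someI[where P = "is_bergman_kernel symmetrized_polydisc", OF is_bergman_kernel_sym] is_bergman_kernel_sym])

text \<open>The diagonal value is the squared norm of the section at \<open>w\<close>. If it were
  zero, the section would vanish almost everywhere, yet it reproduces the constant function
  1.\<close>

lemma sym_kernel_diagonal_pos:
  fixes w :: "(complex, 'n::{finite,linorder}) vec"
  assumes w: "w \<in> symmetrized_polydisc"
  obtains r where "r > 0" "sym_kernel w w = complex_of_real r"
proof -
  let ?G = "symmetrized_polydisc :: (complex, 'n) vec set"
  define k where "k x = indicator ?G x *\<^sub>R (cmod (sym_kernel x w))\<^sup>2" for x
  have intk: "integrable lborel k"
    using sym_kernel_bergman_space[OF w] by (simp add: bergman_space_def set_integrable_def k_def[abs_def])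
  have rep: "f w = set_lebesgue_integral lborel ?G (\<lambda>z. f z * cnj (sym_kernel z w))" if "f \<in> bergman_space ?G" for f
    using is_bergman_kernel_sym[where 'n = 'n] w that by (auto simp: is_bergman_kernel_def)
  have "sym_kernel w w = (\<integral>x. complex_of_real (k x) \<partial>lborel)"
    unfolding rep[OF sym_kernel_bergman_space[OF w]] set_lebesgue_integral_def k_def
    by (simp add: complex_norm_square[symmetric] scaleR_conv_of_real)
  then have eq: "sym_kernel w w = complex_of_real (\<integral>x. k x \<partial>lborel)" by simp
  have k0: "k x \<ge> 0" for x by (simp add: k_def)
  have "(\<integral>x. k x \<partial>lborel) \<noteq> 0"
  proof
    assume "(\<integral>x. k x \<partial>lborel) = 0"
    then have ae: "AE x in lborel. k x = 0" using integral_nonneg_eq_0_iff_AE[OF intk] k0 by auto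
    have "(\<lambda>z. 1) \<in> bergman_space ?G"
    proof -
      have "holomorphic_fun_on (\<lambda>z. 1) ?G" unfolding holomorphic_fun_on_def
        by (intro ballI exI[of _ 0]) auto
      moreover have "set_integrable lborel ?G (\<lambda>z. (cmod 1)\<^sup>2)"
        using emeasure_symmetrized_polydisc by (auto simp: set_integrable_def intro!: integrable_real_indicator)
      ultimately show ?thesis by (simp add: bergman_space_def)
    qed
    from rep[OF this] have "1 = (\<integral>x. indicator ?G x *\<^sub>R cnj (sym_kernel x w) \<partial>lborel)"
      by (simp add: set_lebesgue_integral_def)
    also have "\<dots> = 0"
      by (rule integral_eq_zero_AE) (use ae in \<open>auto simp: k_def\<close>)
    finally show False by simp
  qed
  moreover have "(\<integral>x. k x \<partial>lborel) \<ge> 0" using k0 by simp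
  ultimately show ?thesis using that eq by (metis less_eq_real_def)
qed

text \<open>Non-vanishing of the numerator is obtained on the diagonal, while
  \<open>denom_kernel_nonzero'\<close> covers all pairs of points.\<close>

lemma numer_kernel_diagonal_nonzero:
  assumes "\<xi> \<in> symmetrized_polydisc"
  shows "numer_kernel \<xi> (cnjv \<xi>) \<noteq> 0"
proof
  assume "numer_kernel \<xi> (cnjv \<xi>) = 0"
  then have "sym_kernel \<xi> \<xi> = 0" by (simp add: sym_kernel_def)
  then show False using sym_kernel_diagonal_pos[OF assms] by (metis less_irrefl of_real_eq_0_iff)
qed

lemma denom_kernel_nonzero':
  "\<xi> \<in> symmetrized_polydisc \<Longrightarrow> \<eta> \<in> symmetrized_polydisc \<Longrightarrow> denom_kernel \<xi> (cnjv \<eta>) \<noteq> 0"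
  using denom_kernel_nonzero by (auto simp: symmetrized_polydisc_eq)

section \<open>The Bergman metric along a holomorphic disc\<close>

lemma wirtinger_derivatives:
  fixes f :: "(complex, 'n::finite) vec \<Rightarrow> complex"
  assumes f: "(f has_derivative (\<lambda>h. (\<Sum>i\<in>UNIV. a i * h $ i) + (\<Sum>i\<in>UNIV. b i * cnj (h $ i)))) (at z)"
  shows "d_z k f z = a k" and "d_zbar k f z = b k"
proof -
  have ax: "(\<Sum>i\<in>UNIV. c i * axis k u $ i) = c k * u" "(\<Sum>i\<in>UNIV. c i * cnj (axis k u $ i)) = c k * cnj u" for c u
    by (simp_all add: axis_def if_distrib[of "\<lambda>x. _ * x"] if_distrib[of cnj] cong: if_cong)
  show "d_z k f z = a k" "d_zbar k f z = b k"
    by (simp_all add: d_z_def d_zbar_def frechet_derivative_at[OF f, symmetric] ax algebra_simps)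
qed

text \<open>The two metrics will be compared on pairs \<open>w\<close>, \<open>\<i> *s w\<close>.
  There the form is twice the Levi form, and the factor 2 cancels.\<close>

lemma i_ddbar_complex_line:
  "i_ddbar \<phi> z w (\<i> *s w) =
    2 * (\<Sum>i\<in>UNIV. \<Sum>j\<in>UNIV. d_z i (d_zbar j (\<lambda>x. complex_of_real (\<phi> x))) z * (w $ i * cnj (w $ j)))"
proof -
  have "w $ i * cnj ((\<i> *s w) $ j) - (\<i> *s w) $ i * cnj (w $ j) = (- 2 * \<i>) * (w $ i * cnj (w $ j))" for i j
    by simp
  moreover have "\<i> * (D * ((- 2 * \<i>) * X)) = 2 * (D * X)" for D X by (auto simp: complex_eq_iff)
  ultimately show ?thesis
    unfolding i_ddbar_def sum_distrib_left by (simp only:)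
qed

lemma has_derivative_cnjv: "(cnjv has_derivative cnjv) (at z)"
proof -
  have "((\<lambda>x. \<chi> i. cnj (x $ i)) has_derivative (\<lambda>h. \<chi> i. cnj (h $ i))) (at z)"
    by (intro has_derivative_vec_lambda bounded_linear_imp_has_derivative
        bounded_linear_compose[OF bounded_linear_cnj bounded_linear_vec_nth])
  then show ?thesis by (simp add: cnjv_def[abs_def])
qed

lemma euclidean_form_complex_line:
  "euclidean_form z w (\<i> *s w) = 2 * (\<Sum>j\<in>UNIV. w $ j * cnj (w $ j))"
  for z :: "(complex, 'm::finite) vec"
proof -
  let ?f = "\<lambda>x :: (complex, 'm) vec. complex_of_real (\<Sum>i\<in>UNIV. (cmod (x $ i))\<^sup>2)"
  have f: "?f = (\<lambda>x. \<Sum>i\<in>UNIV. x $ i * cnj (x $ i))"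
    by (simp add: fun_eq_iff complex_norm_square flip: of_real_power)
  have "(?f has_derivative (\<lambda>h. (\<Sum>i\<in>UNIV. cnj (x $ i) * h $ i) + (\<Sum>i\<in>UNIV. x $ i * cnj (h $ i)))) (at x)" for x
  proof -
    have "(?f has_derivative (\<lambda>h. \<Sum>i\<in>UNIV. x $ i * cnj (h $ i) + h $ i * cnj (x $ i))) (at x)"
      unfolding f
      by (intro has_derivative_sum has_derivative_mult bounded_linear_imp_has_derivative bounded_linear_vec_nth
          bounded_linear_compose[OF bounded_linear_cnj bounded_linear_vec_nth])
    then show ?thesis by (simp add: sum.distrib add.commute mult.commute)
  qed
  then have 1: "d_zbar j ?f = (\<lambda>x. x $ j)" for j
    by (intro ext wirtinger_derivatives(2)[of _ "\<lambda>i. cnj (x $ i)" "\<lambda>i. x $ i" for x])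
  have 2: "d_z i (\<lambda>x. x $ j) z = (if i = j then 1 else 0)" for i j
  proof (rule wirtinger_derivatives(1)[where b = "\<lambda>_. 0"])
    have "(\<lambda>h. h $ j) = (\<lambda>h :: (complex, 'm) vec. (\<Sum>i\<in>UNIV. (if i = j then 1 else 0) * h $ i) + (\<Sum>i\<in>UNIV. 0 * cnj (h $ i)))"
      by (simp add: if_distrib[of "\<lambda>x. x * _"] cong: if_cong)
    then show "((\<lambda>x. x $ j) has_derivative (\<lambda>h :: (complex, 'm) vec. (\<Sum>i\<in>UNIV. (if i = j then 1 else 0) * h $ i) + (\<Sum>i\<in>UNIV. 0 * cnj (h $ i)))) (at z)"
      using bounded_linear_imp_has_derivative[OF bounded_linear_vec_nth, of j "at z"] by simp
  qed
  show ?thesis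
    unfolding euclidean_form_def i_ddbar_complex_line 1 2
    by (simp add: if_distrib[of "\<lambda>x. x * _"] cong: if_cong)
qed

section \<open>The Levi form of the logarithm of the kernel\<close>

definition part1 :: "((complex, 'n::finite) vec \<Rightarrow> (complex, 'n) vec \<Rightarrow> complex) \<Rightarrow> 'n \<Rightarrow> (complex, 'n) vec \<Rightarrow> (complex, 'n) vec \<Rightarrow> complex" where
  "part1 H i \<xi> \<tau> = frechet_derivative (\<lambda>p. H (fst p) (snd p)) (at (\<xi>, \<tau>)) (axis i 1, 0)"

definition part2 :: "((complex, 'n::finite) vec \<Rightarrow> (complex, 'n) vec \<Rightarrow> complex) \<Rightarrow> 'n \<Rightarrow> (complex, 'n) vec \<Rightarrow> (complex, 'n) vec \<Rightarrow> complex" where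
  "part2 H i \<xi> \<tau> = frechet_derivative (\<lambda>p. H (fst p) (snd p)) (at (\<xi>, \<tau>)) (0, axis i 1)"

lemma poly_kernel_partials:
  assumes "poly_kernel H"
  shows "poly_kernel (part1 H i)" "poly_kernel (part2 H i)"
    "((\<lambda>p. H (fst p) (snd p)) has_derivative
       (\<lambda>h. (\<Sum>i\<in>UNIV. part1 H i \<xi> \<tau> * fst h $ i) + (\<Sum>i\<in>UNIV. part2 H i \<xi> \<tau> * snd h $ i))) (at (\<xi>, \<tau>))"
proof -
  obtain H1 H2 where H: "\<forall>i. poly_kernel (H1 i)" "\<forall>i. poly_kernel (H2 i)"
    "\<And>\<xi> \<tau>. ((\<lambda>p. H (fst p) (snd p)) has_derivative
       (\<lambda>h. (\<Sum>i\<in>UNIV. H1 i \<xi> \<tau> * fst h $ i) + (\<Sum>i\<in>UNIV. H2 i \<xi> \<tau> * snd h $ i))) (at (\<xi>, \<tau>))"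
    using poly_kernel_has_derivative[OF assms] by blast
  have ax: "(\<Sum>i\<in>UNIV. c i * axis k 1 $ i) = c k" for c :: "'a \<Rightarrow> complex" and k
    by (simp add: axis_def if_distrib[of "\<lambda>x. _ * x"] cong: if_cong)
  have "part1 H = H1" "part2 H = H2"
    by (simp_all add: fun_eq_iff part1_def part2_def frechet_derivative_at[OF H(3), symmetric] ax)
  then show "poly_kernel (part1 H i)" "poly_kernel (part2 H i)"
    "((\<lambda>p. H (fst p) (snd p)) has_derivative
       (\<lambda>h. (\<Sum>i\<in>UNIV. part1 H i \<xi> \<tau> * fst h $ i) + (\<Sum>i\<in>UNIV. part2 H i \<xi> \<tau> * snd h $ i))) (at (\<xi>, \<tau>))"
    using H by auto
qed

text \<open>Normal form of a real-linear functional by its complex-linear and antilinear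
  coefficients, from which the Wirtinger derivatives are read off.\<close>

definition wirt :: "('n \<Rightarrow> complex) \<Rightarrow> ('n \<Rightarrow> complex) \<Rightarrow> (complex, 'n::finite) vec \<Rightarrow> complex" where
  "wirt a b h = (\<Sum>i\<in>UNIV. a i * h $ i) + (\<Sum>i\<in>UNIV. b i * cnj (h $ i))"

lemma wirt_scale: "c * wirt a b h = wirt (\<lambda>i. c * a i) (\<lambda>i. c * b i) h"
  by (simp add: wirt_def sum_distrib_left distrib_left mult.assoc)

lemma wirt_diff: "wirt a b h - wirt a' b' h = wirt (\<lambda>i. a i - a' i) (\<lambda>i. b i - b' i) h"
  by (simp add: wirt_def sum_subtractf left_diff_distrib)

lemma poly_kernel_diagonal_derivative:
  assumes "poly_kernel H"
  shows "((\<lambda>x. H x (cnjv x)) has_derivative wirt (\<lambda>i. part1 H i z (cnjv z)) (\<lambda>i. part2 H i z (cnjv z))) (at z)"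
proof -
  have p: "((\<lambda>x. (x, cnjv x)) has_derivative (\<lambda>h. (h, cnjv h))) (at z)"
    by (intro has_derivative_Pair has_derivative_ident has_derivative_cnjv)
  show ?thesis using has_derivative_compose[OF p poly_kernel_partials(3)[OF assms]]
    by (simp add: wirt_def[abs_def])
qed

text \<open>The derivative of \<open>log (N / M^2)\<close> in the conjugate of coordinate
  \<open>j\<close>; the constant volume factor has dropped out.\<close>

definition log_kernel_dbar :: "'n \<Rightarrow> (complex, 'n::{finite,linorder}) vec \<Rightarrow> complex" where
  "log_kernel_dbar j x = part2 numer_kernel j x (cnjv x) / numer_kernel x (cnjv x)
     - 2 * (part2 denom_kernel j x (cnjv x) / denom_kernel x (cnjv x))"

text \<open>The mixed derivative of \<open>log H\<close> in coordinate \<open>i\<close> and the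
  conjugate of coordinate \<open>j\<close>, on the diagonal.\<close>

definition log_hessian :: "((complex, 'n::finite) vec \<Rightarrow> (complex, 'n) vec \<Rightarrow> complex) \<Rightarrow> 'n \<Rightarrow> 'n \<Rightarrow> (complex, 'n) vec \<Rightarrow> complex" where
  "log_hessian H i j x = (part1 (part2 H j) i x (cnjv x) * H x (cnjv x) - part1 H i x (cnjv x) * part2 H j x (cnjv x)) / (H x (cnjv x))\<^sup>2"

text \<open>On the diagonal the kernel is a positive real number, so the real logarithm can be
  exchanged on the whole open domain for the complex \<open>Ln\<close> of a quotient, to which the
  chain rule applies.\<close>

lemma d_zbar_log_bergman:
  fixes z :: "(complex, 'n::{finite,linorder}) vec"
  assumes z: "z \<in> symmetrized_polydisc"
  shows "d_zbar j (\<lambda>x. complex_of_real (ln (Re (bergman_kernel symmetrized_polydisc x x)))) z = log_kernel_dbar j z"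
proof -
  let ?G = "symmetrized_polydisc :: (complex, 'n) vec set"
  let ?v = "complex_of_real (measure lborel (polydisc :: (complex, 'n) vec set))"
  let ?N = "\<lambda>x :: (complex, 'n) vec. numer_kernel x (cnjv x)" and ?M = "\<lambda>x :: (complex, 'n) vec. denom_kernel x (cnjv x)"
  let ?dN = "wirt (\<lambda>i. part1 numer_kernel i z (cnjv z)) (\<lambda>i. part2 numer_kernel i z (cnjv z))"
  let ?dM = "wirt (\<lambda>i. part1 denom_kernel i z (cnjv z)) (\<lambda>i. part2 denom_kernel i z (cnjv z))"
  have v0: "?v \<noteq> 0" using measure_polydisc_pos[where 'n = 'n] by simp
  have N0: "?N z \<noteq> 0" by (rule numer_kernel_diagonal_nonzero[OF z])
  have M0: "?M z \<noteq> 0" by (rule denom_kernel_nonzero'[OF z z])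
  define Q where "Q x = ?N x / (?v * (?M x)\<^sup>2)" for x
  have Qs: "Q x = sym_kernel x x" for x by (simp add: Q_def sym_kernel_def)
  have LnQ: "complex_of_real (ln (Re (bergman_kernel ?G x x))) = Ln (Q x)" and Qpos: "Q x \<notin> \<real>\<^sub>\<le>\<^sub>0" if x: "x \<in> ?G" for x
  proof -
    obtain r where r: "r > 0" "sym_kernel x x = complex_of_real r" using sym_kernel_diagonal_pos[OF x] by blast
    show "complex_of_real (ln (Re (bergman_kernel ?G x x))) = Ln (Q x)"
      using r by (simp add: bergman_kernel_symmetrized_polydisc[OF x x] Qs Ln_of_real)
    show "Q x \<notin> \<real>\<^sub>\<le>\<^sub>0" using r by (simp add: Qs)
  qed
  have dD: "((\<lambda>x. ?v * (?M x)\<^sup>2) has_derivative (\<lambda>h. ?v * (?M z * ?dM h + ?dM h * ?M z))) (at z)"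
    unfolding power2_eq_square
    by (intro has_derivative_mult_right has_derivative_mult poly_kernel_diagonal_derivative poly_kernel_denom)
  have dQ: "(Q has_derivative (\<lambda>h. (?dN h * (?v * (?M z)\<^sup>2) - ?N z * (?v * (?M z * ?dM h + ?dM h * ?M z))) / ((?v * (?M z)\<^sup>2) * (?v * (?M z)\<^sup>2)))) (at z)"
    unfolding Q_def
    by (rule has_derivative_divide'[OF poly_kernel_diagonal_derivative[OF poly_kernel_numer] dD]) (use v0 M0 in simp)
  have "(Ln has_derivative (\<lambda>h. inverse (Q z) * h)) (at (Q z))"
    using has_field_derivative_Ln[OF Qpos[OF z]] by (simp add: has_field_derivative_def)
  from has_derivative_compose[OF dQ this]
  have "((\<lambda>x. Ln (Q x)) has_derivative (\<lambda>h. inverse (Q z) * ((?dN h * (?v * (?M z)\<^sup>2) - ?N z * (?v * (?M z * ?dM h + ?dM h * ?M z))) / ((?v * (?M z)\<^sup>2) * (?v * (?M z)\<^sup>2))))) (at z)" .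
  also have "(\<lambda>h. inverse (Q z) * ((?dN h * (?v * (?M z)\<^sup>2) - ?N z * (?v * (?M z * ?dM h + ?dM h * ?M z))) / ((?v * (?M z)\<^sup>2) * (?v * (?M z)\<^sup>2)))) =
      (\<lambda>h. inverse (?N z) * ?dN h - (2 * inverse (?M z)) * ?dM h)"
  proof
    fix h
    have gen: "inverse (n / (v * m\<^sup>2)) * ((dn * (v * m\<^sup>2) - n * (v * (m * dm + dm * m))) / ((v * m\<^sup>2) * (v * m\<^sup>2))) = inverse n * dn - (2 * inverse m) * dm"
      if "n \<noteq> 0" "v \<noteq> 0" "m \<noteq> 0" for n v m dn dm :: complex
      using that by (simp add: field_simps power2_eq_square)
    show "inverse (Q z) * ((?dN h * (?v * (?M z)\<^sup>2) - ?N z * (?v * (?M z * ?dM h + ?dM h * ?M z))) / ((?v * (?M z)\<^sup>2) * (?v * (?M z)\<^sup>2))) =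
      inverse (?N z) * ?dN h - (2 * inverse (?M z)) * ?dM h"
      unfolding Q_def by (rule gen[OF N0 v0 M0])
  qed
  also have "\<dots> = wirt (\<lambda>i. inverse (?N z) * part1 numer_kernel i z (cnjv z) - 2 * inverse (?M z) * part1 denom_kernel i z (cnjv z))
      (\<lambda>i. inverse (?N z) * part2 numer_kernel i z (cnjv z) - 2 * inverse (?M z) * part2 denom_kernel i z (cnjv z))"
    unfolding wirt_scale wirt_diff ..
  finally have "((\<lambda>x. complex_of_real (ln (Re (bergman_kernel ?G x x)))) has_derivative
     wirt (\<lambda>i. inverse (?N z) * part1 numer_kernel i z (cnjv z) - 2 * inverse (?M z) * part1 denom_kernel i z (cnjv z))
      (\<lambda>i. inverse (?N z) * part2 numer_kernel i z (cnjv z) - 2 * inverse (?M z) * part2 denom_kernel i z (cnjv z))) (at z)"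
    by (rule has_derivative_transform_within_open[OF _ open_symmetrized_polydisc z]) (simp add: LnQ)
  from wirtinger_derivatives(2)[OF this[unfolded wirt_def]]
  show ?thesis by (simp add: log_kernel_dbar_def divide_inverse mult_ac)
qed

lemma d_z_quotient:
  assumes A: "poly_kernel A" and H: "poly_kernel H" and nz: "H z (cnjv z) \<noteq> 0"
  shows "((\<lambda>x. A x (cnjv x) / H x (cnjv x)) has_derivative
    wirt (\<lambda>i. (part1 A i z (cnjv z) * H z (cnjv z) - part1 H i z (cnjv z) * A z (cnjv z)) / (H z (cnjv z))\<^sup>2)
      (\<lambda>i. (part2 A i z (cnjv z) * H z (cnjv z) - part2 H i z (cnjv z) * A z (cnjv z)) / (H z (cnjv z))\<^sup>2)) (at z)"
proof -
  let ?a = "A z (cnjv z)" and ?h = "H z (cnjv z)"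
  let ?dA = "wirt (\<lambda>i. part1 A i z (cnjv z)) (\<lambda>i. part2 A i z (cnjv z))"
  let ?dH = "wirt (\<lambda>i. part1 H i z (cnjv z)) (\<lambda>i. part2 H i z (cnjv z))"
  have "((\<lambda>x. A x (cnjv x) / H x (cnjv x)) has_derivative (\<lambda>h. (?dA h * ?h - ?a * ?dH h) / (?h * ?h))) (at z)"
    by (rule has_derivative_divide'[OF poly_kernel_diagonal_derivative[OF A] poly_kernel_diagonal_derivative[OF H] nz])
  also have "(\<lambda>h. (?dA h * ?h - ?a * ?dH h) / (?h * ?h)) = (\<lambda>h. (?h / ?h\<^sup>2) * ?dA h - (?a / ?h\<^sup>2) * ?dH h)"
    by (simp add: fun_eq_iff power2_eq_square diff_divide_distrib mult.commute)
  finally show ?thesis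
    unfolding wirt_scale wirt_diff by (simp add: diff_divide_distrib mult_ac)
qed

lemma d_z_log_kernel_dbar:
  fixes z :: "(complex, 'n::{finite,linorder}) vec"
  assumes z: "z \<in> symmetrized_polydisc"
  shows "d_z i (d_zbar j (\<lambda>x. complex_of_real (ln (Re (bergman_kernel symmetrized_polydisc x x))))) z =
    log_hessian numer_kernel i j z - 2 * log_hessian denom_kernel i j z"
proof -
  let ?q = "\<lambda>H i. (part1 (part2 H j) i z (cnjv z) * H z (cnjv z) - part1 H i z (cnjv z) * part2 H j z (cnjv z)) / (H z (cnjv z))\<^sup>2"
  let ?q' = "\<lambda>H i. (part2 (part2 H j) i z (cnjv z) * H z (cnjv z) - part2 H i z (cnjv z) * part2 H j z (cnjv z)) / (H z (cnjv z))\<^sup>2"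
  have "(log_kernel_dbar j has_derivative (\<lambda>h. wirt (?q numer_kernel) (?q' numer_kernel) h - 2 * wirt (?q denom_kernel) (?q' denom_kernel) h)) (at z)"
    unfolding log_kernel_dbar_def
    by (intro has_derivative_diff has_derivative_mult_right d_z_quotient poly_kernel_partials poly_kernel_numer poly_kernel_denom
        numer_kernel_diagonal_nonzero denom_kernel_nonzero' z)
  then have "(d_zbar j (\<lambda>x. complex_of_real (ln (Re (bergman_kernel symmetrized_polydisc x x)))) has_derivative
      (\<lambda>h. wirt (?q numer_kernel) (?q' numer_kernel) h - 2 * wirt (?q denom_kernel) (?q' denom_kernel) h)) (at z)"
    by (rule has_derivative_transform_within_open[OF _ open_symmetrized_polydisc z]) (simp add: d_zbar_log_bergman)
  from wirtinger_derivatives(1)[OF this[unfolded wirt_scale wirt_diff, unfolded wirt_def]]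
  show ?thesis by (simp add: log_hessian_def)
qed

lemma bergman_form_complex_line:
  fixes z :: "(complex, 'n::{finite,linorder}) vec"
  assumes z: "z \<in> symmetrized_polydisc"
  shows "bergman_form symmetrized_polydisc z w (\<i> *s w) =
    2 * (\<Sum>i\<in>UNIV. \<Sum>j\<in>UNIV. (log_hessian numer_kernel i j z - 2 * log_hessian denom_kernel i j z) * (w $ i * cnj (w $ j)))"
  unfolding bergman_form_def i_ddbar_complex_line d_z_log_kernel_dbar[OF z] ..

section \<open>Restriction to a holomorphic curve\<close>

lemma sep_kernel_pullback:
  assumes "poly_kernel H" "\<And>i. (\<lambda>z. g z $ i) holomorphic_on D" "\<And>i. (\<lambda>z. g' z $ i) holomorphic_on D"
  shows "sep_kernel D (\<lambda>z s. H (g z) (g' s))"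
  using assms(1)
  by (induction rule: poly_kernel.induct)
    (auto intro: sep_kernel_add sep_kernel_mult sep_kernel_const sep_kernel_fst sep_kernel_snd assms)

lemma holomorphic_has_derivative_vec:
  fixes g :: "complex \<Rightarrow> (complex, 'n::finite) vec"
  assumes "open D" "\<And>i. (\<lambda>z. g z $ i) holomorphic_on D" "z \<in> D"
  shows "(g has_derivative (\<lambda>h. \<chi> i. deriv (\<lambda>z. g z $ i) z * h)) (at z)"
proof -
  have "((\<lambda>z. \<chi> i. g z $ i) has_derivative (\<lambda>h. \<chi> i. deriv (\<lambda>z. g z $ i) z * h)) (at z)"
    using holomorphic_derivI[OF assms(2,1,3)] by (intro has_derivative_vec_lambda) (simp add: has_field_derivative_def)
  then show ?thesis by simp
qed

lemma dz_pullback: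
  fixes g g' :: "complex \<Rightarrow> (complex, 'n::finite) vec"
  assumes H: "poly_kernel H" and D: "open D" and g: "\<And>i. (\<lambda>z. g z $ i) holomorphic_on D" and z: "z \<in> D"
  shows "((\<lambda>z. H (g z) \<tau>) has_field_derivative (\<Sum>i\<in>UNIV. part1 H i (g z) \<tau> * deriv (\<lambda>z. g z $ i) z)) (at z)"
    and "((\<lambda>z. H \<tau> (g z)) has_field_derivative (\<Sum>i\<in>UNIV. part2 H i \<tau> (g z) * deriv (\<lambda>z. g z $ i) z)) (at z)"
proof -
  note dg = holomorphic_has_derivative_vec[OF D g z]
  have 1: "((\<lambda>z. (g z, \<tau>)) has_derivative (\<lambda>h. (\<chi> i. deriv (\<lambda>z. g z $ i) z * h, 0))) (at z)"
    by (intro has_derivative_Pair dg has_derivative_const)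
  have 2: "((\<lambda>z. (\<tau>, g z)) has_derivative (\<lambda>h. (0, \<chi> i. deriv (\<lambda>z. g z $ i) z * h))) (at z)"
    by (intro has_derivative_Pair dg has_derivative_const)
  show "((\<lambda>z. H (g z) \<tau>) has_field_derivative (\<Sum>i\<in>UNIV. part1 H i (g z) \<tau> * deriv (\<lambda>z. g z $ i) z)) (at z)"
    unfolding has_field_derivative_def
    by (rule has_derivative_eq_rhs[OF has_derivative_compose[OF 1 poly_kernel_partials(3)[OF H], unfolded fst_conv snd_conv]])
      (simp add: fun_eq_iff sum_distrib_right mult.assoc)
  show "((\<lambda>z. H \<tau> (g z)) has_field_derivative (\<Sum>i\<in>UNIV. part2 H i \<tau> (g z) * deriv (\<lambda>z. g z $ i) z)) (at z)"
    unfolding has_field_derivative_def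
    by (rule has_derivative_eq_rhs[OF has_derivative_compose[OF 2 poly_kernel_partials(3)[OF H], unfolded fst_conv snd_conv]])
      (simp add: fun_eq_iff sum_distrib_right mult.assoc)
qed

text \<open>Chain rule in both slots: \<open>z\<close> enters the first through \<open>g\<close>,
  and \<open>s\<close> enters the second through the reflected curve \<open>g'\<close>, whose
  derivative at \<open>cnj z\<close> is the conjugate of that of \<open>g\<close> at
  \<open>z\<close>.\<close>

lemma log_hessian_pullback:
  fixes g :: "complex \<Rightarrow> (complex, 'n::finite) vec"
  defines "g' \<equiv> \<lambda>s. cnjv (g (cnj s))"
  assumes H: "poly_kernel H" and g: "\<And>i. (\<lambda>z. g z $ i) holomorphic_on ball 0 r" and g': "\<And>i. (\<lambda>z. g' z $ i) holomorphic_on ball 0 r"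
    and z: "z \<in> ball 0 r" and s: "s = cnj z"
  defines "K \<equiv> \<lambda>z s. H (g z) (g' s)"
  shows "(\<Sum>i\<in>UNIV. \<Sum>j\<in>UNIV. log_hessian H i j (g z) * (deriv (\<lambda>z. g z $ i) z * cnj (deriv (\<lambda>z. g z $ j) z))) =
    (dz_kernel (ds_kernel K) z s * K z s - dz_kernel K z s * ds_kernel K z s) / (K z s)\<^sup>2"
proof -
  let ?D = "ball (0::complex) r"
  let ?d = "\<lambda>i. deriv (\<lambda>z. g z $ i) z"
  have sD: "s \<in> ?D" using z s by simp
  have gs: "g' s = cnjv (g z)" by (simp add: g'_def s)
  have dg': "deriv (\<lambda>z. g' z $ j) s = cnj (?d j)" for j
  proof (rule DERIV_imp_deriv)
    have d: "((\<lambda>z. g z $ j) has_field_derivative ?d j) (at (cnj s))"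
      using holomorphic_derivI[OF g open_ball z] by (simp add: s)
    have "(cnj \<circ> (\<lambda>z. g z $ j) \<circ> cnj has_field_derivative cnj (?d j)) (at s)"
      by (rule has_field_derivative_cnj_cnj[OF d])
    then show "((\<lambda>z. g' z $ j) has_field_derivative cnj (?d j)) (at s)"
      by (simp add: g'_def o_def)
  qed
  have dzK: "dz_kernel K z s = (\<Sum>i\<in>UNIV. part1 H i (g z) (cnjv (g z)) * ?d i)"
    unfolding dz_kernel_def K_def using DERIV_imp_deriv[OF dz_pullback(1)[OF H open_ball g z, of "g' s"]] by (simp add: gs)
  have dsK: "ds_kernel K z' s = (\<Sum>j\<in>UNIV. part2 H j (g z') (g' s) * cnj (?d j))" for z'
    unfolding ds_kernel_def K_def using DERIV_imp_deriv[OF dz_pullback(2)[OF H open_ball g' sD, of "g z'"]] by (simp add: dg')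
  have "((\<lambda>z'. ds_kernel K z' s) has_field_derivative
      (\<Sum>j\<in>UNIV. (\<Sum>i\<in>UNIV. part1 (part2 H j) i (g z) (g' s) * ?d i) * cnj (?d j))) (at z)"
    unfolding dsK by (intro DERIV_sum DERIV_cmult_right dz_pullback(1)[OF _ open_ball g z] poly_kernel_partials H)
  then have "dz_kernel (ds_kernel K) z s = (\<Sum>j\<in>UNIV. (\<Sum>i\<in>UNIV. part1 (part2 H j) i (g z) (g' s) * ?d i) * cnj (?d j))"
    unfolding dz_kernel_def by (rule DERIV_imp_deriv)
  also have "\<dots> = (\<Sum>i\<in>UNIV. \<Sum>j\<in>UNIV. part1 (part2 H j) i (g z) (cnjv (g z)) * (?d i * cnj (?d j)))"
    unfolding gs sum_distrib_right by (subst sum.swap) (simp only: mult.assoc)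
  finally have dzs: "dz_kernel (ds_kernel K) z s = (\<Sum>i\<in>UNIV. \<Sum>j\<in>UNIV. part1 (part2 H j) i (g z) (cnjv (g z)) * (?d i * cnj (?d j)))" .
  have prod: "dz_kernel K z s * ds_kernel K z s = (\<Sum>i\<in>UNIV. \<Sum>j\<in>UNIV. (part1 H i (g z) (cnjv (g z)) * part2 H j (g z) (cnjv (g z))) * (?d i * cnj (?d j)))"
    unfolding dzK dsK gs sum_product by (intro sum.cong refl) (simp only: mult_ac)
  have K: "K z s = H (g z) (cnjv (g z))" by (simp add: K_def gs)
  show ?thesis
    unfolding dzs prod K log_hessian_def sum_distrib_right sum_subtractf[symmetric] sum_divide_distrib
    by (intro sum.cong refl) (simp add: algebra_simps)
qed

lemma holomorphic_map_has_derivative: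
  fixes F :: "(complex, 'd::finite) vec \<Rightarrow> (complex, 'm::finite) vec"
  assumes F: "holomorphic_map_on F S" and z: "z \<in> S"
  obtains a :: "'m \<Rightarrow> (complex, 'd) vec" where "(F has_derivative (\<lambda>v. \<chi> j. \<Sum>i\<in>UNIV. a j $ i * v $ i)) (at z)"
    "\<And>j. ((\<lambda>z. F z $ j) has_derivative (\<lambda>v. \<Sum>i\<in>UNIV. a j $ i * v $ i)) (at z)"
proof -
  have "\<exists>a :: (complex, 'd) vec. ((\<lambda>z. F z $ j) has_derivative (\<lambda>v. \<Sum>i\<in>UNIV. a $ i * v $ i)) (at z)" for j
    using F z by (auto simp: holomorphic_map_on_def holomorphic_fun_on_def)
  then obtain a :: "'m \<Rightarrow> (complex, 'd) vec" where a: "\<And>j. ((\<lambda>z. F z $ j) has_derivative (\<lambda>v. \<Sum>i\<in>UNIV. a j $ i * v $ i)) (at z)"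
    by metis
  have "((\<lambda>z. \<chi> j. F z $ j) has_derivative (\<lambda>v. \<chi> j. \<Sum>i\<in>UNIV. a j $ i * v $ i)) (at z)"
    by (intro has_derivative_vec_lambda a)
  then show ?thesis using that a by simp
qed

definition line_at :: "(complex, 'd) vec \<Rightarrow> 'd \<Rightarrow> complex \<Rightarrow> (complex, 'd::finite) vec" where
  "line_at z k t = z + axis k t"

lemma has_derivative_line_at: "(line_at z k has_derivative (\<lambda>h. axis k h)) (at t)"
proof -
  have "((\<lambda>t. \<chi> i. if i = k then t else 0) has_derivative (\<lambda>h :: complex. \<chi> i. if i = k then h else 0)) (at t)"
  proof (rule has_derivative_vec_lambda)
    fix i show "((\<lambda>t. if i = k then t else 0) has_derivative (\<lambda>h :: complex. if i = k then h else 0)) (at t)"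
      by (cases "i = k") (auto intro!: derivative_eq_intros)
  qed
  then have "((\<lambda>t. axis k t) has_derivative (\<lambda>h :: complex. axis k h)) (at t)"
    by (simp add: axis_def)
  then show ?thesis unfolding line_at_def by (auto intro!: derivative_eq_intros)
qed

lemma dist_line_at: "dist (line_at z k t) z = cmod t"
proof -
  have "(\<Sum>i\<in>UNIV. (cmod (axis k t $ i))\<^sup>2) = (cmod t)\<^sup>2"
    by (simp add: axis_def if_distrib[of "\<lambda>x. (cmod x)\<^sup>2"] cong: if_cong)
  then show ?thesis by (simp add: line_at_def dist_norm norm_vec_def L2_set_def)
qed

lemma holomorphic_map_on_line:
  fixes F :: "(complex, 'd::finite) vec \<Rightarrow> (complex, 'm::finite) vec"
  assumes F: "holomorphic_map_on F S" and t: "line_at z k t \<in> S"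
  shows "((\<lambda>t. F (line_at z k t) $ j) has_field_derivative (frechet_derivative F (at (line_at z k t)) (axis k 1) $ j)) (at t)"
    and "frechet_derivative F (at (line_at z k t)) (\<i> *s axis k 1) = \<i> *s frechet_derivative F (at (line_at z k t)) (axis k 1)"
proof -
  obtain a :: "'m \<Rightarrow> (complex, 'd) vec" where
    a: "(F has_derivative (\<lambda>v. \<chi> j. \<Sum>i\<in>UNIV. a j $ i * v $ i)) (at (line_at z k t))"
    and aj: "\<And>j. ((\<lambda>z. F z $ j) has_derivative (\<lambda>v. \<Sum>i\<in>UNIV. a j $ i * v $ i)) (at (line_at z k t))"
    using holomorphic_map_has_derivative[OF F t] by blast
  have fd: "frechet_derivative F (at (line_at z k t)) = (\<lambda>v. \<chi> j. \<Sum>i\<in>UNIV. a j $ i * v $ i)"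
    using frechet_derivative_at[OF a] by simp
  have ax: "(\<Sum>i\<in>UNIV. a j $ i * axis k c $ i) = a j $ k * c" for j c
    by (simp add: axis_def if_distrib[of "\<lambda>x. _ * x"] cong: if_cong)
  have "((\<lambda>t. F (line_at z k t) $ j) has_derivative (\<lambda>h. \<Sum>i\<in>UNIV. a j $ i * axis k h $ i)) (at t)"
    by (rule has_derivative_compose[OF has_derivative_line_at aj])
  then show "((\<lambda>t. F (line_at z k t) $ j) has_field_derivative (frechet_derivative F (at (line_at z k t)) (axis k 1) $ j)) (at t)"
    unfolding has_field_derivative_def fd by (simp add: ax)
  show "frechet_derivative F (at (line_at z k t)) (\<i> *s axis k 1) = \<i> *s frechet_derivative F (at (line_at z k t)) (axis k 1)"
    unfolding fd by (simp add: vec_eq_iff sum_distrib_left mult_ac)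
qed

text \<open>Restricted to a coordinate line through \<open>z0\<close>, the equality of forms becomes
  the hypothesis \<open>diag\<close> of \<open>no_log_ratio_potential\<close>. Its conclusion
  annihilates the derivative of \<open>F\<close> along that line, against injectivity.\<close>

lemma no_common_disc:
  fixes F :: "(complex, 'd::finite) vec \<Rightarrow> (complex, 'm::finite) vec"
    and G :: "(complex, 'd) vec \<Rightarrow> (complex, 'n::{finite,linorder}) vec"
  assumes S: "open S" "z0 \<in> S" and F: "holomorphic_map_on F S" and G: "holomorphic_map_on G S"
    and GS: "\<And>z. z \<in> S \<Longrightarrow> G z \<in> symmetrized_polydisc"
    and inj: "inj (frechet_derivative F (at z0))"
    and eq: "\<And>z. z \<in> S \<Longrightarrow> pullback_form F euclidean_form z = pullback_form G (bergman_form symmetrized_polydisc) z"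
  shows False
proof -
  \<comment> \<open>Some coordinate direction; which one is immaterial.\<close>
  define k :: 'd where "k = undefined"
  obtain r0 where r0: "r0 > 0" "ball z0 r0 \<subseteq> S" using S by (meson open_contains_ball)
  define l where "l = line_at z0 k"
  have lS: "l t \<in> S" if "cmod t < r0" for t
  proof -
    have "dist (l t) z0 < r0" using that by (simp add: l_def dist_line_at)
    then show ?thesis using r0(2) by (auto simp: dist_commute)
  qed
  define f where "f j t = F (l t) $ j" for j t
  define g where "g t = G (l t)" for t
  \<comment> \<open>The reflected curve: holomorphic in \<open>s\<close>, and equal to the conjugate
    of \<open>g z\<close> at \<open>s = cnj z\<close>.\<close>
  define g' where "g' s = cnjv (g (cnj s))" for s
  let ?dF = "\<lambda>t. frechet_derivative F (at (l t)) (axis k 1)" and ?dG = "\<lambda>t. frechet_derivative G (at (l t)) (axis k 1)"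
  have df: "(f j has_field_derivative ?dF t $ j) (at t)" if "cmod t < r0" for j t
    using holomorphic_map_on_line(1)[OF F lS[OF that, unfolded l_def]] by (simp add: f_def[abs_def] l_def)
  have dg: "((\<lambda>t. g t $ j) has_field_derivative ?dG t $ j) (at t)" if "cmod t < r0" for j t
    using holomorphic_map_on_line(1)[OF G lS[OF that, unfolded l_def]] by (simp add: g_def l_def)
  have gG: "g t \<in> symmetrized_polydisc" if "cmod t < r0" for t using GS lS[OF that] by (simp add: g_def)
  have hol_g0: "(\<lambda>t. g t $ j) holomorphic_on ball 0 r0" for j
    unfolding holomorphic_on_open[OF open_ball] using dg by (meson mem_ball_0)
  have hol_g'0: "(\<lambda>t. g' t $ j) holomorphic_on ball 0 r0" for j
  proof -
    have "cnj ` ball 0 r0 = ball 0 r0" by (auto simp: image_iff intro!: bexI[of _ "cnj _"])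
    then have "cnj \<circ> (\<lambda>t. g t $ j) \<circ> cnj holomorphic_on ball 0 r0"
      using hol_g0 by (intro holomorphic_on_compose_cnj_cnj) auto
    then show ?thesis by (simp add: g'_def o_def)
  qed
  define N where "N z s = numer_kernel (g z) (g' s)" for z s
  define M where "M z s = denom_kernel (g z) (g' s)" for z s
  have "continuous_on (ball 0 r0 \<times> ball 0 r0) (\<lambda>p. N (fst p) (snd p))"
  proof -
    have c: "continuous_on (ball 0 r0) g" "continuous_on (ball 0 r0) g'"
      using hol_g0 hol_g'0 holomorphic_on_imp_continuous_on continuous_on_vec_lambda[of "ball 0 r0" "\<lambda>j t. g t $ j"]
        continuous_on_vec_lambda[of "ball 0 r0" "\<lambda>j t. g' t $ j"] by auto
    show ?thesis unfolding N_def
      by (intro poly_kernel_continuous[OF poly_kernel_numer] continuous_on_compose2[OF c(1)] continuous_on_compose2[OF c(2)])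
        (auto intro!: continuous_intros)
  qed
  moreover have N00: "N 0 0 \<noteq> 0"
    using numer_kernel_diagonal_nonzero[OF gG[of 0]] r0 by (simp add: N_def g'_def)
  moreover have "(0, 0) \<in> ball (0::complex) r0 \<times> ball (0::complex) r0" "cmod (N 0 0) > 0" using r0 N00 by auto
  ultimately obtain e where e: "e > 0"
    "\<And>p. p \<in> ball 0 r0 \<times> ball 0 r0 \<Longrightarrow> dist p (0, 0) < e \<Longrightarrow> dist (N (fst p) (snd p)) (N 0 0) < cmod (N 0 0)"
    unfolding continuous_on_iff by (metis fst_conv snd_conv)
  \<comment> \<open>Half of \<open>e\<close>, because the distance of \<open>(z, s)\<close> from the
    origin is at most \<open>cmod z + cmod s\<close>. On the smaller disc the polarized numerator
    has no zero.\<close>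
  define r where "r = min r0 (e / 2)"
  have r: "r > 0" "r \<le> r0" using r0 e by (auto simp: r_def)
  have sub: "ball 0 r \<subseteq> ball (0::complex) r0" using r by auto
  have lt: "cmod t < r0" if "t \<in> ball 0 r" for t using that r by auto
  have N0: "N z s \<noteq> 0" if "z \<in> ball 0 r" "s \<in> ball 0 r" for z s
  proof -
    have "dist (z, s) (0, 0) \<le> cmod z + cmod s"
      using norm_Pair_le[of z s] by (simp add: dist_norm)
    also have "\<dots> < e" using that by (auto simp: r_def)
    finally have "dist (N z s) (N 0 0) < cmod (N 0 0)" using e(2)[of "(z, s)"] lt[OF that(1)] lt[OF that(2)] by simp
    then show ?thesis by auto
  qed
  have M0: "M z s \<noteq> 0" if "z \<in> ball 0 r" "s \<in> ball 0 r" for z s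
    using denom_kernel_nonzero'[OF gG[OF lt[OF that(1)]] gG[of "cnj s"]] lt[OF that(2)] by (simp add: M_def g'_def)
  note hol_g = holomorphic_on_subset[OF hol_g0 sub] and hol_g' = holomorphic_on_subset[OF hol_g'0 sub]
  have sepN: "sep_kernel (ball 0 r) N" unfolding N_def[abs_def] by (rule sep_kernel_pullback[OF poly_kernel_numer hol_g hol_g'])
  have sepM: "sep_kernel (ball 0 r) M" unfolding M_def[abs_def] by (rule sep_kernel_pullback[OF poly_kernel_denom hol_g hol_g'])
  have hol_f: "f j holomorphic_on ball 0 r" for j
    unfolding holomorphic_on_open[OF open_ball] using df lt by blast
  have diag: "(\<Sum>j\<in>UNIV. deriv (f j) z * cnj (deriv (f j) z)) =
        (dz_kernel (ds_kernel N) z s * N z s - dz_kernel N z s * ds_kernel N z s) / (N z s)\<^sup>2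
        - 2 * ((dz_kernel (ds_kernel M) z s * M z s - dz_kernel M z s * ds_kernel M z s) / (M z s)\<^sup>2)"
    if z: "z \<in> ball 0 r" and s: "s = cnj z" for z s
  proof -
    have dF: "?dF z $ j = deriv (f j) z" and dG: "?dG z $ i = deriv (\<lambda>t. g t $ i) z" for i j
      using DERIV_imp_deriv[OF df[OF lt[OF z]], of j] DERIV_imp_deriv[OF dg[OF lt[OF z]], of i] by auto
    have lz: "l z \<in> S" by (rule lS[OF lt[OF z]])
    \<comment> \<open>Both differentials commute with multiplication by \<open>\<i>\<close>, so the
      forms are evaluated at a tangent vector and its multiple by \<open>\<i>\<close> on either
      side.\<close>
    have "euclidean_form (F (l z)) (?dF z) (\<i> *s ?dF z) = bergman_form symmetrized_polydisc (G (l z)) (?dG z) (\<i> *s ?dG z)"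
      using fun_cong[OF fun_cong[OF eq[OF lz], of "axis k 1"], of "\<i> *s axis k 1"]
        holomorphic_map_on_line(2)[OF F lz[unfolded l_def]] holomorphic_map_on_line(2)[OF G lz[unfolded l_def]]
      by (simp add: pullback_form_def l_def)
    then have "(\<Sum>j\<in>UNIV. deriv (f j) z * cnj (deriv (f j) z)) =
      (\<Sum>i\<in>UNIV. \<Sum>j\<in>UNIV. (log_hessian numer_kernel i j (g z) - 2 * log_hessian denom_kernel i j (g z)) * (?dG z $ i * cnj (?dG z $ j)))"
      unfolding euclidean_form_complex_line bergman_form_complex_line[OF GS[OF lz]] by (simp add: dF g_def)
    also have "\<dots> = (\<Sum>i\<in>UNIV. \<Sum>j\<in>UNIV. log_hessian numer_kernel i j (g z) * (deriv (\<lambda>t. g t $ i) z * cnj (deriv (\<lambda>t. g t $ j) z)))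
      - 2 * (\<Sum>i\<in>UNIV. \<Sum>j\<in>UNIV. log_hessian denom_kernel i j (g z) * (deriv (\<lambda>t. g t $ i) z * cnj (deriv (\<lambda>t. g t $ j) z)))"
      unfolding dG by (simp only: left_diff_distrib sum_subtractf sum_distrib_left mult.assoc)
    finally show ?thesis
      unfolding N_def[abs_def] M_def[abs_def] g'_def
      by (simp only: log_hessian_pullback[OF poly_kernel_numer hol_g hol_g'[unfolded g'_def] z s]
          log_hessian_pullback[OF poly_kernel_denom hol_g hol_g'[unfolded g'_def] z s])
  qed
  have "(\<Sum>j\<in>UNIV. deriv (f j) 0 * cnj (deriv (f j) 0)) = 0"
    by (rule no_log_ratio_potential[OF r(1) finite hol_f sepN sepM N0 M0 diag])
  then have "complex_of_real (\<Sum>j\<in>UNIV. (cmod (deriv (f j) 0))\<^sup>2) = 0"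
    by (simp only: of_real_sum complex_norm_square)
  then have "(\<Sum>j\<in>UNIV. (cmod (deriv (f j) 0))\<^sup>2) = 0" by (simp only: of_real_eq_0_iff)
  then have "deriv (f j) 0 = 0" for j by (simp add: sum_nonneg_eq_0_iff)
  then have "?dF 0 $ j = 0" for j using DERIV_imp_deriv[OF df[of 0 j]] r0 by simp
  moreover have "l 0 = z0" by (simp add: vec_eq_iff l_def line_at_def axis_def)
  ultimately have dF0: "frechet_derivative F (at z0) (axis k 1) = 0" by (simp add: vec_eq_iff)
  \<comment> \<open>The differential is identified as a linear map, so that 0 is a second point with
    value 0.\<close>
  obtain a :: "'m \<Rightarrow> (complex, 'd) vec" where "(F has_derivative (\<lambda>v. \<chi> j. \<Sum>i\<in>UNIV. a j $ i * v $ i)) (at z0)"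
    using holomorphic_map_has_derivative[OF F S(2)] by blast
  from frechet_derivative_at[OF this, symmetric] have "frechet_derivative F (at z0) 0 = 0"
    by (simp add: vec_eq_iff)
  then have "axis k (1::complex) = 0" using inj dF0 by (metis injD)
  then show False by (simp add: vec_eq_iff axis_def) (metis zero_neq_one)
qed

theorem corollary1p2:
  shows "\<not> (\<exists>(X :: 'x topology) (A :: ('x, 'd::finite) chart set) \<omega>
            (F :: 'x \<Rightarrow> complex^'m::finite) (G :: 'x \<Rightarrow> complex^'n::{finite,linorder}).
          kaehler_manifold X A \<omega> \<and>
          holomorphic_embedding X A UNIV F \<and>
          isometric_map A \<omega> euclidean_form F \<and>
          holomorphic_embedding X A symmetrized_polydisc G \<and>
          isometric_map A \<omega> (bergman_form symmetrized_polydisc) G)"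
proof (intro notI, elim exE conjE)
  fix X :: "'x topology" and A :: "('x, 'd) chart set" and \<omega>
    and F :: "'x \<Rightarrow> (complex, 'm) vec" and G :: "'x \<Rightarrow> (complex, 'n) vec"
  assume K: "kaehler_manifold X A \<omega>"
    and F: "holomorphic_embedding X A UNIV F" "isometric_map A \<omega> euclidean_form F"
    and G: "holomorphic_embedding X A symmetrized_polydisc G" "isometric_map A \<omega> (bergman_form symmetrized_polydisc) G"
  interpret kaehler_manifold X A \<omega> by (rule K)
  obtain p U \<phi> where U: "(U, \<phi>) \<in> A" "p \<in> U" using nonempty covering by blast
  have UX: "U \<subseteq> topspace X" using chart_dom[OF U(1)] openin_subset by blast
  let ?F = "F \<circ> inv_into U \<phi>" and ?G = "G \<circ> inv_into U \<phi>"
  have GS: "?G z \<in> symmetrized_polydisc" if "z \<in> \<phi> ` U" for z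
    using G(1) UX inv_into_into[OF that] by (auto simp: holomorphic_embedding_def)
  \<comment> \<open>In a chart both pullbacks equal the same local representative
    \<open>\<omega> (U, \<phi>)\<close>.\<close>
  have "pullback_form ?F euclidean_form z = pullback_form ?G (bergman_form symmetrized_polydisc) z" if "z \<in> \<phi> ` U" for z
    using F(2) G(2) U(1) that unfolding isometric_map_def by fastforce
  moreover have "holomorphic_map_on ?F (\<phi> ` U)" "inj (frechet_derivative ?F (at (\<phi> p)))" "holomorphic_map_on ?G (\<phi> ` U)"
    using F(1) G(1) U by (auto simp: holomorphic_embedding_def)
  ultimately show False
    using no_common_disc[of "\<phi> ` U" "\<phi> p" ?F ?G] chart_ran[OF U(1)] U(2) GS by blast
qed

end
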